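(* Let $\mu,\nu\in\{-,0,+\}$ and $\tau\in\mathbb{R}$. The left $U_q(\mu)$-module structure on $A_{\mu\nu}^{\tau}$ restricts to a left $U_q(\mu)$-module structure on $B_{\mu\nu}^{\tau}$, which hence becomes a left $U_q(\mu)$-module $^*$-algebra.
   Context: Fix a real number $0<q<1$ and put $\lambda=(q-q^{-1})^{-1}<0$. The symbols $-,0,+$ stand for the real numbers $-1,0,1$. For $\mu,\nu\in\mathbb{R}$, $U_q(\mu,\nu)$ is the universal unital algebra over $\mathbb{C}$ generated by $K,K^{-1},E,F$ (written $K_{\mu\nu}$, $E_{\mu\nu}$, etc. when indices matter) with relations $K^{-1}K=1=KK^{-1}$, $KE=qEK$, $KF=q^{-1}FK$, $[E,F]=\lambda(\mu K^2-\nu K^{-2})$, with $^*$-structure determined by $K^*=K$, $E^*=F$. For $\mu,\upsilon,\nu\in\mathbb{R}$, $\Delta_{\mu\nu}^{\upsilon}:U_q(\mu,\nu)\to U_q(\mu,\upsilon)\otimes U_q(\upsilon,\nu)$ is the unital $^*$-homomorphism with $\Delta_{\mu\nu}^{\upsilon}(E_{\mu\nu})=E_{\mu\upsilon}\otimes K_{\upsilon\nu}+K_{\mu\upsilon}^{-1}\otimes E_{\upsilon\nu}$, $\Delta_{\mu\nu}^{\upsilon}(K_{\mu\nu})=K_{\mu\upsilon}\otimes K_{\upsilon\nu}$; write $\Delta_{\mu\nu}^\upsilon(x)=x_{(1)\mu\upsilon}\otimes x_{(2)\upsilon\nu}$ (Sweedler notation). $U_q(\mu):=U_q(\mu,\mu)$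 is a Hopf $^*$-algebra with comultiplication $\Delta_{\mu\mu}^\mu$. $S_{\mu\nu}:U_q(\mu,\nu)\to U_q(\nu,\mu)$ is the unital bijective anti-homomorphism with $S_{\mu\nu}(E_{\mu\nu})=-qE_{\nu\mu}$, $S_{\mu\nu}(F_{\mu\nu})=-q^{-1}F_{\nu\mu}$, $S_{\mu\nu}(K_{\mu\nu})=K_{\nu\mu}^{-1}$; $S_{\mu\mu}$ is the antipode of $U_q(\mu)$. The left Miyashita-Ulbrich action of $U_q(\mu)$ on $U_q(\mu,\nu)$ is $x\rhd y=x_{(1)\mu\nu}\,y\,S_{\nu\mu}(x_{(2)\nu\mu})$ for $x\in U_q(\mu)$, $y\in U_q(\mu,\nu)$. A left module $^*$-algebra for a Hopf $^*$-algebra $H$ with antipode $S$ is a unital $^*$-algebra $A$ with a left $H$-module structure $\rhd$ such that $x\rhd(yz)=(x_{(1)}\rhd y)(x_{(2)}\rhd z)$, $x\rhd1=\varepsilon(x)1$ and $x\rhd(y^* )=((S(x)^* )\rhd y)^*$. The Casimir element of $U_q(\mu,\nu)$ is the central self-adjoint element $C_{\mu\nu}=EF+\lambda^2(q^{-1}\mu K^2+q\nu K^{-2})$. For $\tau\in\mathbb{R}$, $A_{\mu\nu}^\tau=U_q(\mu,\nu)/(C_{\mu\nu}-\tau q^{-1}\lambda^2 1)$ with quotient map $\pi_\tau$; it carries the left $U_q(\mu)$-module $^*$-algebra structure determined by $x\rhd\pi_\tau(y)=\pi_\tau(x\rhd y)$. $B_{\mu\nu}^\tau$ is the unital sub-$^*$-algebra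 of $A_{\mu\nu}^\tau$ generated by $\pi_\tau(K_{\mu\nu}^2)$ and $\pi_\tau(K_{\mu\nu}E_{\mu\nu})$. *)

theory Defs
  imports "HOL-Algebra.Module" "HOL-Algebra.QuotRing" "HOL-Library.Poly_Mapping" Complex_Main
begin

section \<open>Complex unital $*$-algebras\<close>

record 'a star_algebra = "(complex, 'a) module" +
  star :: "'a \<Rightarrow> 'a"

definition complex_algebra :: "complex star_algebra" where
  "complex_algebra =
     \<lparr>carrier = UNIV, mult = (*), one = 1, zero = 0, add = (+), smult = (*), star = cnj\<rparr>"

locale complex_star_algebra = ring A + Module.module complex_algebra A for A (structure) +
  assumes smult_mult_left: "\<lbrakk>x \<in> carrier A; y \<in> carrier A\<rbrakk> \<Longrightarrow> (c \<odot> x) \<otimes> y = c \<odot> (x \<otimes> y)"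
    and smult_mult_right: "\<lbrakk>x \<in> carrier A; y \<in> carrier A\<rbrakk> \<Longrightarrow> x \<otimes> (c \<odot> y) = c \<odot> (x \<otimes> y)"
    and star_closed: "x \<in> carrier A \<Longrightarrow> star A x \<in> carrier A"
    and star_star: "x \<in> carrier A \<Longrightarrow> star A (star A x) = x"
    and star_add: "\<lbrakk>x \<in> carrier A; y \<in> carrier A\<rbrakk> \<Longrightarrow> star A (x \<oplus> y) = star A x \<oplus> star A y"
    and star_smult: "x \<in> carrier A \<Longrightarrow> star A (c \<odot> x) = cnj c \<odot> star A x"
    and star_mult: "\<lbrakk>x \<in> carrier A; y \<in> carrier A\<rbrakk> \<Longrightarrow> star A (x \<otimes> y) = star A y \<otimes> star A x"

text \<open>Membership in \<^const>\<open>ring_hom\<close> includes preservation of the unit. Homomorphisms are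
  required to be extensional so that they are determined by their values on the carrier.\<close>

definition algebra_hom ::
  "('a, 'r) star_algebra_scheme \<Rightarrow> ('b, 's) star_algebra_scheme \<Rightarrow> ('a \<Rightarrow> 'b) set" where
  "algebra_hom A B = {f \<in> ring_hom A B. f \<in> extensional (carrier A) \<and>
     (\<forall>c. \<forall>x \<in> carrier A. f (c \<odot>\<^bsub>A\<^esub> x) = c \<odot>\<^bsub>B\<^esub> f x)}"

definition star_algebra_hom ::
  "('a, 'r) star_algebra_scheme \<Rightarrow> ('b, 's) star_algebra_scheme \<Rightarrow> ('a \<Rightarrow> 'b) set" where
  "star_algebra_hom A B =
     {f \<in> algebra_hom A B. \<forall>x \<in> carrier A. f (star A x) = star B (f x)}"

definition algebra_antihom ::
  "('a, 'r) star_algebra_scheme \<Rightarrow> ('b, 's) star_algebra_scheme \<Rightarrow> ('a \<Rightarrow> 'b) set" where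
  "algebra_antihom A B = {f \<in> carrier A \<rightarrow>\<^sub>E carrier B.
     f \<one>\<^bsub>A\<^esub> = \<one>\<^bsub>B\<^esub> \<and>
     (\<forall>x \<in> carrier A. \<forall>y \<in> carrier A. f (x \<oplus>\<^bsub>A\<^esub> y) = f x \<oplus>\<^bsub>B\<^esub> f y) \<and>
     (\<forall>x \<in> carrier A. \<forall>y \<in> carrier A. f (x \<otimes>\<^bsub>A\<^esub> y) = f y \<otimes>\<^bsub>B\<^esub> f x) \<and>
     (\<forall>c. \<forall>x \<in> carrier A. f (c \<odot>\<^bsub>A\<^esub> x) = c \<odot>\<^bsub>B\<^esub> f x)}"

definition star_subalgebra :: "'a set \<Rightarrow> ('a, 'r) star_algebra_scheme \<Rightarrow> bool" where
  "star_subalgebra S A \<longleftrightarrow> S \<subseteq> carrier A \<and> \<one>\<^bsub>A\<^esub> \<in> S \<and>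
     (\<forall>x \<in> S. \<forall>y \<in> S. x \<oplus>\<^bsub>A\<^esub> y \<in> S \<and> x \<otimes>\<^bsub>A\<^esub> y \<in> S) \<and>
     (\<forall>c. \<forall>x \<in> S. c \<odot>\<^bsub>A\<^esub> x \<in> S) \<and> (\<forall>x \<in> S. star A x \<in> S)"

definition generated_star_subalgebra :: "('a, 'r) star_algebra_scheme \<Rightarrow> 'a set \<Rightarrow> 'a set" where
  "generated_star_subalgebra A X = \<Inter>{S. star_subalgebra S A \<and> X \<subseteq> S}"

text \<open>The operations on cosets follow \<^const>\<open>rcoset_mult\<close>; they are well defined when
  \<open>I\<close> is a $*$-invariant two-sided ideal.\<close>

definition quotient_star_algebra ::
  "('a, 'r) star_algebra_scheme \<Rightarrow> 'a set \<Rightarrow> 'a set star_algebra" where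
  "quotient_star_algebra A I =
     \<lparr>carrier = carrier (A Quot I), mult = mult (A Quot I), one = one (A Quot I),
      zero = zero (A Quot I), add = add (A Quot I),
      smult = (\<lambda>c X. \<Union>x\<in>X. I +>\<^bsub>A\<^esub> (c \<odot>\<^bsub>A\<^esub> x)),
      star = (\<lambda>X. \<Union>x\<in>X. I +>\<^bsub>A\<^esub> star A x)\<rparr>"

text \<open>The monoid algebra $\mathbb{C}[M]$, with the $*$-structure extending conjugate-linearly
  an anti-multiplicative involution \<open>s\<close> of the monoid.\<close>

definition monoid_star_algebra ::
  "('m, 'r) monoid_scheme \<Rightarrow> ('m \<Rightarrow> 'm) \<Rightarrow> ('m \<Rightarrow>\<^sub>0 complex) star_algebra" where
  "monoid_star_algebra M s =
     \<lparr>carrier = {f. Poly_Mapping.keys f \<subseteq> carrier M},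
      mult = (\<lambda>f g. \<Sum>a\<in>Poly_Mapping.keys f. \<Sum>b\<in>Poly_Mapping.keys g.
        Poly_Mapping.single (a \<otimes>\<^bsub>M\<^esub> b) (Poly_Mapping.lookup f a * Poly_Mapping.lookup g b)),
      one = Poly_Mapping.single \<one>\<^bsub>M\<^esub> 1,
      zero = 0,
      add = (+),
      smult = (\<lambda>c. Poly_Mapping.map ((*) c)),
      star = (\<lambda>f. \<Sum>a\<in>Poly_Mapping.keys f.
        Poly_Mapping.single (s a) (cnj (Poly_Mapping.lookup f a)))\<rparr>"


section \<open>Tensor products\<close>

text \<open>As a vector space, the monoid algebra of the multiplicative monoid $A \times B$ is the free
  vector space on the set $A \times B$, and its multiplication and involution are given on basis
  elements by $(a,b)(a',b') = (aa',bb')$ and $(a,b)^* = (a^*,b^*)$.\<close>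

definition tensor_free ::
  "('a, 'r) star_algebra_scheme \<Rightarrow> ('b, 's) star_algebra_scheme \<Rightarrow>
   ('a \<times> 'b \<Rightarrow>\<^sub>0 complex) star_algebra" where
  "tensor_free A B = monoid_star_algebra (A \<times>\<times> B) (map_prod (star A) (star B))"

text \<open>The linear span of the bilinearity relations.\<close>

inductive_set tensor_null ::
  "('a, 'r) star_algebra_scheme \<Rightarrow> ('b, 's) star_algebra_scheme \<Rightarrow> ('a \<times> 'b \<Rightarrow>\<^sub>0 complex) set"
  for A :: "('a, 'r) star_algebra_scheme" and B :: "('b, 's) star_algebra_scheme" where
  zero: "0 \<in> tensor_null A B"
| add: "\<lbrakk>s \<in> tensor_null A B; t \<in> tensor_null A B\<rbrakk> \<Longrightarrow> s + t \<in> tensor_null A B"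
| smult: "s \<in> tensor_null A B \<Longrightarrow> Poly_Mapping.map ((*) c) s \<in> tensor_null A B"
| add_left: "\<lbrakk>a \<in> carrier A; a' \<in> carrier A; b \<in> carrier B\<rbrakk> \<Longrightarrow>
    Poly_Mapping.single (a \<oplus>\<^bsub>A\<^esub> a', b) 1
      - Poly_Mapping.single (a, b) 1 - Poly_Mapping.single (a', b) 1 \<in> tensor_null A B"
| add_right: "\<lbrakk>a \<in> carrier A; b \<in> carrier B; b' \<in> carrier B\<rbrakk> \<Longrightarrow>
    Poly_Mapping.single (a, b \<oplus>\<^bsub>B\<^esub> b') 1
      - Poly_Mapping.single (a, b) 1 - Poly_Mapping.single (a, b') 1 \<in> tensor_null A B"
| smult_left: "\<lbrakk>a \<in> carrier A; b \<in> carrier B\<rbrakk> \<Longrightarrow>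
    Poly_Mapping.single (c \<odot>\<^bsub>A\<^esub> a, b) 1 - Poly_Mapping.single (a, b) c \<in> tensor_null A B"
| smult_right: "\<lbrakk>a \<in> carrier A; b \<in> carrier B\<rbrakk> \<Longrightarrow>
    Poly_Mapping.single (a, c \<odot>\<^bsub>B\<^esub> b) 1 - Poly_Mapping.single (a, b) c \<in> tensor_null A B"

definition tensor_algebra ::
  "('a, 'r) star_algebra_scheme \<Rightarrow> ('b, 's) star_algebra_scheme \<Rightarrow>
   ('a \<times> 'b \<Rightarrow>\<^sub>0 complex) set star_algebra" where
  "tensor_algebra A B = quotient_star_algebra (tensor_free A B) (tensor_null A B)"

definition pure_tensor ::
  "('a, 'r) star_algebra_scheme \<Rightarrow> ('b, 's) star_algebra_scheme \<Rightarrow> 'a \<Rightarrow> 'b \<Rightarrow>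
   ('a \<times> 'b \<Rightarrow>\<^sub>0 complex) set" where
  "pure_tensor A B a b = tensor_null A B +>\<^bsub>tensor_free A B\<^esub> Poly_Mapping.single (a, b) 1"

text \<open>For a bilinear map \<open>f\<close> from $A \times B$ to \<open>V\<close>, the linear map from $A \otimes B$ to \<open>V\<close>
  that sends $a \otimes b$ to $f(a,b)$: on a coset \<open>t\<close> it is the common value of the linear
  extension of \<open>f\<close> at the representatives of \<open>t\<close>. If $t = \Delta(x)$, this is what Sweedler
  notation writes as $f(x_{(1)}, x_{(2)})$.\<close>

definition tensor_lift ::
  "('v, 'r) star_algebra_scheme \<Rightarrow> ('a \<Rightarrow> 'b \<Rightarrow> 'v) \<Rightarrow> ('a \<times> 'b \<Rightarrow>\<^sub>0 complex) set \<Rightarrow> 'v" where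
  "tensor_lift V f t = the_elem
     ((\<lambda>s. \<Oplus>\<^bsub>V\<^esub>p\<in>Poly_Mapping.keys s. Poly_Mapping.lookup s p \<odot>\<^bsub>V\<^esub> f (fst p) (snd p)) ` t)"


section \<open>Left module $*$-algebras\<close>

locale left_module_over =
  fixes H :: "('h, 'r) star_algebra_scheme"
    and A :: "('a, 's) star_algebra_scheme"
    and act :: "'h \<Rightarrow> 'a \<Rightarrow> 'a"  (infixr \<open>\<rhd>\<close> 75)
  assumes act_closed: "\<lbrakk>x \<in> carrier H; a \<in> carrier A\<rbrakk> \<Longrightarrow> x \<rhd> a \<in> carrier A"
    and act_add_left: "\<lbrakk>x \<in> carrier H; y \<in> carrier H; a \<in> carrier A\<rbrakk> \<Longrightarrow>
      (x \<oplus>\<^bsub>H\<^esub> y) \<rhd> a = (x \<rhd> a) \<oplus>\<^bsub>A\<^esub> (y \<rhd> a)"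
    and act_smult_left: "\<lbrakk>x \<in> carrier H; a \<in> carrier A\<rbrakk> \<Longrightarrow>
      (c \<odot>\<^bsub>H\<^esub> x) \<rhd> a = c \<odot>\<^bsub>A\<^esub> (x \<rhd> a)"
    and act_add_right: "\<lbrakk>x \<in> carrier H; a \<in> carrier A; b \<in> carrier A\<rbrakk> \<Longrightarrow>
      x \<rhd> (a \<oplus>\<^bsub>A\<^esub> b) = (x \<rhd> a) \<oplus>\<^bsub>A\<^esub> (x \<rhd> b)"
    and act_smult_right: "\<lbrakk>x \<in> carrier H; a \<in> carrier A\<rbrakk> \<Longrightarrow>
      x \<rhd> (c \<odot>\<^bsub>A\<^esub> a) = c \<odot>\<^bsub>A\<^esub> (x \<rhd> a)"
    and act_one: "a \<in> carrier A \<Longrightarrow> \<one>\<^bsub>H\<^esub> \<rhd> a = a"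
    and act_mult: "\<lbrakk>x \<in> carrier H; y \<in> carrier H; a \<in> carrier A\<rbrakk> \<Longrightarrow>
      (x \<otimes>\<^bsub>H\<^esub> y) \<rhd> a = x \<rhd> (y \<rhd> a)"

text \<open>The Hopf $*$-algebra enters as the $*$-algebra \<open>H\<close> together with its comultiplication
  (with values in \<^term>\<open>tensor_algebra H H\<close>), counit and antipode.\<close>

locale left_module_star_algebra = complex_star_algebra A + left_module_over H A act
  for H :: "('h, 'r) star_algebra_scheme"
    and comult :: "'h \<Rightarrow> ('h \<times> 'h \<Rightarrow>\<^sub>0 complex) set"
    and counit :: "'h \<Rightarrow> complex"
    and antipode :: "'h \<Rightarrow> 'h"
    and A :: "('a, 's) star_algebra_scheme"
    and act :: "'h \<Rightarrow> 'a \<Rightarrow> 'a"  (infixr \<open>\<rhd>\<close> 75) +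
  assumes act_product: "\<lbrakk>x \<in> carrier H; a \<in> carrier A; b \<in> carrier A\<rbrakk> \<Longrightarrow>
      x \<rhd> (a \<otimes>\<^bsub>A\<^esub> b) = tensor_lift A (\<lambda>x1 x2. (x1 \<rhd> a) \<otimes>\<^bsub>A\<^esub> (x2 \<rhd> b)) (comult x)"
    and act_unit: "x \<in> carrier H \<Longrightarrow> x \<rhd> \<one>\<^bsub>A\<^esub> = counit x \<odot>\<^bsub>A\<^esub> \<one>\<^bsub>A\<^esub>"
    and act_star: "\<lbrakk>x \<in> carrier H; a \<in> carrier A\<rbrakk> \<Longrightarrow>
      x \<rhd> star A a = star A (star H (antipode x) \<rhd> a)"


section \<open>The algebras $U_q(\mu,\nu)$\<close>

datatype generator = GK | GKinv | GE | GF

fun generator_star :: "generator \<Rightarrow> generator" where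
  "generator_star GK = GK"
| "generator_star GKinv = GKinv"
| "generator_star GE = GF"
| "generator_star GF = GE"

definition word_monoid :: "generator list monoid" where
  "word_monoid = \<lparr>carrier = UNIV, mult = (@), one = []\<rparr>"

definition free_star_algebra :: "(generator list \<Rightarrow>\<^sub>0 complex) star_algebra" where
  "free_star_algebra = monoid_star_algebra word_monoid (\<lambda>w. rev (map generator_star w))"

definition lam :: "real \<Rightarrow> real" where
  "lam q = inverse (q - inverse q)"

abbreviation word :: "generator list \<Rightarrow> real \<Rightarrow> generator list \<Rightarrow>\<^sub>0 complex" where
  "word w c \<equiv> Poly_Mapping.single w (complex_of_real c)"

definition Uq_relators :: "real \<Rightarrow> real \<Rightarrow> real \<Rightarrow> (generator list \<Rightarrow>\<^sub>0 complex) set" where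
  "Uq_relators q \<mu> \<nu> =
     {word [GKinv, GK] 1 - word [] 1,
      word [GK, GKinv] 1 - word [] 1,
      word [GK, GE] 1 - word [GE, GK] q,
      word [GK, GF] 1 - word [GF, GK] (inverse q),
      word [GE, GF] 1 - word [GF, GE] 1
        - (word [GK, GK] (lam q * \<mu>) - word [GKinv, GKinv] (lam q * \<nu>))}"

definition Uq_ideal :: "real \<Rightarrow> real \<Rightarrow> real \<Rightarrow> (generator list \<Rightarrow>\<^sub>0 complex) set" where
  "Uq_ideal q \<mu> \<nu> = Idl\<^bsub>free_star_algebra\<^esub> (Uq_relators q \<mu> \<nu>)"

type_synonym Uq_elem = "(generator list \<Rightarrow>\<^sub>0 complex) set"

definition Uq :: "real \<Rightarrow> real \<Rightarrow> real \<Rightarrow> Uq_elem star_algebra" where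
  "Uq q \<mu> \<nu> = quotient_star_algebra free_star_algebra (Uq_ideal q \<mu> \<nu>)"

definition Uq_gen :: "real \<Rightarrow> real \<Rightarrow> real \<Rightarrow> generator \<Rightarrow> Uq_elem" where
  "Uq_gen q \<mu> \<nu> g = Uq_ideal q \<mu> \<nu> +>\<^bsub>free_star_algebra\<^esub> word [g] 1"

abbreviation UK :: "real \<Rightarrow> real \<Rightarrow> real \<Rightarrow> Uq_elem" where "UK q \<mu> \<nu> \<equiv> Uq_gen q \<mu> \<nu> GK"
abbreviation UKinv :: "real \<Rightarrow> real \<Rightarrow> real \<Rightarrow> Uq_elem" where "UKinv q \<mu> \<nu> \<equiv> Uq_gen q \<mu> \<nu> GKinv"
abbreviation UE :: "real \<Rightarrow> real \<Rightarrow> real \<Rightarrow> Uq_elem" where "UE q \<mu> \<nu> \<equiv> Uq_gen q \<mu> \<nu> GE"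
abbreviation UF :: "real \<Rightarrow> real \<Rightarrow> real \<Rightarrow> Uq_elem" where "UF q \<mu> \<nu> \<equiv> Uq_gen q \<mu> \<nu> GF"

text \<open>\<open>Uq_comult q \<mu> \<upsilon> \<nu>\<close> is $\Delta_{\mu\nu}^{\upsilon}$.\<close>

definition Uq_comult ::
  "real \<Rightarrow> real \<Rightarrow> real \<Rightarrow> real \<Rightarrow> Uq_elem \<Rightarrow> (Uq_elem \<times> Uq_elem \<Rightarrow>\<^sub>0 complex) set" where
  "Uq_comult q \<mu> \<upsilon> \<nu> =
     (let T = tensor_algebra (Uq q \<mu> \<upsilon>) (Uq q \<upsilon> \<nu>);
          tens = pure_tensor (Uq q \<mu> \<upsilon>) (Uq q \<upsilon> \<nu>)
      in THE f. f \<in> star_algebra_hom (Uq q \<mu> \<nu>) T \<and>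
           f (UE q \<mu> \<nu>) =
             tens (UE q \<mu> \<upsilon>) (UK q \<upsilon> \<nu>) \<oplus>\<^bsub>T\<^esub> tens (UKinv q \<mu> \<upsilon>) (UE q \<upsilon> \<nu>) \<and>
           f (UK q \<mu> \<nu>) = tens (UK q \<mu> \<upsilon>) (UK q \<upsilon> \<nu>))"

definition Uq_antipode :: "real \<Rightarrow> real \<Rightarrow> real \<Rightarrow> Uq_elem \<Rightarrow> Uq_elem" where
  "Uq_antipode q \<mu> \<nu> = (THE f. f \<in> algebra_antihom (Uq q \<mu> \<nu>) (Uq q \<nu> \<mu>) \<and>
     f (UE q \<mu> \<nu>) = complex_of_real (- q) \<odot>\<^bsub>Uq q \<nu> \<mu>\<^esub> UE q \<nu> \<mu> \<and>
     f (UF q \<mu> \<nu>) = complex_of_real (- inverse q) \<odot>\<^bsub>Uq q \<nu> \<mu>\<^esub> UF q \<nu> \<mu> \<and>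
     f (UK q \<mu> \<nu>) = UKinv q \<nu> \<mu>)"

text \<open>The counit of $U_q(\mu) = U_q(\mu,\mu)$; the values on the generators are forced by the
  counit axioms for $\Delta_{\mu\mu}^{\mu}$.\<close>

definition Uq_counit :: "real \<Rightarrow> real \<Rightarrow> Uq_elem \<Rightarrow> complex" where
  "Uq_counit q \<mu> = (THE f. f \<in> algebra_hom (Uq q \<mu> \<mu>) complex_algebra \<and>
     f (UE q \<mu> \<mu>) = 0 \<and> f (UF q \<mu> \<mu>) = 0 \<and> f (UK q \<mu> \<mu>) = 1)"

text \<open>The left Miyashita-Ulbrich action of $U_q(\mu)$ on $U_q(\mu,\nu)$.\<close>

definition MU_action :: "real \<Rightarrow> real \<Rightarrow> real \<Rightarrow> Uq_elem \<Rightarrow> Uq_elem \<Rightarrow> Uq_elem" where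
  "MU_action q \<mu> \<nu> x y = tensor_lift (Uq q \<mu> \<nu>)
     (\<lambda>x1 x2. x1 \<otimes>\<^bsub>Uq q \<mu> \<nu>\<^esub> y \<otimes>\<^bsub>Uq q \<mu> \<nu>\<^esub> Uq_antipode q \<nu> \<mu> x2) (Uq_comult q \<mu> \<nu> \<mu> x)"


section \<open>The quotients $A_{\mu\nu}^{\tau}$ and the subalgebras $B_{\mu\nu}^{\tau}$\<close>

definition casimir :: "real \<Rightarrow> real \<Rightarrow> real \<Rightarrow> Uq_elem" where
  "casimir q \<mu> \<nu> = (let U = Uq q \<mu> \<nu> in
     (UE q \<mu> \<nu> \<otimes>\<^bsub>U\<^esub> UF q \<mu> \<nu>) \<oplus>\<^bsub>U\<^esub>
     complex_of_real ((lam q)\<^sup>2) \<odot>\<^bsub>U\<^esub>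
       ((complex_of_real (inverse q * \<mu>) \<odot>\<^bsub>U\<^esub> (UK q \<mu> \<nu> \<otimes>\<^bsub>U\<^esub> UK q \<mu> \<nu>)) \<oplus>\<^bsub>U\<^esub>
        (complex_of_real (q * \<nu>) \<odot>\<^bsub>U\<^esub> (UKinv q \<mu> \<nu> \<otimes>\<^bsub>U\<^esub> UKinv q \<mu> \<nu>))))"

definition casimir_ideal :: "real \<Rightarrow> real \<Rightarrow> real \<Rightarrow> real \<Rightarrow> Uq_elem set" where
  "casimir_ideal q \<mu> \<nu> \<tau> = (let U = Uq q \<mu> \<nu> in
     Idl\<^bsub>U\<^esub> {casimir q \<mu> \<nu> \<ominus>\<^bsub>U\<^esub> complex_of_real (\<tau> * inverse q * (lam q)\<^sup>2) \<odot>\<^bsub>U\<^esub> \<one>\<^bsub>U\<^esub>})"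

definition A_algebra :: "real \<Rightarrow> real \<Rightarrow> real \<Rightarrow> real \<Rightarrow> Uq_elem set star_algebra" where
  "A_algebra q \<mu> \<nu> \<tau> = quotient_star_algebra (Uq q \<mu> \<nu>) (casimir_ideal q \<mu> \<nu> \<tau>)"

definition A_proj :: "real \<Rightarrow> real \<Rightarrow> real \<Rightarrow> real \<Rightarrow> Uq_elem \<Rightarrow> Uq_elem set" where
  "A_proj q \<mu> \<nu> \<tau> y = casimir_ideal q \<mu> \<nu> \<tau> +>\<^bsub>Uq q \<mu> \<nu>\<^esub> y"

text \<open>The action on $A_{\mu\nu}^{\tau}$ determined by $x \rhd \pi_\tau(y) = \pi_\tau(x \rhd y)$,
  where \<open>y\<close> ranges over all representatives of the coset \<open>Y\<close>.\<close>

definition A_action ::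
  "real \<Rightarrow> real \<Rightarrow> real \<Rightarrow> real \<Rightarrow> Uq_elem \<Rightarrow> Uq_elem set \<Rightarrow> Uq_elem set" where
  "A_action q \<mu> \<nu> \<tau> x Y = (\<Union>y\<in>Y. A_proj q \<mu> \<nu> \<tau> (MU_action q \<mu> \<nu> x y))"

definition B_carrier :: "real \<Rightarrow> real \<Rightarrow> real \<Rightarrow> real \<Rightarrow> Uq_elem set set" where
  "B_carrier q \<mu> \<nu> \<tau> = (let U = Uq q \<mu> \<nu> in
     generated_star_subalgebra (A_algebra q \<mu> \<nu> \<tau>)
       {A_proj q \<mu> \<nu> \<tau> (UK q \<mu> \<nu> \<otimes>\<^bsub>U\<^esub> UK q \<mu> \<nu>),
        A_proj q \<mu> \<nu> \<tau> (UK q \<mu> \<nu> \<otimes>\<^bsub>U\<^esub> UE q \<mu> \<nu>)})"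

definition B_algebra :: "real \<Rightarrow> real \<Rightarrow> real \<Rightarrow> real \<Rightarrow> Uq_elem set star_algebra" where
  "B_algebra q \<mu> \<nu> \<tau> = (A_algebra q \<mu> \<nu> \<tau>)\<lparr>carrier := B_carrier q \<mu> \<nu> \<tau>\<rparr>"

end

theory Submission
  imports Defs
begin

text \<open>The action is determined by the generators of $U_q(\mu)$: \<open>x = K, E, F\<close> act on
  $U_q(\mu,\nu)$ as $y \mapsto KyK^{-1}$, $EyK^{-1} - qK^{-1}yE$ and $FyK^{-1} - q^{-1}K^{-1}yF$.
  Hence every axiom of a module $*$-algebra follows for all \<open>x\<close> by induction on words, once it is
  checked on generators, and these operations preserve every two-sided ideal, in particular the one
  generated by the Casimir relation. The elements of $B_{\mu\nu}^\tau$ that all generators map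
  into $B_{\mu\nu}^\tau$ form a $*$-subalgebra, so it suffices to act on $K^2$ and $KE$. The
  only case in which the Casimir relation is needed is
  $F \rhd KE = qFE - q^{-1}EF$, where it makes the $K^{-2}$ terms cancel.\<close>

section \<open>Complex unital $*$-algebras\<close>

text \<open>Delta, S and epsilon are given by \<open>THE\<close>, and the elements of tensor
  products, of U_q and of A are cosets, so nothing can be evaluated before existence, uniqueness and
  independence of representatives are settled. A single universal property does this for the three
  maps: a family in a *-algebra that satisfies the defining relations (\<open>Uq_rep\<close>)
  induces a unique homomorphism. The targets are the tensor product for Delta, the opposite algebra
  for S and the complex numbers for epsilon. Since A satisfies the same relations, the identities
  for the operators of the generators are proved once and hold in U_q(mu,nu) and in A. The induction
  on words passes from x to zx. It works for the star axiom because S and the star both reverse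
  products, so that x -> S(x)^* is multiplicative. Why the K^{-2} terms cancel: substituting the
  Casimir value of EF and the commutator into qFE - q^{-1}EF gives K^{-2} the coefficient q lambda
  nu (1 - lambda (q - q^{-1})), which vanishes by the choice of lambda. This matters because K^{-2}
  is not among the generators of B.\<close>

lemma cring_complex_algebra: "cring complex_algebra"
proof (rule cringI)
  show "abelian_group complex_algebra"
    by (rule abelian_groupI) (auto simp: complex_algebra_def intro: exI[of _ "- x" for x] add.left_inverse)
  show "Group.comm_monoid complex_algebra"
    by (rule comm_monoidI) (auto simp: complex_algebra_def)
qed (auto simp: complex_algebra_def algebra_simps)

text \<open>The locale takes its vector space axioms from the record \<open>complex_algebra\<close>.
  Here they become identities with plain complex scalars, the form in which every concrete algebra
  below is verified.\<close>

lemma complex_star_algebraI: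
  assumes "ring A"
    and "\<And>c x. x \<in> carrier A \<Longrightarrow> c \<odot>\<^bsub>A\<^esub> x \<in> carrier A"
    and "\<And>c d x. x \<in> carrier A \<Longrightarrow> (c + d) \<odot>\<^bsub>A\<^esub> x = c \<odot>\<^bsub>A\<^esub> x \<oplus>\<^bsub>A\<^esub> d \<odot>\<^bsub>A\<^esub> x"
    and "\<And>c x y. \<lbrakk>x \<in> carrier A; y \<in> carrier A\<rbrakk> \<Longrightarrow> c \<odot>\<^bsub>A\<^esub> (x \<oplus>\<^bsub>A\<^esub> y) = c \<odot>\<^bsub>A\<^esub> x \<oplus>\<^bsub>A\<^esub> c \<odot>\<^bsub>A\<^esub> y"
    and "\<And>c d x. x \<in> carrier A \<Longrightarrow> (c * d) \<odot>\<^bsub>A\<^esub> x = c \<odot>\<^bsub>A\<^esub> (d \<odot>\<^bsub>A\<^esub> x)"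
    and "\<And>x. x \<in> carrier A \<Longrightarrow> 1 \<odot>\<^bsub>A\<^esub> x = x"
    and "\<And>c x y. \<lbrakk>x \<in> carrier A; y \<in> carrier A\<rbrakk> \<Longrightarrow> (c \<odot>\<^bsub>A\<^esub> x) \<otimes>\<^bsub>A\<^esub> y = c \<odot>\<^bsub>A\<^esub> (x \<otimes>\<^bsub>A\<^esub> y)"
    and "\<And>c x y. \<lbrakk>x \<in> carrier A; y \<in> carrier A\<rbrakk> \<Longrightarrow> x \<otimes>\<^bsub>A\<^esub> (c \<odot>\<^bsub>A\<^esub> y) = c \<odot>\<^bsub>A\<^esub> (x \<otimes>\<^bsub>A\<^esub> y)"
    and "\<And>x. x \<in> carrier A \<Longrightarrow> star A x \<in> carrier A"
    and "\<And>x. x \<in> carrier A \<Longrightarrow> star A (star A x) = x"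
    and "\<And>x y. \<lbrakk>x \<in> carrier A; y \<in> carrier A\<rbrakk> \<Longrightarrow> star A (x \<oplus>\<^bsub>A\<^esub> y) = star A x \<oplus>\<^bsub>A\<^esub> star A y"
    and "\<And>c x. x \<in> carrier A \<Longrightarrow> star A (c \<odot>\<^bsub>A\<^esub> x) = cnj c \<odot>\<^bsub>A\<^esub> star A x"
    and "\<And>x y. \<lbrakk>x \<in> carrier A; y \<in> carrier A\<rbrakk> \<Longrightarrow> star A (x \<otimes>\<^bsub>A\<^esub> y) = star A y \<otimes>\<^bsub>A\<^esub> star A x"
  shows "complex_star_algebra A"
proof -
  interpret A: ring A by fact
  have "Module.module complex_algebra A"
    by (rule moduleI)
      (use assms A.abelian_group_axioms cring_complex_algebra in \<open>auto simp: complex_algebra_def\<close>)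
  then show ?thesis
    by (intro complex_star_algebra.intro complex_star_algebra_axioms.intro A.ring_axioms)
       (use assms in auto)
qed

section \<open>Arithmetic with complex coefficients in a *-algebra\<close>

context complex_star_algebra
begin

lemma alg_ring: "ring A"
  by unfold_locales

lemmas alg_add_assoc = ring.ring_simprules(7)[OF alg_ring]
lemmas alg_add_comm = ring.ring_simprules(10)[OF alg_ring]
lemmas alg_mult_assoc = ring.ring_simprules(11)[OF alg_ring]
lemmas alg_l_distr = ring.ring_simprules(13)[OF alg_ring]
lemmas alg_add_lcomm = ring.ring_simprules(22)[OF alg_ring]
lemmas alg_r_distr = ring.ring_simprules(23)[OF alg_ring]
lemmas alg_add_ac = alg_add_assoc alg_add_comm alg_add_lcomm
lemmas alg_abelian = ring.is_abelian_group[OF alg_ring]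

lemma alg_smult_closed [simp]: "x \<in> carrier A \<Longrightarrow> c \<odot> x \<in> carrier A"
  using smult_closed[of c x] by (simp add: complex_algebra_def)

lemma alg_smult_add_left: "x \<in> carrier A \<Longrightarrow> (c + d) \<odot> x = c \<odot> x \<oplus> d \<odot> x"
  using smult_l_distr[of c d x] by (simp add: complex_algebra_def)

lemma alg_smult_add_right:
  "\<lbrakk>x \<in> carrier A; y \<in> carrier A\<rbrakk> \<Longrightarrow> c \<odot> (x \<oplus> y) = c \<odot> x \<oplus> c \<odot> y"
  using smult_r_distr[of c x y] by (simp add: complex_algebra_def)

lemma alg_smult_smult [simp]: "x \<in> carrier A \<Longrightarrow> c \<odot> (d \<odot> x) = (c * d) \<odot> x"
  using smult_assoc1[of c d x] by (simp add: complex_algebra_def)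

lemma alg_smult_one [simp]: "x \<in> carrier A \<Longrightarrow> 1 \<odot> x = x"
  using smult_one[of x] by (simp add: complex_algebra_def)

lemma alg_smult_zero_left [simp]: "x \<in> carrier A \<Longrightarrow> 0 \<odot> x = \<zero>"
  using smult_l_null[of x] by (simp add: complex_algebra_def)

lemma alg_smult_zero_right [simp]: "c \<odot> \<zero> = \<zero>"
  using smult_r_null[of c] by (simp add: complex_algebra_def)

text \<open>With negation expressed by the scalar -1, sums can be normalised by collecting
  coefficients, and subtraction disappears from the normal forms.\<close>

lemma alg_uminus_eq_smult: "x \<in> carrier A \<Longrightarrow> \<ominus> x = (- 1) \<odot> x"
proof -
  assume x: "x \<in> carrier A"
  have "(- 1) \<odot> x \<oplus> x = (- 1 + 1) \<odot> x"
    using x by (subst alg_smult_add_left) auto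
  then have "(- 1) \<odot> x \<oplus> x = \<zero>" using x by simp
  then show ?thesis
    using x abelian_group.minus_equality[OF alg_abelian] by simp
qed

lemma alg_minus_eq_smult:
  "\<lbrakk>x \<in> carrier A; y \<in> carrier A\<rbrakk> \<Longrightarrow> x \<ominus> y = x \<oplus> (- 1) \<odot> y"
  by (simp add: a_minus_def alg_uminus_eq_smult)

lemmas alg_l_one [simp] = monoid.l_one[OF ring.is_monoid[OF alg_ring]]
lemmas alg_r_one [simp] = monoid.r_one[OF ring.is_monoid[OF alg_ring]]
lemmas alg_l_zero [simp] = ring.ring_simprules(8)[OF alg_ring]
lemmas alg_r_zero [simp] = ring.ring_simprules(15)[OF alg_ring]
lemmas alg_l_null [simp] = ring.ring_simprules(24)[OF alg_ring]
lemmas alg_r_null [simp] = ring.ring_simprules(25)[OF alg_ring]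

lemma alg_eqI:
  assumes "x \<in> carrier A" "y \<in> carrier A" "x \<oplus> (- 1) \<odot> y = \<zero>"
  shows "x = y"
  using assms abelian_group.minus_equality[OF alg_abelian, of x "\<ominus> y"]
  by (simp add: alg_uminus_eq_smult)

lemma alg_cancel: "x \<in> carrier A \<Longrightarrow> x \<oplus> (- 1) \<odot> x = \<zero>"
  using alg_smult_add_left[of x 1 "- 1"] by simp

lemma alg_cancel_right:
  "x \<in> carrier A \<Longrightarrow> c \<odot> x \<oplus> (- c) \<odot> x = \<zero>"
  "x \<in> carrier A \<Longrightarrow> (- c) \<odot> x \<oplus> c \<odot> x = \<zero>"
  by (simp_all flip: alg_smult_add_left)

lemma alg_cancel_left:
  "\<lbrakk>x \<in> carrier A; y \<in> carrier A\<rbrakk> \<Longrightarrow> c \<odot> x \<oplus> ((- c) \<odot> x \<oplus> y) = y"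
  "\<lbrakk>x \<in> carrier A; y \<in> carrier A\<rbrakk> \<Longrightarrow> (- c) \<odot> x \<oplus> (c \<odot> x \<oplus> y) = y"
  by (simp_all flip: alg_add_assoc alg_smult_add_left)

text \<open>Sorting a sum with \<open>alg_add_ac\<close> may leave one summand between two opposite
  terms; these rules cancel such pairs.\<close>

lemma alg_cancel_inner:
  "\<lbrakk>x \<in> carrier A; y \<in> carrier A\<rbrakk> \<Longrightarrow> c \<odot> x \<oplus> (y \<oplus> (- c) \<odot> x) = y"
  "\<lbrakk>x \<in> carrier A; y \<in> carrier A; z \<in> carrier A\<rbrakk> \<Longrightarrow> c \<odot> x \<oplus> (y \<oplus> ((- c) \<odot> x \<oplus> z)) = y \<oplus> z"
  using alg_add_lcomm[of "c \<odot> x" y "(- c) \<odot> x"] alg_add_lcomm[of "c \<odot> x" y "(- c) \<odot> x \<oplus> z"]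
  by (simp_all add: alg_cancel_right alg_cancel_left)

text \<open>The form of the [E,F] relator after EF has been expanded by its commutation relation:
  \<open>a\<close> stands for FE, \<open>x\<close> and \<open>y\<close> for K^2 and K^{-2}.\<close>

lemma alg_cancel3:
  assumes "a \<in> carrier A" "x \<in> carrier A" "y \<in> carrier A"
  shows "a \<oplus> c \<odot> x \<oplus> (- d) \<odot> y \<oplus> (- 1) \<odot> a \<oplus> ((- c) \<odot> x \<oplus> d \<odot> y) = \<zero>"
  using assms alg_cancel[of "a \<oplus> c \<odot> x \<oplus> (- d) \<odot> y"]
  by (simp add: alg_smult_add_right alg_add_assoc)

text \<open>Coordinates in the span of three elements, later 1, K^2 and K^{-2}, in terms of which
  both EF and FE are expressed in A.\<close>

lemma alg_combine3:
  assumes "x \<in> carrier A" "y \<in> carrier A" "z \<in> carrier A"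
  shows "c \<odot> (a0 \<odot> x \<oplus> a1 \<odot> y \<oplus> a2 \<odot> z) \<oplus> d \<odot> (b0 \<odot> x \<oplus> b1 \<odot> y \<oplus> b2 \<odot> z)
    = (c * a0 + d * b0) \<odot> x \<oplus> (c * a1 + d * b1) \<odot> y \<oplus> (c * a2 + d * b2) \<odot> z"
  using assms by (simp add: alg_smult_add_right alg_smult_add_left alg_add_ac)

lemma alg_combine2:
  assumes "x \<in> carrier A" "y \<in> carrier A" "z \<in> carrier A"
  shows "x \<oplus> a1 \<odot> y \<oplus> a2 \<odot> z \<oplus> b1 \<odot> y \<oplus> b2 \<odot> z = x \<oplus> (a1 + b1) \<odot> y \<oplus> (a2 + b2) \<odot> z"
  using assms by (simp add: alg_smult_add_left alg_add_ac)

lemma alg_move3: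
  assumes "x \<oplus> c \<odot> y \<oplus> d \<odot> z = w" "x \<in> carrier A" "y \<in> carrier A" "z \<in> carrier A"
  shows "x = w \<oplus> (- c) \<odot> y \<oplus> (- d) \<odot> z"
  unfolding assms(1)[symmetric] using assms(2-)
  by (simp add: alg_add_ac alg_cancel_left alg_cancel_inner alg_cancel_right)

lemmas alg_star_simps [simp] = star_closed star_star star_add star_smult star_mult

lemma alg_star_zero [simp]: "star A \<zero> = \<zero>"
  using star_smult[of \<zero> 0] by simp

text \<open>By anti-multiplicativity (star 1) 1 is selfadjoint, and it equals star 1; hence star 1 =
  star (star 1) = 1.\<close>

lemma alg_star_one [simp]: "star A \<one> = \<one>"
proof -
  have "star A (star A \<one> \<otimes> \<one>) = star A \<one> \<otimes> \<one>"
    by (subst star_mult) simp_all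
  moreover have "star A \<one> \<otimes> \<one> = star A \<one>"
    by (rule monoid.r_one[OF ring.is_monoid[OF alg_ring]]) simp
  ultimately show ?thesis
    by simp
qed

end

text \<open>In contrast to \<open>algebra_hom\<close>, extensionality is not imposed, so lambda
  terms such as \<open>\<lambda>x. act x v\<close> are members without being restricted to the
  carrier.\<close>

definition linear_maps ::
  "('a, 'r) star_algebra_scheme \<Rightarrow> ('b, 's) star_algebra_scheme \<Rightarrow> ('a \<Rightarrow> 'b) set" where
  "linear_maps V W = {h \<in> carrier V \<rightarrow> carrier W.
     (\<forall>x\<in>carrier V. \<forall>y\<in>carrier V. h (x \<oplus>\<^bsub>V\<^esub> y) = h x \<oplus>\<^bsub>W\<^esub> h y) \<and>
     (\<forall>c. \<forall>x\<in>carrier V. h (c \<odot>\<^bsub>V\<^esub> x) = c \<odot>\<^bsub>W\<^esub> h x)}"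

lemma linear_mapsI:
  assumes "\<And>x. x \<in> carrier V \<Longrightarrow> h x \<in> carrier W"
    and "\<And>x y. \<lbrakk>x \<in> carrier V; y \<in> carrier V\<rbrakk> \<Longrightarrow> h (x \<oplus>\<^bsub>V\<^esub> y) = h x \<oplus>\<^bsub>W\<^esub> h y"
    and "\<And>c x. x \<in> carrier V \<Longrightarrow> h (c \<odot>\<^bsub>V\<^esub> x) = c \<odot>\<^bsub>W\<^esub> h x"
  shows "h \<in> linear_maps V W"
  using assms by (auto simp: linear_maps_def)

lemma
  assumes "h \<in> linear_maps V W"
  shows linear_maps_closed: "x \<in> carrier V \<Longrightarrow> h x \<in> carrier W"
    and linear_maps_add: "\<lbrakk>x \<in> carrier V; y \<in> carrier V\<rbrakk> \<Longrightarrow> h (x \<oplus>\<^bsub>V\<^esub> y) = h x \<oplus>\<^bsub>W\<^esub> h y"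
    and linear_maps_smult: "x \<in> carrier V \<Longrightarrow> h (c \<odot>\<^bsub>V\<^esub> x) = c \<odot>\<^bsub>W\<^esub> h x"
  using assms by (auto simp: linear_maps_def)


section \<open>Formal linear combinations\<close>

abbreviation pm_scale :: "complex \<Rightarrow> ('p \<Rightarrow>\<^sub>0 complex) \<Rightarrow> 'p \<Rightarrow>\<^sub>0 complex" where
  "pm_scale c \<equiv> Poly_Mapping.map ((*) c)"

lemma lookup_pm_scale [simp]:
  "Poly_Mapping.lookup (pm_scale c s) p = c * Poly_Mapping.lookup s p"
  by (auto simp: Poly_Mapping.map.rep_eq when_def)

lemma pm_scale_add: "pm_scale c (s + t) = pm_scale c s + pm_scale c t"
  by (rule poly_mapping_eqI) (simp add: lookup_add algebra_simps)

lemma pm_scale_zero [simp]: "pm_scale c 0 = 0"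
  by (rule poly_mapping_eqI) simp

lemma keys_pm_scale: "Poly_Mapping.keys (pm_scale c s) \<subseteq> Poly_Mapping.keys s"
  by (auto simp: in_keys_iff)

lemma keys_uminus_complex: "Poly_Mapping.keys (- s :: 'p \<Rightarrow>\<^sub>0 complex) = Poly_Mapping.keys s"
  by (auto simp: in_keys_iff)

lemma keys_add_subset:
  "\<lbrakk>Poly_Mapping.keys s \<subseteq> X; Poly_Mapping.keys t \<subseteq> X\<rbrakk> \<Longrightarrow> Poly_Mapping.keys (s + t) \<subseteq> X"
  using Poly_Mapping.keys_add[of s t] by blast

lemma keys_sum_subset:
  "(\<And>i. i \<in> I \<Longrightarrow> Poly_Mapping.keys (f i) \<subseteq> X) \<Longrightarrow> Poly_Mapping.keys (sum f I) \<subseteq> X"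
  by (induction I rule: infinite_finite_induct) (simp_all add: keys_add_subset)

text \<open>The support condition is kept in the addition step because the operations on a monoid
  algebra obey their laws only inside its carrier, the mappings supported in the monoid.\<close>

lemma poly_mapping_span_induct [consumes 1, case_names zero single add]:
  fixes s :: "'p \<Rightarrow>\<^sub>0 complex"
  assumes "Poly_Mapping.keys s \<subseteq> X"
    and zero: "P 0"
    and single: "\<And>p c. p \<in> X \<Longrightarrow> P (Poly_Mapping.single p c)"
    and add: "\<And>s t. \<lbrakk>Poly_Mapping.keys s \<subseteq> X; Poly_Mapping.keys t \<subseteq> X; P s; P t\<rbrakk> \<Longrightarrow> P (s + t)"
  shows "P s"
proof -
  have eq: "s = (\<Sum>p\<in>Poly_Mapping.keys s. Poly_Mapping.single p (Poly_Mapping.lookup s p))"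
  proof (rule poly_mapping_eqI)
    fix k
    have "(\<Sum>p\<in>Poly_Mapping.keys s. Poly_Mapping.lookup s p when p = k) = Poly_Mapping.lookup s k"
      by (simp add: when_def sum.delta in_keys_iff)
    then show "Poly_Mapping.lookup s k = Poly_Mapping.lookup
        (\<Sum>p\<in>Poly_Mapping.keys s. Poly_Mapping.single p (Poly_Mapping.lookup s p)) k"
      by (simp add: lookup_sum lookup_single)
  qed
  have "Poly_Mapping.keys (\<Sum>p\<in>Y. Poly_Mapping.single p (Poly_Mapping.lookup s p)) \<subseteq> X \<and>
      P (\<Sum>p\<in>Y. Poly_Mapping.single p (Poly_Mapping.lookup s p))" if "finite Y" "Y \<subseteq> X" for Y
    using that
  proof (induction Y)
    case (insert y Y)
    then have IH: "Poly_Mapping.keys (\<Sum>p\<in>Y. Poly_Mapping.single p (Poly_Mapping.lookup s p)) \<subseteq> X"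
        "P (\<Sum>p\<in>Y. Poly_Mapping.single p (Poly_Mapping.lookup s p))"
      by auto
    have y: "Poly_Mapping.keys (Poly_Mapping.single y (Poly_Mapping.lookup s y)) \<subseteq> X"
        "P (Poly_Mapping.single y (Poly_Mapping.lookup s y))"
      using insert.prems single by auto
    show ?case
      unfolding sum.insert[OF insert.hyps]
      using keys_add_subset[OF y(1) IH(1)] add[OF y(1) IH(1) y(2) IH(2)] by blast
  qed (use zero in simp)
  then show ?thesis
    using eq assms(1) by (metis finite_keys)
qed

text \<open>The sum inside \<open>tensor_lift\<close>, with an arbitrary index type: over pairs it
  computes lifts from tensor products, over words it evaluates noncommutative polynomials.\<close>

definition linear_extension ::
  "('v, 'r) star_algebra_scheme \<Rightarrow> ('p \<Rightarrow> 'v) \<Rightarrow> ('p \<Rightarrow>\<^sub>0 complex) \<Rightarrow> 'v" where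
  "linear_extension V f s =
     (\<Oplus>\<^bsub>V\<^esub>p\<in>Poly_Mapping.keys s. Poly_Mapping.lookup s p \<odot>\<^bsub>V\<^esub> f p)"

context complex_star_algebra
begin

text \<open>The support of s + t can shrink by cancellation, so additivity has to be proved on a
  common finite superset of the supports.\<close>

lemma linear_extension_superset:
  assumes "finite X" "Poly_Mapping.keys s \<subseteq> X" "\<And>p. p \<in> X \<Longrightarrow> f p \<in> carrier A"
  shows "linear_extension A f s = (\<Oplus>p\<in>X. Poly_Mapping.lookup s p \<odot> f p)"
  unfolding linear_extension_def finsum_def
  by (rule comm_monoid.finprod_mono_neutral_cong_left)
     (use assms in \<open>auto simp: in_keys_iff intro: abelian_monoid.a_comm_monoid
        abelian_group.axioms alg_abelian\<close>)

lemma linear_extension_closed [simp]: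
  assumes "\<And>p. p \<in> Poly_Mapping.keys s \<Longrightarrow> f p \<in> carrier A"
  shows "linear_extension A f s \<in> carrier A"
  unfolding linear_extension_def
  by (rule abelian_monoid.finsum_closed)
     (use assms alg_abelian in \<open>auto intro: abelian_group.axioms\<close>)

lemma linear_extension_zero [simp]: "linear_extension A f 0 = \<zero>"
  by (simp add: linear_extension_def abelian_monoid.finsum_empty[OF abelian_group.axioms(1)[OF alg_abelian]])

lemma linear_extension_single:
  assumes "f p \<in> carrier A"
  shows "linear_extension A f (Poly_Mapping.single p c) = c \<odot> f p"
proof -
  have "linear_extension A f (Poly_Mapping.single p c)
      = (\<Oplus>i\<in>{p}. Poly_Mapping.lookup (Poly_Mapping.single p c) i \<odot> f i)"
    by (rule linear_extension_superset) (use assms in auto)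
  also have "\<dots> = c \<odot> f p \<oplus> \<zero>"
    using assms
    by (subst abelian_monoid.finsum_insert[OF abelian_group.axioms(1)[OF alg_abelian]])
       (auto simp: abelian_monoid.finsum_empty[OF abelian_group.axioms(1)[OF alg_abelian]])
  finally show ?thesis
    using assms by (simp add: ring.ring_simprules[OF alg_ring])
qed

lemma linear_extension_add:
  assumes "\<And>p. p \<in> X \<Longrightarrow> f p \<in> carrier A" "Poly_Mapping.keys s \<subseteq> X" "Poly_Mapping.keys t \<subseteq> X"
  shows "linear_extension A f (s + t) = linear_extension A f s \<oplus> linear_extension A f t"
proof -
  define Y where "Y = Poly_Mapping.keys s \<union> Poly_Mapping.keys t"
  have Y: "finite Y" "Y \<subseteq> X" "\<And>p. p \<in> Y \<Longrightarrow> f p \<in> carrier A" "Poly_Mapping.keys (s + t) \<subseteq> Y"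
    "Poly_Mapping.keys s \<subseteq> Y" "Poly_Mapping.keys t \<subseteq> Y"
    using assms Poly_Mapping.keys_add[of s t] by (auto simp: Y_def)
  have "linear_extension A f (s + t)
      = (\<Oplus>p\<in>Y. (Poly_Mapping.lookup s p + Poly_Mapping.lookup t p) \<odot> f p)"
    using Y by (subst linear_extension_superset[of Y]) (auto simp: lookup_add)
  also have "\<dots> = (\<Oplus>p\<in>Y. Poly_Mapping.lookup s p \<odot> f p \<oplus> Poly_Mapping.lookup t p \<odot> f p)"
    using Y by (intro abelian_monoid.finsum_cong'[OF abelian_group.axioms(1)[OF alg_abelian]])
      (auto simp: alg_smult_add_left Pi_def)
  also have "\<dots> = (\<Oplus>p\<in>Y. Poly_Mapping.lookup s p \<odot> f p) \<oplus> (\<Oplus>p\<in>Y. Poly_Mapping.lookup t p \<odot> f p)"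
    using Y by (intro abelian_monoid.finsum_addf[OF abelian_group.axioms(1)[OF alg_abelian]]) auto
  finally show ?thesis
    using Y by (simp add: linear_extension_superset[of Y])
qed

lemma linear_extension_scale:
  assumes "\<And>p. p \<in> X \<Longrightarrow> f p \<in> carrier A" "Poly_Mapping.keys s \<subseteq> X"
  shows "linear_extension A f (pm_scale c s) = c \<odot> linear_extension A f s"
  using assms(2)
proof (induction rule: poly_mapping_span_induct)
  case (single p d)
  then show ?case
    using assms(1) by (auto simp: linear_extension_single)
next
  case (add s t)
  have "\<And>p. p \<in> Poly_Mapping.keys s \<Longrightarrow> f p \<in> carrier A"
    "\<And>p. p \<in> Poly_Mapping.keys t \<Longrightarrow> f p \<in> carrier A"
    using add assms(1) by auto
  moreover have "Poly_Mapping.keys (pm_scale c s) \<subseteq> X" "Poly_Mapping.keys (pm_scale c t) \<subseteq> X"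
    by (rule order_trans[OF keys_pm_scale add.hyps(1)], rule order_trans[OF keys_pm_scale add.hyps(2)])
  ultimately show ?case
    by (simp only: pm_scale_add linear_extension_add[OF assms(1) add.hyps(1,2)]
        linear_extension_add[OF assms(1)] add.IH alg_smult_add_right linear_extension_closed)
qed simp

end

section \<open>Monoid algebras\<close>

text \<open>Two monoids matter: words under concatenation, with reversal and the exchange of E and
  F, and pairs from A and B, with the componentwise star.\<close>

locale star_monoid = Group.monoid M for M (structure) +
  fixes s :: "'a \<Rightarrow> 'a"
  assumes inv_closed: "a \<in> carrier M \<Longrightarrow> s a \<in> carrier M"
    and inv_inv: "a \<in> carrier M \<Longrightarrow> s (s a) = a"
    and inv_mult: "\<lbrakk>a \<in> carrier M; b \<in> carrier M\<rbrakk> \<Longrightarrow> s (a \<otimes> b) = s b \<otimes> s a"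

lemma monoid_star_algebra_sel [simp]:
  "carrier (monoid_star_algebra M s) = {f. Poly_Mapping.keys f \<subseteq> carrier M}"
  "\<one>\<^bsub>monoid_star_algebra M s\<^esub> = Poly_Mapping.single \<one>\<^bsub>M\<^esub> 1"
  "\<zero>\<^bsub>monoid_star_algebra M s\<^esub> = 0"
  "x \<oplus>\<^bsub>monoid_star_algebra M s\<^esub> y = x + y"
  "c \<odot>\<^bsub>monoid_star_algebra M s\<^esub> x = pm_scale c x"
  by (simp_all add: monoid_star_algebra_def)

lemma monoid_star_algebra_mult_add_left:
  "(f + g) \<otimes>\<^bsub>monoid_star_algebra M s\<^esub> h =
     f \<otimes>\<^bsub>monoid_star_algebra M s\<^esub> h + g \<otimes>\<^bsub>monoid_star_algebra M s\<^esub> h"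
  unfolding monoid_star_algebra_def
  using setsum_keys_plus_distrib[where f = "\<lambda>a c. \<Sum>b\<in>Poly_Mapping.keys h.
      Poly_Mapping.single (a \<otimes>\<^bsub>M\<^esub> b) (c * Poly_Mapping.lookup h b)" and p = f and q = g]
  by (simp add: distrib_right single_add sum.distrib)

lemma monoid_star_algebra_mult_add_right:
  "h \<otimes>\<^bsub>monoid_star_algebra M s\<^esub> (f + g) =
     h \<otimes>\<^bsub>monoid_star_algebra M s\<^esub> f + h \<otimes>\<^bsub>monoid_star_algebra M s\<^esub> g"
proof -
  have "(\<Sum>b\<in>Poly_Mapping.keys (f + g).
        Poly_Mapping.single (a \<otimes>\<^bsub>M\<^esub> b) (c * Poly_Mapping.lookup (f + g) b)) =
      (\<Sum>b\<in>Poly_Mapping.keys f. Poly_Mapping.single (a \<otimes>\<^bsub>M\<^esub> b) (c * Poly_Mapping.lookup f b)) +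
      (\<Sum>b\<in>Poly_Mapping.keys g. Poly_Mapping.single (a \<otimes>\<^bsub>M\<^esub> b) (c * Poly_Mapping.lookup g b))"
    for a c
    using setsum_keys_plus_distrib[where f = "\<lambda>b d. Poly_Mapping.single (a \<otimes>\<^bsub>M\<^esub> b) (c * d)"
        and p = f and q = g]
    by (simp add: distrib_left single_add)
  then show ?thesis
    unfolding monoid_star_algebra_def by (simp add: sum.distrib)
qed

lemma monoid_star_algebra_mult_single [simp]:
  "Poly_Mapping.single a c \<otimes>\<^bsub>monoid_star_algebra M s\<^esub> Poly_Mapping.single b d =
     Poly_Mapping.single (a \<otimes>\<^bsub>M\<^esub> b) (c * d)"
  by (simp add: monoid_star_algebra_def)

lemma monoid_star_algebra_mult_zero [simp]:
  "0 \<otimes>\<^bsub>monoid_star_algebra M s\<^esub> f = 0" "f \<otimes>\<^bsub>monoid_star_algebra M s\<^esub> 0 = 0"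
  by (simp_all add: monoid_star_algebra_def)

lemma monoid_star_algebra_star_add:
  "star (monoid_star_algebra M s) (f + g) =
     star (monoid_star_algebra M s) f + star (monoid_star_algebra M s) g"
  unfolding monoid_star_algebra_def
  using setsum_keys_plus_distrib[where f = "\<lambda>a c. Poly_Mapping.single (s a) (cnj c)"
      and p = f and q = g]
  by (simp add: single_add)

lemma monoid_star_algebra_star_single [simp]:
  "star (monoid_star_algebra M s) (Poly_Mapping.single a c) = Poly_Mapping.single (s a) (cnj c)"
  by (simp add: monoid_star_algebra_def)

lemma monoid_star_algebra_star_zero [simp]: "star (monoid_star_algebra M s) 0 = 0"
  by (simp add: monoid_star_algebra_def)

context star_monoid
begin

abbreviation "MA \<equiv> monoid_star_algebra M s"

lemma MA_mult_closed:
  assumes "f \<in> carrier MA" "g \<in> carrier MA"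
  shows "f \<otimes>\<^bsub>MA\<^esub> g \<in> carrier MA"
proof -
  have "Poly_Mapping.keys (Poly_Mapping.single (a \<otimes> b) c) \<subseteq> carrier M"
    if "a \<in> Poly_Mapping.keys f" "b \<in> Poly_Mapping.keys g" for a b c
    using that assms by auto
  then show ?thesis
    by (simp add: monoid_star_algebra_def del: Poly_Mapping.keys_single)
      (intro keys_sum_subset, blast)
qed

lemma MA_star_closed:
  assumes "f \<in> carrier MA"
  shows "star MA f \<in> carrier MA"
proof -
  have "Poly_Mapping.keys (Poly_Mapping.single (s a) c) \<subseteq> carrier M"
    if "a \<in> Poly_Mapping.keys f" for a c
    using that assms inv_closed by auto
  then show ?thesis
    by (simp add: monoid_star_algebra_def del: Poly_Mapping.keys_single)
      (intro keys_sum_subset, blast)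
qed

lemma MA_assoc:
  assumes "f \<in> carrier MA" "g \<in> carrier MA" "h \<in> carrier MA"
  shows "(f \<otimes>\<^bsub>MA\<^esub> g) \<otimes>\<^bsub>MA\<^esub> h = f \<otimes>\<^bsub>MA\<^esub> (g \<otimes>\<^bsub>MA\<^esub> h)"
  using assms[simplified]
proof (induction f rule: poly_mapping_span_induct)
  case (single a c)
  from single(2,1,3) show ?case
  proof (induction g rule: poly_mapping_span_induct)
    case (single b d)
    from single(3,1,2) show ?case
      by (induction h rule: poly_mapping_span_induct)
         (simp_all add: monoid_star_algebra_mult_add_right m_assoc mult.assoc)
  qed (simp_all add: monoid_star_algebra_mult_add_left monoid_star_algebra_mult_add_right)
qed (simp_all add: monoid_star_algebra_mult_add_left)

lemma MA_one:
  assumes "f \<in> carrier MA"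
  shows "\<one>\<^bsub>MA\<^esub> \<otimes>\<^bsub>MA\<^esub> f = f" "f \<otimes>\<^bsub>MA\<^esub> \<one>\<^bsub>MA\<^esub> = f"
  using assms[simplified]
  by (induction f rule: poly_mapping_span_induct)
     (simp_all add: monoid_star_algebra_mult_add_left monoid_star_algebra_mult_add_right)

lemma MA_smult_mult:
  assumes "f \<in> carrier MA" "g \<in> carrier MA"
  shows "pm_scale c f \<otimes>\<^bsub>MA\<^esub> g = pm_scale c (f \<otimes>\<^bsub>MA\<^esub> g)"
    and "f \<otimes>\<^bsub>MA\<^esub> pm_scale c g = pm_scale c (f \<otimes>\<^bsub>MA\<^esub> g)"
proof -
  have "pm_scale c f \<otimes>\<^bsub>MA\<^esub> g = pm_scale c (f \<otimes>\<^bsub>MA\<^esub> g) \<and> f \<otimes>\<^bsub>MA\<^esub> pm_scale c g = pm_scale c (f \<otimes>\<^bsub>MA\<^esub> g)"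
    using assms[simplified]
  proof (induction f rule: poly_mapping_span_induct)
    case (single a d)
    from single(2,1) show ?case
      by (induction g rule: poly_mapping_span_induct)
         (simp_all add: pm_scale_add monoid_star_algebra_mult_add_right ac_simps)
  qed (simp_all add: pm_scale_add monoid_star_algebra_mult_add_left)
  then show "pm_scale c f \<otimes>\<^bsub>MA\<^esub> g = pm_scale c (f \<otimes>\<^bsub>MA\<^esub> g)"
    and "f \<otimes>\<^bsub>MA\<^esub> pm_scale c g = pm_scale c (f \<otimes>\<^bsub>MA\<^esub> g)" by blast+
qed

lemma MA_star_star:
  assumes "f \<in> carrier MA"
  shows "star MA (star MA f) = f"
  using assms[simplified]
  by (induction f rule: poly_mapping_span_induct)
     (simp_all add: monoid_star_algebra_star_add inv_inv)

lemma MA_star_mult: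
  assumes "f \<in> carrier MA" "g \<in> carrier MA"
  shows "star MA (f \<otimes>\<^bsub>MA\<^esub> g) = star MA g \<otimes>\<^bsub>MA\<^esub> star MA f"
  using assms[simplified]
proof (induction f rule: poly_mapping_span_induct)
  case (single a d)
  from single(2,1) show ?case
    by (induction g rule: poly_mapping_span_induct)
       (simp_all add: monoid_star_algebra_star_add monoid_star_algebra_mult_add_left
         monoid_star_algebra_mult_add_right ac_simps inv_mult)
qed (simp_all add: monoid_star_algebra_star_add monoid_star_algebra_mult_add_left
       monoid_star_algebra_mult_add_right)

lemma MA_star_smult:
  assumes "f \<in> carrier MA"
  shows "star MA (pm_scale c f) = pm_scale (cnj c) (star MA f)"
  using assms[simplified]
  by (induction f rule: poly_mapping_span_induct)
     (simp_all add: monoid_star_algebra_star_add pm_scale_add)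

lemma complex_star_algebra_MA: "complex_star_algebra MA"
proof (rule complex_star_algebraI)
  show "ring MA"
  proof (rule ringI)
    show "abelian_group MA"
    proof (rule abelian_groupI)
      show "\<exists>y\<in>carrier MA. y \<oplus>\<^bsub>MA\<^esub> x = \<zero>\<^bsub>MA\<^esub>" if "x \<in> carrier MA" for x
        using that by (intro bexI[of _ "- x"]) (simp_all add: keys_uminus_complex)
    qed (simp_all add: keys_add_subset ac_simps)
    show "Group.monoid MA"
      by (rule monoidI) (use MA_mult_closed MA_assoc MA_one in auto)
  qed (simp_all add: monoid_star_algebra_mult_add_left monoid_star_algebra_mult_add_right)
  show "c \<odot>\<^bsub>MA\<^esub> x \<in> carrier MA" if "x \<in> carrier MA" for c x
    using that keys_pm_scale by fastforce
  show "(c + d) \<odot>\<^bsub>MA\<^esub> x = c \<odot>\<^bsub>MA\<^esub> x \<oplus>\<^bsub>MA\<^esub> d \<odot>\<^bsub>MA\<^esub> x" for c d x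
    by (auto intro!: poly_mapping_eqI simp: lookup_add algebra_simps)
  show "(c * d) \<odot>\<^bsub>MA\<^esub> x = c \<odot>\<^bsub>MA\<^esub> (d \<odot>\<^bsub>MA\<^esub> x)" for c d x
    by (auto intro!: poly_mapping_eqI simp: algebra_simps)
  show "1 \<odot>\<^bsub>MA\<^esub> x = x" for x
    by (auto intro!: poly_mapping_eqI)
qed (use MA_star_closed MA_star_star MA_star_mult MA_star_smult MA_smult_mult in
      \<open>auto simp: pm_scale_add monoid_star_algebra_star_add\<close>)

text \<open>Universal property of the monoid algebra: both sides are bilinear, so the claim reduces
  to basis elements, where it is the multiplicativity of \<open>g\<close>.\<close>

lemma linear_extension_mult:
  assumes "complex_star_algebra V"
    and g: "\<And>a. a \<in> carrier M \<Longrightarrow> g a \<in> carrier V"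
    and gm: "\<And>a b. \<lbrakk>a \<in> carrier M; b \<in> carrier M\<rbrakk> \<Longrightarrow> g (a \<otimes> b) = g a \<otimes>\<^bsub>V\<^esub> g b"
    and f: "f \<in> carrier MA" "h \<in> carrier MA"
  shows "linear_extension V g (f \<otimes>\<^bsub>MA\<^esub> h) = linear_extension V g f \<otimes>\<^bsub>V\<^esub> linear_extension V g h"
proof -
  interpret V: complex_star_algebra V by fact
  have cl: "linear_extension V g f \<in> carrier V" if "Poly_Mapping.keys f \<subseteq> carrier M" for f
    using that g by (intro V.linear_extension_closed) auto
  have lin_add: "linear_extension V g (a + b) = linear_extension V g a \<oplus>\<^bsub>V\<^esub> linear_extension V g b"
    if "Poly_Mapping.keys a \<subseteq> carrier M" "Poly_Mapping.keys b \<subseteq> carrier M" for a b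
    using that g by (intro V.linear_extension_add[where X = "carrier M"]) auto
  have mc: "Poly_Mapping.keys (a \<otimes>\<^bsub>MA\<^esub> b) \<subseteq> carrier M"
    if "Poly_Mapping.keys a \<subseteq> carrier M" "Poly_Mapping.keys b \<subseteq> carrier M" for a b
    using MA_mult_closed[of a b] that by simp
  show ?thesis
    using f[simplified]
  proof (induction f rule: poly_mapping_span_induct)
    case (single a c)
    have k: "Poly_Mapping.keys (Poly_Mapping.single a c) \<subseteq> carrier M" using single by simp
    from single(2,1) show ?case
    proof (induction h rule: poly_mapping_span_induct)
      case (single b d)
      then show ?case
        using g by (simp add: V.linear_extension_single gm V.smult_mult_left V.smult_mult_right
          mult.commute)
    next
      case (add h k)
      then show ?case
        using g k by (simp add: monoid_star_algebra_mult_add_right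
          lin_add mc cl V.alg_r_distr del: Poly_Mapping.keys_single)
    qed (use g single in \<open>simp add: V.linear_extension_single\<close>)
  next
    case (add s t)
    then show ?case
      by (simp add: monoid_star_algebra_mult_add_left lin_add mc cl V.alg_l_distr)
  qed (simp add: cl)
qed

end


section \<open>Quotients by $*$-ideals\<close>

locale star_ideal = complex_star_algebra A + I?: ideal I A for I and A (structure) +
  assumes star_mem: "x \<in> I \<Longrightarrow> star A x \<in> I"
begin

abbreviation "Q \<equiv> quotient_star_algebra A I"
abbreviation proj where "proj x \<equiv> I +> x"

text \<open>A ring ideal is automatically a subspace, since c x = (c 1) x.\<close>

lemma smult_mem: "x \<in> I \<Longrightarrow> c \<odot> x \<in> I"
  using smult_mult_left[of \<one> x c] I_l_closed[of x "c \<odot> \<one>"] a_Hcarr[of x]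
  by (simp add: ring.ring_simprules[OF alg_ring] monoid.l_one[OF ring.is_monoid[OF alg_ring]])

lemma proj_eq_iff:
  assumes "x \<in> carrier A" "y \<in> carrier A"
  shows "proj x = proj y \<longleftrightarrow> x \<ominus> y \<in> I"
proof
  assume "proj x = proj y"
  then have "x \<in> proj y"
    using a_rcos_self[OF assms(1)] by simp
  then show "x \<ominus> y \<in> I"
    using a_rcos_module_minus[OF alg_ring, of y x] assms by simp
next
  assume "x \<ominus> y \<in> I"
  then have "x \<in> proj y"
    using a_rcos_module_minus[OF alg_ring, of y x] assms by simp
  then show "proj x = proj y"
    using a_repr_independence'[of x y] assms by simp
qed

lemma mem_proj:
  assumes "x \<in> carrier A" "y \<in> proj x"
  shows "y \<in> carrier A" "proj y = proj x"
proof -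
  show *: "y \<in> carrier A"
    using a_elemrcos_carrier[OF assms] .
  show "proj y = proj x"
    using a_repr_independence'[OF assms(2,1)] by simp
qed

lemma carrier_Q: "carrier Q = proj ` carrier A"
  by (auto simp: quotient_star_algebra_def FactRing_def A_RCOSETS_def RCOSETS_def a_r_coset_def)

lemma proj_closed [simp]: "x \<in> carrier A \<Longrightarrow> proj x \<in> carrier Q"
  by (simp add: carrier_Q)

lemma Q_cases:
  assumes "X \<in> carrier Q"
  obtains x where "x \<in> carrier A" "X = proj x"
  using assms by (auto simp: carrier_Q)

lemma one_Q: "\<one>\<^bsub>Q\<^esub> = proj \<one>"
  by (simp add: quotient_star_algebra_def FactRing_def)

lemma zero_Q: "\<zero>\<^bsub>Q\<^esub> = proj \<zero>"
  using abelian_group.a_coset_add_zero[OF alg_abelian a_subset]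
  by (simp add: quotient_star_algebra_def FactRing_def)

lemma add_Q: "\<lbrakk>x \<in> carrier A; y \<in> carrier A\<rbrakk> \<Longrightarrow> proj x \<oplus>\<^bsub>Q\<^esub> proj y = proj (x \<oplus> y)"
  by (simp add: quotient_star_algebra_def FactRing_def a_rcos_sum)

lemma mult_Q: "\<lbrakk>x \<in> carrier A; y \<in> carrier A\<rbrakk> \<Longrightarrow> proj x \<otimes>\<^bsub>Q\<^esub> proj y = proj (x \<otimes> y)"
  by (simp add: quotient_star_algebra_def FactRing_def rcoset_mult_add)

text \<open>Operations on cosets are defined as unions over representatives. When every
  representative yields the same set, the union is that set; this serves scalars, the star and later
  \<open>A_action\<close>.\<close>

lemma UN_proj_eq:
  assumes x: "x \<in> carrier A"
    and f: "\<And>y. y \<in> carrier A \<Longrightarrow> proj y = proj x \<Longrightarrow> f y = f x"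
  shows "(\<Union>y\<in>proj x. f y) = f x"
proof -
  have "f y = f x" if "y \<in> proj x" for y
    using mem_proj[OF x that] by (rule f)
  then have "(\<Union>y\<in>proj x. f y) = (\<Union>y\<in>proj x. f x)"
    by (intro SUP_cong) auto
  then show ?thesis
    using a_rcos_self[OF x] by auto
qed

lemma smult_Q: "x \<in> carrier A \<Longrightarrow> c \<odot>\<^bsub>Q\<^esub> proj x = proj (c \<odot> x)"
  unfolding quotient_star_algebra_def
proof (simp, rule UN_proj_eq)
  fix y assume xy: "x \<in> carrier A" "y \<in> carrier A" "proj y = proj x"
  then have "c \<odot> (y \<ominus> x) \<in> I"
    by (simp add: proj_eq_iff smult_mem)
  then show "proj (c \<odot> y) = proj (c \<odot> x)"
    using xy by (simp add: proj_eq_iff alg_minus_eq_smult alg_smult_add_right)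
qed

lemma star_Q: "x \<in> carrier A \<Longrightarrow> star Q (proj x) = proj (star A x)"
  unfolding quotient_star_algebra_def
proof (simp, rule UN_proj_eq)
  fix y assume xy: "x \<in> carrier A" "y \<in> carrier A" "proj y = proj x"
  then have "star A (y \<ominus> x) \<in> I"
    by (simp add: proj_eq_iff star_mem)
  then show "proj (star A y) = proj (star A x)"
    using xy by (simp add: proj_eq_iff alg_minus_eq_smult)
qed

lemmas proj_simps = one_Q zero_Q add_Q mult_Q smult_Q star_Q

lemma complex_star_algebra_Q: "complex_star_algebra Q"
proof (rule complex_star_algebraI)
  show "ring Q"
  proof (rule ringI)
    show "abelian_group Q"
    proof (rule abelian_groupI)
      show "\<exists>y\<in>carrier Q. y \<oplus>\<^bsub>Q\<^esub> x = \<zero>\<^bsub>Q\<^esub>" if x: "x \<in> carrier Q" for x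
      proof -
        obtain a where a: "a \<in> carrier A" "x = proj a" using x by (rule Q_cases)
        then show ?thesis
          by (intro bexI[of _ "proj (\<ominus> a)"])
             (simp_all add: proj_simps ring.ring_simprules[OF alg_ring])
      qed
    qed (auto simp: proj_simps ring.ring_simprules[OF alg_ring] elim!: Q_cases)
    show "Group.monoid Q"
      by (rule monoidI) (auto simp: proj_simps alg_mult_assoc
          monoid.l_one[OF ring.is_monoid[OF alg_ring]] monoid.r_one[OF ring.is_monoid[OF alg_ring]]
          elim!: Q_cases)
  qed (auto simp: proj_simps alg_l_distr alg_r_distr elim!: Q_cases)
qed (auto simp: proj_simps alg_smult_add_left alg_smult_add_right smult_mult_left
       smult_mult_right elim!: Q_cases)

end

context complex_star_algebra
begin

text \<open>The star exchanges left and right multiplication, so two-sidedness of \<open>I\<close>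
  is what makes the preimage two-sided.\<close>

lemma star_vimage_ideal:
  assumes "ideal I A"
  shows "ideal {x \<in> carrier A. star A x \<in> I} A"
proof -
  interpret I: ideal I A by fact
  show ?thesis
  proof (rule idealI)
    show "subgroup {x \<in> carrier A. star A x \<in> I} (add_monoid A)"
    proof (rule group.subgroupI)
      show "group (add_monoid A)"
        using alg_abelian by (rule abelian_group.a_group)
      show "inv\<^bsub>add_monoid A\<^esub> a \<in> {x \<in> carrier A. star A x \<in> I}"
        if "a \<in> {x \<in> carrier A. star A x \<in> I}" for a
      proof -
        have "star A (\<ominus> a) = \<ominus> (star A a)"
          using that by (simp add: alg_uminus_eq_smult)
        then show ?thesis
          using that by (simp flip: a_inv_def add: I.a_inv_closed)
      qed
    qed (auto intro: exI[of _ \<zero>])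
  qed (auto simp: alg_ring intro: I.I_l_closed I.I_r_closed)
qed

text \<open>Invariance need only be checked on generators: the star preimage of \<open>Idl X\<close>
  is an ideal containing \<open>X\<close>, hence contains \<open>Idl X\<close> by
  minimality.\<close>

lemma star_ideal_genideal:
  assumes X: "X \<subseteq> carrier A" and star: "\<And>x. x \<in> X \<Longrightarrow> star A x \<in> Idl X"
  shows "star_ideal (Idl X) A"
proof -
  have id: "ideal (Idl X) A"
    using alg_ring X by (rule ring.genideal_ideal)
  have "Idl X \<subseteq> {x \<in> carrier A. star A x \<in> Idl X}"
    using X star by (intro ring.genideal_minimal[OF alg_ring star_vimage_ideal[OF id]]) auto
  then show ?thesis
    by (intro star_ideal.intro star_ideal_axioms.intro id complex_star_algebra_axioms) auto
qed

end

section \<open>Tensor products\<close>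

definition bilinear_maps ::
  "('a, 'r) star_algebra_scheme \<Rightarrow> ('b, 's) star_algebra_scheme \<Rightarrow>
   ('v, 't) star_algebra_scheme \<Rightarrow> ('a \<Rightarrow> 'b \<Rightarrow> 'v) set" where
  "bilinear_maps A B V =
     {f. (\<forall>a\<in>carrier A. f a \<in> linear_maps B V) \<and>
         (\<forall>b\<in>carrier B. (\<lambda>a. f a b) \<in> linear_maps A V)}"

lemma bilinear_mapsI:
  assumes "\<And>a. a \<in> carrier A \<Longrightarrow> f a \<in> linear_maps B V"
    and "\<And>b. b \<in> carrier B \<Longrightarrow> (\<lambda>a. f a b) \<in> linear_maps A V"
  shows "f \<in> bilinear_maps A B V"
  using assms by (simp add: bilinear_maps_def)

lemma
  assumes "f \<in> bilinear_maps A B V"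
  shows bilinear_maps_left: "b \<in> carrier B \<Longrightarrow> (\<lambda>a. f a b) \<in> linear_maps A V"
    and bilinear_maps_right: "a \<in> carrier A \<Longrightarrow> f a \<in> linear_maps B V"
  using assms by (simp_all add: bilinear_maps_def)

lemma keys_diff_subset:
  fixes s t :: "'p \<Rightarrow>\<^sub>0 complex"
  shows "\<lbrakk>Poly_Mapping.keys s \<subseteq> X; Poly_Mapping.keys t \<subseteq> X\<rbrakk> \<Longrightarrow> Poly_Mapping.keys (s - t) \<subseteq> X"
  using keys_add_subset[of s X "- t"] by (simp add: keys_uminus_complex)

lemma pm_scale_diff: "pm_scale c (s - t) = pm_scale c s - pm_scale c t"
  by (rule poly_mapping_eqI) (simp add: lookup_minus algebra_simps)

lemma diff_eq_add_pm_scale: "s - t = s + pm_scale (- 1) t"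
  by (rule poly_mapping_eqI) (simp add: lookup_minus lookup_add)

lemma monoid_star_algebra_mult_diff_left:
  "(f - g) \<otimes>\<^bsub>monoid_star_algebra M s\<^esub> h =
     f \<otimes>\<^bsub>monoid_star_algebra M s\<^esub> h - g \<otimes>\<^bsub>monoid_star_algebra M s\<^esub> h"
  using monoid_star_algebra_mult_add_left[where M = M and s = s and f = "f - g" and g = g and h = h] by simp

lemma monoid_star_algebra_mult_diff_right:
  "h \<otimes>\<^bsub>monoid_star_algebra M s\<^esub> (f - g) =
     h \<otimes>\<^bsub>monoid_star_algebra M s\<^esub> f - h \<otimes>\<^bsub>monoid_star_algebra M s\<^esub> g"
  using monoid_star_algebra_mult_add_right[where M = M and s = s and f = "f - g" and g = g and h = h] by simp

lemma monoid_star_algebra_star_diff: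
  "star (monoid_star_algebra M s) (f - g) =
     star (monoid_star_algebra M s) f - star (monoid_star_algebra M s) g"
  using monoid_star_algebra_star_add[where M = M and s = s and f = "f - g" and g = g] by simp

lemma (in star_monoid) MA_minus:
  assumes "x \<in> carrier MA" "y \<in> carrier MA"
  shows "x \<ominus>\<^bsub>MA\<^esub> y = x - y"
  using complex_star_algebra.alg_minus_eq_smult[OF complex_star_algebra_MA assms]
  by (simp add: diff_eq_add_pm_scale)

locale tensor_product = A: complex_star_algebra A + B: complex_star_algebra B
  for A :: "('a, 'r) star_algebra_scheme" and B :: "('b, 's) star_algebra_scheme"
begin

abbreviation "FT \<equiv> tensor_free A B"
abbreviation "N \<equiv> tensor_null A B"
abbreviation "T \<equiv> tensor_algebra A B"
abbreviation "pure \<equiv> pure_tensor A B"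
abbreviation "pairs \<equiv> carrier A \<times> carrier B"

lemma star_monoid_pairs: "star_monoid (A \<times>\<times> B) (map_prod (star A) (star B))"
proof (intro star_monoid.intro star_monoid_axioms.intro)
  show "Group.monoid (A \<times>\<times> B)"
    using A.alg_ring B.alg_ring by (intro DirProd_monoid ring.is_monoid)
qed (simp_all add: DirProd_def split_paired_all)

lemmas FT_simps =
  monoid_star_algebra_mult_add_left[where M = "A \<times>\<times> B" and s = "map_prod (star A) (star B)", folded tensor_free_def]
  monoid_star_algebra_mult_add_right[where M = "A \<times>\<times> B" and s = "map_prod (star A) (star B)", folded tensor_free_def]
  monoid_star_algebra_mult_diff_left[where M = "A \<times>\<times> B" and s = "map_prod (star A) (star B)", folded tensor_free_def]
  monoid_star_algebra_mult_diff_right[where M = "A \<times>\<times> B" and s = "map_prod (star A) (star B)", folded tensor_free_def]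
  monoid_star_algebra_mult_single[where M = "A \<times>\<times> B" and s = "map_prod (star A) (star B)", folded tensor_free_def]
  monoid_star_algebra_mult_zero[where M = "A \<times>\<times> B" and s = "map_prod (star A) (star B)", folded tensor_free_def]
  monoid_star_algebra_star_add[where M = "A \<times>\<times> B" and s = "map_prod (star A) (star B)", folded tensor_free_def]
  monoid_star_algebra_star_diff[where M = "A \<times>\<times> B" and s = "map_prod (star A) (star B)", folded tensor_free_def]
  monoid_star_algebra_star_single[where M = "A \<times>\<times> B" and s = "map_prod (star A) (star B)", folded tensor_free_def]
  monoid_star_algebra_star_zero[where M = "A \<times>\<times> B" and s = "map_prod (star A) (star B)", folded tensor_free_def]

lemma FT_sel [simp]:
  "carrier FT = {f. Poly_Mapping.keys f \<subseteq> pairs}" "\<one>\<^bsub>FT\<^esub> = Poly_Mapping.single (\<one>\<^bsub>A\<^esub>, \<one>\<^bsub>B\<^esub>) 1"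
  "\<zero>\<^bsub>FT\<^esub> = 0" "x \<oplus>\<^bsub>FT\<^esub> y = x + y" "c \<odot>\<^bsub>FT\<^esub> x = pm_scale c x"
  by (simp_all add: tensor_free_def)

lemma complex_star_algebra_FT: "complex_star_algebra FT"
  unfolding tensor_free_def by (rule star_monoid.complex_star_algebra_MA[OF star_monoid_pairs])

lemmas FT_smult_mult = star_monoid.MA_smult_mult[OF star_monoid_pairs, folded tensor_free_def]
lemmas FT_star_smult = star_monoid.MA_star_smult[OF star_monoid_pairs, folded tensor_free_def]
lemmas FT_minus = star_monoid.MA_minus[OF star_monoid_pairs, folded tensor_free_def]

lemma keys_N:
  assumes "t \<in> N"
  shows "Poly_Mapping.keys t \<subseteq> pairs"
  using assms
proof induction
  case (smult s c)
  then show ?case using keys_pm_scale[of c s] by blast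
qed (simp_all add: keys_add_subset keys_diff_subset)

lemma N_uminus: "t \<in> N \<Longrightarrow> - t \<in> N"
  using tensor_null.smult[of t A B "- 1"] diff_eq_add_pm_scale[of 0 t] by simp

text \<open>Multiplying a bilinearity relator by a basis element gives a scalar multiple of a
  relator of the same kind, with the factors multiplied into its entries.\<close>

lemma N_mult_single:
  assumes "t \<in> N" "x \<in> carrier A" "y \<in> carrier B"
  shows "Poly_Mapping.single (x, y) d \<otimes>\<^bsub>FT\<^esub> t \<in> N" "t \<otimes>\<^bsub>FT\<^esub> Poly_Mapping.single (x, y) d \<in> N"
proof -
  have xy: "Poly_Mapping.single (x, y) d \<in> carrier FT"
    using assms by simp
  have "Poly_Mapping.single (x, y) d \<otimes>\<^bsub>FT\<^esub> t \<in> N \<and> t \<otimes>\<^bsub>FT\<^esub> Poly_Mapping.single (x, y) d \<in> N"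
    using assms(1)
  proof induction
    case zero
    show ?case by (simp add: FT_simps tensor_null.zero)
  next
    case (add s t)
    then show ?case by (simp add: FT_simps tensor_null.add)
  next
    case (smult s c)
    have "s \<in> carrier FT" using keys_N[OF smult.hyps] by simp
    then show ?case using smult xy by (simp add: FT_smult_mult tensor_null.smult)
  next
    case (add_left a a' b)
    then show ?case
      using assms tensor_null.smult[OF tensor_null.add_left[of "x \<otimes>\<^bsub>A\<^esub> a" A "x \<otimes>\<^bsub>A\<^esub> a'" "y \<otimes>\<^bsub>B\<^esub> b" B], of d]
        tensor_null.smult[OF tensor_null.add_left[of "a \<otimes>\<^bsub>A\<^esub> x" A "a' \<otimes>\<^bsub>A\<^esub> x" "b \<otimes>\<^bsub>B\<^esub> y" B], of d]
      by (simp add: FT_simps A.alg_r_distr A.alg_l_distr pm_scale_diff)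
  next
    case (add_right a b b')
    then show ?case
      using assms tensor_null.smult[OF tensor_null.add_right[of "x \<otimes>\<^bsub>A\<^esub> a" A "y \<otimes>\<^bsub>B\<^esub> b" B "y \<otimes>\<^bsub>B\<^esub> b'"], of d]
        tensor_null.smult[OF tensor_null.add_right[of "a \<otimes>\<^bsub>A\<^esub> x" A "b \<otimes>\<^bsub>B\<^esub> y" B "b' \<otimes>\<^bsub>B\<^esub> y"], of d]
      by (simp add: FT_simps B.alg_r_distr B.alg_l_distr pm_scale_diff)
  next
    case (smult_left a b c)
    then show ?case
      using assms tensor_null.smult[OF tensor_null.smult_left[of "x \<otimes>\<^bsub>A\<^esub> a" A "y \<otimes>\<^bsub>B\<^esub> b" B c], of d]
        tensor_null.smult[OF tensor_null.smult_left[of "a \<otimes>\<^bsub>A\<^esub> x" A "b \<otimes>\<^bsub>B\<^esub> y" B c], of d]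
      by (simp add: FT_simps A.smult_mult_left A.smult_mult_right pm_scale_diff mult.commute)
  next
    case (smult_right a b c)
    then show ?case
      using assms tensor_null.smult[OF tensor_null.smult_right[of "x \<otimes>\<^bsub>A\<^esub> a" A "y \<otimes>\<^bsub>B\<^esub> b" B c], of d]
        tensor_null.smult[OF tensor_null.smult_right[of "a \<otimes>\<^bsub>A\<^esub> x" A "b \<otimes>\<^bsub>B\<^esub> y" B c], of d]
      by (simp add: FT_simps B.smult_mult_left B.smult_mult_right pm_scale_diff mult.commute)
  qed
  then show "Poly_Mapping.single (x, y) d \<otimes>\<^bsub>FT\<^esub> t \<in> N" "t \<otimes>\<^bsub>FT\<^esub> Poly_Mapping.single (x, y) d \<in> N"
    by blast+
qed

lemma N_star:
  assumes "t \<in> N"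
  shows "star FT t \<in> N"
  using assms
proof induction
  case (smult s c)
  have "s \<in> carrier FT" using keys_N[OF smult.hyps] by simp
  then show ?case using smult by (simp add: FT_star_smult tensor_null.smult)
qed (simp_all add: FT_simps tensor_null.intros)

text \<open>\<open>tensor_null\<close> is introduced only as a linear span; absorption of products
  is reduced to \<open>N_mult_single\<close> by decomposing the other factor into basis
  elements.\<close>

lemma star_ideal_N: "star_ideal N FT"
proof (intro star_ideal.intro star_ideal_axioms.intro complex_star_algebra_FT idealI)
  interpret F: complex_star_algebra FT by (rule complex_star_algebra_FT)
  show "ring FT" by (rule F.alg_ring)
  show "subgroup N (add_monoid FT)"
  proof (rule group.subgroupI)
    show "group (add_monoid FT)"
      using F.alg_abelian by (rule abelian_group.a_group)
    show "inv\<^bsub>add_monoid FT\<^esub> a \<in> N" if "a \<in> N" for a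
    proof -
      have "\<ominus>\<^bsub>FT\<^esub> a = - a"
        using keys_N[OF that] FT_minus[of 0 a] by (simp add: a_minus_def)
      then show ?thesis
        using N_uminus[OF that] by (simp only: a_inv_def)
    qed
  qed (use keys_N tensor_null.zero[of A B] tensor_null.add[of _ A B] in auto)
  show "x \<otimes>\<^bsub>FT\<^esub> a \<in> N" "a \<otimes>\<^bsub>FT\<^esub> x \<in> N" if a: "a \<in> N" and x: "x \<in> carrier FT" for a x
  proof -
    from x[simplified] have "x \<otimes>\<^bsub>FT\<^esub> a \<in> N \<and> a \<otimes>\<^bsub>FT\<^esub> x \<in> N"
      by (induction rule: poly_mapping_span_induct)
         (auto simp: FT_simps N_mult_single a intro: tensor_null.zero tensor_null.add)
    then show "x \<otimes>\<^bsub>FT\<^esub> a \<in> N" "a \<otimes>\<^bsub>FT\<^esub> x \<in> N" by blast+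
  qed
qed (rule N_star)

sublocale N: star_ideal N FT
  by (rule star_ideal_N)

lemma complex_star_algebra_T: "complex_star_algebra T"
  unfolding tensor_algebra_def by (rule N.complex_star_algebra_Q)

sublocale T: complex_star_algebra T
  by (rule complex_star_algebra_T)

lemma pure_closed [simp]: "\<lbrakk>a \<in> carrier A; b \<in> carrier B\<rbrakk> \<Longrightarrow> pure a b \<in> carrier T"
  by (simp add: pure_tensor_def tensor_algebra_def)

lemma pure_add_left:
  "\<lbrakk>a \<in> carrier A; a' \<in> carrier A; b \<in> carrier B\<rbrakk> \<Longrightarrow> pure (a \<oplus>\<^bsub>A\<^esub> a') b = pure a b \<oplus>\<^bsub>T\<^esub> pure a' b"
  using tensor_null.add_left[of a A a' b B]
  by (simp add: pure_tensor_def tensor_algebra_def N.proj_simps N.proj_eq_iff FT_minus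
      keys_add_subset diff_diff_eq)

lemma pure_add_right:
  "\<lbrakk>a \<in> carrier A; b \<in> carrier B; b' \<in> carrier B\<rbrakk> \<Longrightarrow> pure a (b \<oplus>\<^bsub>B\<^esub> b') = pure a b \<oplus>\<^bsub>T\<^esub> pure a b'"
  using tensor_null.add_right[of a A b B b']
  by (simp add: pure_tensor_def tensor_algebra_def N.proj_simps N.proj_eq_iff FT_minus
      keys_add_subset diff_diff_eq)

lemma pure_smult_left:
  "\<lbrakk>a \<in> carrier A; b \<in> carrier B\<rbrakk> \<Longrightarrow> pure (c \<odot>\<^bsub>A\<^esub> a) b = c \<odot>\<^bsub>T\<^esub> pure a b"
  using tensor_null.smult_left[of a A b B c]
  by (simp add: pure_tensor_def tensor_algebra_def N.proj_simps N.proj_eq_iff FT_minus)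

lemma pure_smult_right:
  "\<lbrakk>a \<in> carrier A; b \<in> carrier B\<rbrakk> \<Longrightarrow> pure a (c \<odot>\<^bsub>B\<^esub> b) = c \<odot>\<^bsub>T\<^esub> pure a b"
  using tensor_null.smult_right[of a A b B c]
  by (simp add: pure_tensor_def tensor_algebra_def N.proj_simps N.proj_eq_iff FT_minus)

lemma pure_mult:
  "\<lbrakk>a \<in> carrier A; a' \<in> carrier A; b \<in> carrier B; b' \<in> carrier B\<rbrakk> \<Longrightarrow>
     pure a b \<otimes>\<^bsub>T\<^esub> pure a' b' = pure (a \<otimes>\<^bsub>A\<^esub> a') (b \<otimes>\<^bsub>B\<^esub> b')"
  by (simp add: pure_tensor_def tensor_algebra_def N.proj_simps FT_simps)

lemma pure_star:
  "\<lbrakk>a \<in> carrier A; b \<in> carrier B\<rbrakk> \<Longrightarrow> star T (pure a b) = pure (star A a) (star B b)"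
  by (simp add: pure_tensor_def tensor_algebra_def N.proj_simps FT_simps)

lemma pure_one: "\<one>\<^bsub>T\<^esub> = pure \<one>\<^bsub>A\<^esub> \<one>\<^bsub>B\<^esub>"
  by (simp add: pure_tensor_def tensor_algebra_def N.proj_simps)

text \<open>A coefficient can be absorbed into the first factor, so sums of pure tensors already
  exhaust the tensor product and no scalar case is required.\<close>

lemma tensor_induct [consumes 1, case_names pure add]:
  assumes "t \<in> carrier T"
    and pure: "\<And>a b. \<lbrakk>a \<in> carrier A; b \<in> carrier B\<rbrakk> \<Longrightarrow> P (pure a b)"
    and add: "\<And>s t. \<lbrakk>s \<in> carrier T; t \<in> carrier T; P s; P t\<rbrakk> \<Longrightarrow> P (s \<oplus>\<^bsub>T\<^esub> t)"
  shows "P t"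
proof -
  obtain s where s: "Poly_Mapping.keys s \<subseteq> pairs" "t = N.proj s"
    using assms(1) by (auto simp: tensor_algebra_def elim: N.Q_cases)
  have single: "P (N.proj (Poly_Mapping.single (a, b) c))" if "a \<in> carrier A" "b \<in> carrier B" for a b c
  proof -
    have "N.proj (Poly_Mapping.single (a, b) c) = pure (c \<odot>\<^bsub>A\<^esub> a) b"
      using that by (simp add: pure_smult_left)
        (simp add: pure_tensor_def tensor_algebra_def N.proj_simps)
    then show ?thesis using that pure by simp
  qed
  have "P (N.proj s)"
    using s(1)
  proof (induction rule: poly_mapping_span_induct)
    case zero
    \<comment> \<open>Zero is obtained as the pure tensor of 0 times 1 with 1, which the case of
      pure tensors covers.\<close>
    have "0 = Poly_Mapping.single (\<one>\<^bsub>A\<^esub>, \<one>\<^bsub>B\<^esub>) (0 :: complex)" by simp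
    then show ?case using single[of "\<one>\<^bsub>A\<^esub>" "\<one>\<^bsub>B\<^esub>" 0] by simp
  next
    case (add s t)
    then show ?case
      using assms(3)[of "N.proj s" "N.proj t"]
      by (simp add: tensor_algebra_def N.add_Q)
  qed (auto intro: single)
  then show ?thesis using s by simp
qed

lemma linear_maps_T_eqI:
  assumes "h \<in> linear_maps T V" "h' \<in> linear_maps T V" "t \<in> carrier T"
    and "\<And>a b. \<lbrakk>a \<in> carrier A; b \<in> carrier B\<rbrakk> \<Longrightarrow> h (pure a b) = h' (pure a b)"
  shows "h t = h' t"
  using assms(3)
  by (induction rule: tensor_induct) (simp_all add: assms linear_maps_add[OF assms(1)] linear_maps_add[OF assms(2)])

end

locale tensor_product_lift = tensor_product A B + V: complex_star_algebra V
  for A :: "('a, 'r) star_algebra_scheme" and B :: "('b, 's) star_algebra_scheme"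
    and V :: "('v, 't) star_algebra_scheme" +
  fixes f :: "'a \<Rightarrow> 'b \<Rightarrow> 'v"
  assumes bilinear: "f \<in> bilinear_maps A B V"
begin

abbreviation "ext \<equiv> linear_extension V (\<lambda>p. f (fst p) (snd p))"

lemma f_closed [simp]: "\<lbrakk>a \<in> carrier A; b \<in> carrier B\<rbrakk> \<Longrightarrow> f a b \<in> carrier V"
  using linear_maps_closed[OF bilinear_maps_right[OF bilinear]] .

lemma ext_single: "\<lbrakk>a \<in> carrier A; b \<in> carrier B\<rbrakk> \<Longrightarrow> ext (Poly_Mapping.single (a, b) c) = c \<odot>\<^bsub>V\<^esub> f a b"
  by (simp add: V.linear_extension_single)

lemma ext_add:
  "\<lbrakk>Poly_Mapping.keys s \<subseteq> pairs; Poly_Mapping.keys t \<subseteq> pairs\<rbrakk> \<Longrightarrow> ext (s + t) = ext s \<oplus>\<^bsub>V\<^esub> ext t"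
  by (rule V.linear_extension_add[where X = pairs]) auto

lemma ext_scale:
  "Poly_Mapping.keys s \<subseteq> pairs \<Longrightarrow> ext (pm_scale c s) = c \<odot>\<^bsub>V\<^esub> ext s"
  by (rule V.linear_extension_scale[where X = pairs]) auto

lemma ext_closed [simp]: "Poly_Mapping.keys s \<subseteq> pairs \<Longrightarrow> ext s \<in> carrier V"
  by (rule V.linear_extension_closed) auto

lemma ext_diff:
  "\<lbrakk>Poly_Mapping.keys s \<subseteq> pairs; Poly_Mapping.keys t \<subseteq> pairs\<rbrakk> \<Longrightarrow> ext (s - t) = ext s \<ominus>\<^bsub>V\<^esub> ext t"
  by (simp add: diff_eq_add_pm_scale ext_add ext_scale order_trans[OF keys_pm_scale]
      V.alg_minus_eq_smult)

lemma ext_null: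
  assumes "s \<in> N"
  shows "ext s = \<zero>\<^bsub>V\<^esub>"
  using assms
proof induction
  case (add s t)
  then show ?case using keys_N by (simp add: ext_add)
next
  case (smult s c)
  then show ?case using keys_N by (simp add: ext_scale)
next
  case (add_left a a' b)
  then show ?case
    using linear_maps_add[OF bilinear_maps_left[OF bilinear], of b a a']
    by (simp add: ext_diff keys_diff_subset ext_single) (simp add: ring.ring_simprules[OF V.alg_ring])
next
  case (add_right a b b')
  then show ?case
    using linear_maps_add[OF bilinear_maps_right[OF bilinear], of a b b']
    by (simp add: ext_diff keys_diff_subset ext_single) (simp add: ring.ring_simprules[OF V.alg_ring])
next
  case (smult_left a b c)
  then show ?case
    using linear_maps_smult[OF bilinear_maps_left[OF bilinear], of b a c]
    by (simp add: ext_diff keys_diff_subset ext_single) (simp add: ring.ring_simprules[OF V.alg_ring])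
next
  case (smult_right a b c)
  then show ?case
    using linear_maps_smult[OF bilinear_maps_right[OF bilinear], of a b c]
    by (simp add: ext_diff keys_diff_subset ext_single) (simp add: ring.ring_simprules[OF V.alg_ring])
qed simp

text \<open>\<open>the_elem\<close> is meaningful here because two representatives differ by an
  element of \<open>N\<close>, on which \<open>ext\<close> vanishes, and because the coset is
  nonempty.\<close>

lemma tensor_lift_proj:
  assumes s: "Poly_Mapping.keys s \<subseteq> pairs"
  shows "tensor_lift V f (N.proj s) = ext s"
proof -
  have "ext y = ext s" if y: "y \<in> N.proj s" for y
  proof -
    have ky: "Poly_Mapping.keys y \<subseteq> pairs" "N.proj y = N.proj s"
      using N.mem_proj[OF _ y] s by auto
    then have "y - s \<in> N"
      using N.proj_eq_iff[of y s] s by (simp add: FT_minus)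
    then have "ext (s + (y - s)) = ext s \<oplus>\<^bsub>V\<^esub> \<zero>\<^bsub>V\<^esub>"
      using ext_null[of "y - s"] ext_add[OF s keys_diff_subset[OF ky(1) s]] by (simp only:)
    then show ?thesis
      using s by (simp add: ring.ring_simprules[OF V.alg_ring])
  qed
  then have "ext ` N.proj s = (\<lambda>_. ext s) ` N.proj s"
    by (intro image_cong) simp_all
  moreover have "s \<in> N.proj s"
    using N.a_rcos_self[of s] s by simp
  ultimately have "ext ` N.proj s = {ext s}"
    by auto
  then show ?thesis
    by (simp add: tensor_lift_def linear_extension_def)
qed

lemma tensor_lift_pure: "\<lbrakk>a \<in> carrier A; b \<in> carrier B\<rbrakk> \<Longrightarrow> tensor_lift V f (pure a b) = f a b"
  by (simp add: pure_tensor_def tensor_lift_proj ext_single)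

lemma tensor_lift_linear: "tensor_lift V f \<in> linear_maps T V"
  by (rule linear_mapsI)
     (auto simp: tensor_algebra_def N.proj_simps tensor_lift_proj ext_add ext_scale
       keys_add_subset order_trans[OF keys_pm_scale] elim!: N.Q_cases)

end

section \<open>Opposite algebras, subalgebras and homomorphisms\<close>

lemma complex_star_algebra_complex: "complex_star_algebra complex_algebra"
  by (rule complex_star_algebraI)
     (use cring.axioms(1)[OF cring_complex_algebra] in \<open>auto simp: complex_algebra_def algebra_simps\<close>)

text \<open>Anti-homomorphisms into A are homomorphisms into this algebra, which brings the antipode
  under the same universal property as the comultiplication.\<close>

abbreviation op_algebra :: "('a, 'r) star_algebra_scheme \<Rightarrow> ('a, 'r) star_algebra_scheme" where
  "op_algebra A \<equiv> A\<lparr>mult := (\<lambda>x y. y \<otimes>\<^bsub>A\<^esub> x)\<rparr>"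

context complex_star_algebra
begin

lemma complex_star_algebra_op: "complex_star_algebra (op_algebra A)"
proof (rule complex_star_algebraI)
  show "ring (op_algebra A)"
  proof (rule ringI)
    show "abelian_group (op_algebra A)"
      using alg_abelian
      by (simp add: abelian_group_def abelian_monoid_def abelian_group_axioms_def)
    show "Group.monoid (op_algebra A)"
      by (rule monoidI) (auto simp: alg_mult_assoc)
  qed (auto simp: alg_l_distr alg_r_distr)
qed (auto simp: alg_smult_add_left alg_smult_add_right smult_mult_left smult_mult_right)

text \<open>\<open>star_subalgebra\<close> lists neither zero nor negatives; they come from the unit
  and from closure under the scalars 0 and -1.\<close>

lemma complex_star_algebra_subalgebra:
  assumes "star_subalgebra S A"
  shows "complex_star_algebra (A\<lparr>carrier := S\<rparr>)"
proof -
  have S: "S \<subseteq> carrier A" "\<one> \<in> S" "\<And>x y. \<lbrakk>x \<in> S; y \<in> S\<rbrakk> \<Longrightarrow> x \<oplus> y \<in> S"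
    "\<And>x y. \<lbrakk>x \<in> S; y \<in> S\<rbrakk> \<Longrightarrow> x \<otimes> y \<in> S" "\<And>c x. x \<in> S \<Longrightarrow> c \<odot> x \<in> S" "\<And>x. x \<in> S \<Longrightarrow> star A x \<in> S"
    using assms by (auto simp: star_subalgebra_def)
  have Sc [simp]: "x \<in> carrier A" if "x \<in> S" for x using that S(1) by blast
  have S0: "\<zero> \<in> S" using S(2) S(5)[of \<one> 0] by simp
  show ?thesis
  proof (rule complex_star_algebraI)
    show "ring (A\<lparr>carrier := S\<rparr>)"
    proof (rule ringI)
      show "abelian_group (A\<lparr>carrier := S\<rparr>)"
      proof (rule abelian_groupI)
        show "\<exists>y\<in>carrier (A\<lparr>carrier := S\<rparr>). y \<oplus>\<^bsub>A\<lparr>carrier := S\<rparr>\<^esub> x = \<zero>\<^bsub>A\<lparr>carrier := S\<rparr>\<^esub>"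
          if "x \<in> carrier (A\<lparr>carrier := S\<rparr>)" for x
          using that S(5)[of x "- 1"] alg_uminus_eq_smult[of x] ring.ring_simprules(9)[OF alg_ring, of x]
          by (auto intro!: bexI[of _ "(- 1) \<odot> x"])
      qed (auto simp: S S0 alg_add_ac)
      show "Group.monoid (A\<lparr>carrier := S\<rparr>)"
        by (rule monoidI) (auto simp: S alg_mult_assoc)
    qed (auto simp: alg_l_distr alg_r_distr)
  qed (auto simp: S alg_smult_add_left alg_smult_add_right smult_mult_left smult_mult_right)
qed

end

lemma algebra_antihom_eq: "algebra_antihom A B = algebra_hom A (op_algebra B)"
  by (auto simp: algebra_antihom_def algebra_hom_def ring_hom_def PiE_def)

lemma
  assumes "f \<in> algebra_hom A B"
  shows algebra_hom_linear: "f \<in> linear_maps A B"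
    and algebra_hom_mult: "\<lbrakk>x \<in> carrier A; y \<in> carrier A\<rbrakk> \<Longrightarrow> f (x \<otimes>\<^bsub>A\<^esub> y) = f x \<otimes>\<^bsub>B\<^esub> f y"
    and algebra_hom_one: "f \<one>\<^bsub>A\<^esub> = \<one>\<^bsub>B\<^esub>"
    and algebra_hom_ext: "f \<in> extensional (carrier A)"
  using assms by (auto simp: algebra_hom_def ring_hom_def linear_maps_def)

lemma (in star_ideal) factor_hom:
  assumes V: "complex_star_algebra V"
    and lin: "h \<in> linear_maps A V"
    and mult: "\<And>x y. \<lbrakk>x \<in> carrier A; y \<in> carrier A\<rbrakk> \<Longrightarrow> h (x \<otimes> y) = h x \<otimes>\<^bsub>V\<^esub> h y"
    and one: "h \<one> = \<one>\<^bsub>V\<^esub>"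
    and ker: "\<And>x. x \<in> I \<Longrightarrow> h x = \<zero>\<^bsub>V\<^esub>"
  obtains f where "f \<in> algebra_hom Q V" "\<And>x. x \<in> carrier A \<Longrightarrow> f (proj x) = h x"
proof -
  interpret V: complex_star_algebra V by fact
  \<comment> \<open>The restriction to the carrier supplies the extensionality that
    \<open>algebra_hom\<close> demands.\<close>
  define f where "f = (\<lambda>X\<in>carrier Q. the_elem (h ` X))"
  have f: "f (proj x) = h x" if x: "x \<in> carrier A" for x
  proof -
    have "h y = h x" if y: "y \<in> proj x" for y
    proof -
      have ky: "y \<in> carrier A" "y \<ominus> x \<in> I"
        using mem_proj[OF x y] proj_eq_iff[of y x] x by auto
      then have eq0: "h y \<oplus>\<^bsub>V\<^esub> (- 1) \<odot>\<^bsub>V\<^esub> h x = \<zero>\<^bsub>V\<^esub>"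
        using ker[of "y \<ominus> x"] x
        by (simp add: alg_minus_eq_smult linear_maps_add[OF lin] linear_maps_smult[OF lin])
      show ?thesis
        by (rule V.alg_eqI) (use eq0 ky x linear_maps_closed[OF lin] in simp_all)
    qed
    then have "h ` proj x = (\<lambda>_. h x) ` proj x"
      by (intro image_cong) simp_all
    then have "h ` proj x = {h x}"
      using a_rcos_self[OF x] by auto
    then show ?thesis
      using x by (simp add: f_def)
  qed
  have "f \<in> algebra_hom Q V"
    unfolding algebra_hom_def ring_hom_def
    using lin mult one
    by (auto simp: proj_simps f linear_maps_closed linear_maps_add linear_maps_smult
        elim!: Q_cases) (simp add: f_def)
  with f that show thesis by blast
qed

text \<open>The kernel is an ideal containing \<open>X\<close>, so it contains the smallest such
  ideal.\<close>

lemma (in complex_star_algebra) hom_vanishes_on_genideal: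
  assumes V: "complex_star_algebra V"
    and lin: "h \<in> linear_maps A V"
    and mult: "\<And>x y. \<lbrakk>x \<in> carrier A; y \<in> carrier A\<rbrakk> \<Longrightarrow> h (x \<otimes> y) = h x \<otimes>\<^bsub>V\<^esub> h y"
    and one: "h \<one> = \<one>\<^bsub>V\<^esub>"
    and X: "X \<subseteq> carrier A" "\<And>x. x \<in> X \<Longrightarrow> h x = \<zero>\<^bsub>V\<^esub>"
    and x: "x \<in> Idl X"
  shows "h x = \<zero>\<^bsub>V\<^esub>"
proof -
  interpret V: complex_star_algebra V by fact
  have "h \<in> ring_hom A V"
    by (rule ring_hom_memI)
       (auto simp: linear_maps_closed[OF lin] linear_maps_add[OF lin] mult one)
  then have "ring_hom_ring A V h"
    by (rule ring_hom_ringI2[OF alg_ring V.alg_ring])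
  note ker = ring_hom_ring.kernel_is_ideal[OF this]
  have "Idl X \<subseteq> a_kernel A V h"
    using X by (intro ring.genideal_minimal[OF alg_ring ker]) (auto simp: a_kernel_def')
  then show ?thesis
    using x by (auto simp: a_kernel_def')
qed

section \<open>Presentation of $U_q(\mu,\nu)$\<close>

interpretation free_alg: star_monoid word_monoid "\<lambda>w. rev (map generator_star w)"
proof -
  have "generator_star (generator_star x) = x" for x
    by (cases x) auto
  then have "map (generator_star \<circ> generator_star) w = w" for w
    by (intro map_idI) simp
  then show "star_monoid word_monoid (\<lambda>w. rev (map generator_star w))"
    by unfold_locales (auto simp: word_monoid_def rev_map)
qed

lemma free_star_algebra_sel [simp]:
  "carrier free_star_algebra = UNIV" "\<one>\<^bsub>free_star_algebra\<^esub> = Poly_Mapping.single [] 1"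
  "\<zero>\<^bsub>free_star_algebra\<^esub> = 0" "x \<oplus>\<^bsub>free_star_algebra\<^esub> y = x + y"
  "c \<odot>\<^bsub>free_star_algebra\<^esub> x = pm_scale c x"
  by (simp_all add: free_star_algebra_def word_monoid_def)

lemma free_star_algebra_mult_single [simp]:
  "Poly_Mapping.single u c \<otimes>\<^bsub>free_star_algebra\<^esub> Poly_Mapping.single v d =
     Poly_Mapping.single (u @ v) (c * d)"
  by (simp add: free_star_algebra_def) (simp add: word_monoid_def)

lemma free_star_algebra_star_single [simp]:
  "star free_star_algebra (Poly_Mapping.single w c) =
     Poly_Mapping.single (rev (map generator_star w)) (cnj c)"
  by (simp add: free_star_algebra_def)

lemma free_star_algebra_star_diff:
  "star free_star_algebra (f - g) = star free_star_algebra f - star free_star_algebra g"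
  by (simp add: free_star_algebra_def monoid_star_algebra_star_diff)

lemma free_star_algebra_minus: "x \<ominus>\<^bsub>free_star_algebra\<^esub> y = x - y"
  unfolding free_star_algebra_def by (rule free_alg.MA_minus) (simp_all add: word_monoid_def)

interpretation free_sa: complex_star_algebra free_star_algebra
  unfolding free_star_algebra_def by (rule free_alg.complex_star_algebra_MA)

lemma relators_mem: "r \<in> Uq_relators q \<mu> \<nu> \<Longrightarrow> r \<in> Uq_ideal q \<mu> \<nu>"
  unfolding Uq_ideal_def using ring.genideal_self[OF free_sa.alg_ring, of "Uq_relators q \<mu> \<nu>"] by auto

lemma ideal_Uq: "ideal (Uq_ideal q \<mu> \<nu>) free_star_algebra"
  unfolding Uq_ideal_def by (rule ring.genideal_ideal[OF free_sa.alg_ring]) simp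

text \<open>A special case of \<open>smult_mem\<close>, stated separately because it is used to
  prove that this ideal is a \<open>star_ideal\<close> in the first place.\<close>

lemma Uq_ideal_scale: "x \<in> Uq_ideal q \<mu> \<nu> \<Longrightarrow> pm_scale c x \<in> Uq_ideal q \<mu> \<nu>"
  using ideal.I_l_closed[OF ideal_Uq, of x q \<mu> \<nu> "Poly_Mapping.single [] c"]
    free_sa.smult_mult_left[of "Poly_Mapping.single [] 1" x c]
    free_sa.alg_l_one[of x]
  by simp

text \<open>The star permutes the relators up to a scalar. It exchanges the two inverse relations
  and fixes the commutator relator, while (KE - qEK)^* = -q (KF - q^{-1}FK) and symmetrically for
  F.\<close>

lemma star_relator_mem:
  assumes "q \<noteq> 0" "r \<in> Uq_relators q \<mu> \<nu>"
  shows "star free_star_algebra r \<in> Uq_ideal q \<mu> \<nu>"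
proof -
  from assms(2) consider "star free_star_algebra r = word [GK, GKinv] 1 - word [] 1"
    | "star free_star_algebra r = word [GKinv, GK] 1 - word [] 1"
    | "star free_star_algebra r = pm_scale (- q) (word [GK, GF] 1 - word [GF, GK] (inverse q))"
    | "star free_star_algebra r = pm_scale (- inverse q) (word [GK, GE] 1 - word [GE, GK] q)"
    | "star free_star_algebra r = word [GE, GF] 1 - word [GF, GE] 1
        - (word [GK, GK] (lam q * \<mu>) - word [GKinv, GKinv] (lam q * \<nu>))"
    using assms(1)
    by (auto simp: Uq_relators_def free_star_algebra_star_diff pm_scale_diff single_uminus)
  then show ?thesis
    by cases (simp only:, (rule Uq_ideal_scale)?, rule relators_mem, simp add: Uq_relators_def)+
qed

lemma star_ideal_Uq:
  assumes "q \<noteq> 0"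
  shows "star_ideal (Uq_ideal q \<mu> \<nu>) free_star_algebra"
  unfolding Uq_ideal_def
  by (rule free_sa.star_ideal_genideal)
     (simp_all add: star_relator_mem[OF assms, unfolded Uq_ideal_def])

text \<open>The defining relations, realised by a family \<open>g\<close> in an arbitrary *-algebra.
  They hold for the generators in U_q(mu,nu) and in A, and for the intended images under Delta, S
  and epsilon in the respective targets.\<close>

locale Uq_rep = complex_star_algebra A for A (structure) +
  fixes q \<mu> \<nu> :: real and g :: "generator \<Rightarrow> 'a"
  assumes q0: "q \<noteq> 0"
    and g_closed [simp]: "g x \<in> carrier A"
    and Kinv_K: "g GKinv \<otimes> g GK = \<one>"
    and K_Kinv: "g GK \<otimes> g GKinv = \<one>"
    and K_E: "g GK \<otimes> g GE = q \<odot> (g GE \<otimes> g GK)"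
    and K_F: "g GK \<otimes> g GF = inverse q \<odot> (g GF \<otimes> g GK)"
    and E_F: "g GE \<otimes> g GF = g GF \<otimes> g GE \<oplus> (lam q * \<mu>) \<odot> (g GK \<otimes> g GK)
        \<oplus> (- (lam q * \<nu>)) \<odot> (g GKinv \<otimes> g GKinv)"

locale Uq_star_rep = Uq_rep +
  assumes star_g: "star A (g x) = g (generator_star x)"

section \<open>Evaluation of noncommutative polynomials\<close>

context Uq_rep
begin

definition word_value :: "generator list \<Rightarrow> 'a" where
  "word_value w = foldr (\<lambda>x y. g x \<otimes> y) w \<one>"

lemma word_value_Nil [simp]: "word_value [] = \<one>"
  and word_value_Cons [simp]: "word_value (x # w) = g x \<otimes> word_value w"
  by (simp_all add: word_value_def)

lemma word_value_closed [simp]: "word_value w \<in> carrier A"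
  by (induction w) auto

lemma word_value_append: "word_value (u @ v) = word_value u \<otimes> word_value v"
  by (induction u) (simp_all add: alg_mult_assoc)

abbreviation "free_value \<equiv> linear_extension A word_value"

lemma free_value_linear: "free_value \<in> linear_maps free_star_algebra A"
  by (rule linear_mapsI)
     (auto simp: linear_extension_add[where X = UNIV] linear_extension_scale[where X = UNIV])

lemma free_value_mult:
  "free_value (x \<otimes>\<^bsub>free_star_algebra\<^esub> y) = free_value x \<otimes> free_value y"
  unfolding free_star_algebra_def
  by (rule free_alg.linear_extension_mult[OF complex_star_algebra_axioms])
     (auto simp: word_monoid_def word_value_append)

lemma free_value_single: "free_value (Poly_Mapping.single w c) = c \<odot> word_value w"
  by (simp add: linear_extension_single)

lemma free_value_diff: "free_value (x - y) = free_value x \<oplus> (- 1) \<odot> free_value y"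
  using linear_maps_add[OF free_value_linear, of x "pm_scale (- 1) y"]
    linear_maps_smult[OF free_value_linear, of y "- 1"]
  by (simp add: diff_eq_add_pm_scale)

lemma free_value_relator:
  assumes "r \<in> Uq_relators q \<mu> \<nu>"
  shows "free_value r = \<zero>"
  using assms unfolding Uq_relators_def
  by (auto simp: free_value_diff free_value_single Kinv_K K_Kinv K_E K_F E_F alg_cancel
      alg_cancel3 alg_smult_add_right alg_smult_add_left[symmetric])

end

section \<open>The universal property of U_q(mu,nu)\<close>

locale quantum_parameter =
  fixes q :: real
  assumes q_pos: "0 < q" and q_less_1: "q < 1"
begin

lemma q_nz [simp]: "q \<noteq> 0"
  using q_pos by simp

sublocale UI: star_ideal "Uq_ideal q \<mu> \<nu>" free_star_algebra for \<mu> \<nu>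
  by (rule star_ideal_Uq) simp

sublocale U: complex_star_algebra "Uq q \<mu> \<nu>" for \<mu> \<nu>
  unfolding Uq_def by (rule UI.complex_star_algebra_Q)

lemma Uq_gen_closed [simp]: "Uq_gen q \<mu> \<nu> x \<in> carrier (Uq q \<mu> \<nu>)"
  unfolding Uq_gen_def Uq_def by (rule UI.proj_closed) simp

lemma Uq_gen_mult_word:
  "Uq_gen q \<mu> \<nu> x \<otimes>\<^bsub>Uq q \<mu> \<nu>\<^esub> UI.proj \<mu> \<nu> (Poly_Mapping.single w c) =
     UI.proj \<mu> \<nu> (Poly_Mapping.single (x # w) c)"
  unfolding Uq_gen_def Uq_def by (simp add: UI.mult_Q)

lemma proj_eqI_relator:
  assumes "x - y \<in> Uq_relators q \<mu> \<nu>"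
  shows "UI.proj \<mu> \<nu> x = UI.proj \<mu> \<nu> y"
  using relators_mem[OF assms] by (simp add: UI.proj_eq_iff free_star_algebra_minus)

lemma proj_simps_word:
  "UI.proj \<mu> \<nu> x \<oplus>\<^bsub>Uq q \<mu> \<nu>\<^esub> UI.proj \<mu> \<nu> y = UI.proj \<mu> \<nu> (x + y)"
  "c \<odot>\<^bsub>Uq q \<mu> \<nu>\<^esub> UI.proj \<mu> \<nu> x = UI.proj \<mu> \<nu> (pm_scale c x)"
  "\<one>\<^bsub>Uq q \<mu> \<nu>\<^esub> = UI.proj \<mu> \<nu> (Poly_Mapping.single [] 1)"
  "Uq_gen q \<mu> \<nu> z = UI.proj \<mu> \<nu> (Poly_Mapping.single [z] 1)"
  "UI.proj \<mu> \<nu> x \<otimes>\<^bsub>Uq q \<mu> \<nu>\<^esub> UI.proj \<mu> \<nu> y = UI.proj \<mu> \<nu> (x \<otimes>\<^bsub>free_star_algebra\<^esub> y)"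
  "star (Uq q \<mu> \<nu>) (UI.proj \<mu> \<nu> x) = UI.proj \<mu> \<nu> (star free_star_algebra x)"
  by (simp_all add: Uq_def Uq_gen_def UI.proj_simps)

lemma Uq_star_rep_Uq: "Uq_star_rep (Uq q \<mu> \<nu>) q \<mu> \<nu> (Uq_gen q \<mu> \<nu>)"
proof (intro Uq_star_rep.intro Uq_star_rep_axioms.intro Uq_rep.intro Uq_rep_axioms.intro
    U.complex_star_algebra_axioms)
  show "UE q \<mu> \<nu> \<otimes>\<^bsub>Uq q \<mu> \<nu>\<^esub> UF q \<mu> \<nu> = UF q \<mu> \<nu> \<otimes>\<^bsub>Uq q \<mu> \<nu>\<^esub> UE q \<mu> \<nu>
      \<oplus>\<^bsub>Uq q \<mu> \<nu>\<^esub> (lam q * \<mu>) \<odot>\<^bsub>Uq q \<mu> \<nu>\<^esub> (UK q \<mu> \<nu> \<otimes>\<^bsub>Uq q \<mu> \<nu>\<^esub> UK q \<mu> \<nu>)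
      \<oplus>\<^bsub>Uq q \<mu> \<nu>\<^esub> (- (lam q * \<nu>)) \<odot>\<^bsub>Uq q \<mu> \<nu>\<^esub> (UKinv q \<mu> \<nu> \<otimes>\<^bsub>Uq q \<mu> \<nu>\<^esub> UKinv q \<mu> \<nu>)"
    unfolding proj_simps_word
    by (simp, rule proj_eqI_relator) (simp add: Uq_relators_def single_uminus algebra_simps)
  show "UKinv q \<mu> \<nu> \<otimes>\<^bsub>Uq q \<mu> \<nu>\<^esub> UK q \<mu> \<nu> = \<one>\<^bsub>Uq q \<mu> \<nu>\<^esub>"
    "UK q \<mu> \<nu> \<otimes>\<^bsub>Uq q \<mu> \<nu>\<^esub> UKinv q \<mu> \<nu> = \<one>\<^bsub>Uq q \<mu> \<nu>\<^esub>"
    "UK q \<mu> \<nu> \<otimes>\<^bsub>Uq q \<mu> \<nu>\<^esub> UE q \<mu> \<nu> = complex_of_real q \<odot>\<^bsub>Uq q \<mu> \<nu>\<^esub> (UE q \<mu> \<nu> \<otimes>\<^bsub>Uq q \<mu> \<nu>\<^esub> UK q \<mu> \<nu>)"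
    "UK q \<mu> \<nu> \<otimes>\<^bsub>Uq q \<mu> \<nu>\<^esub> UF q \<mu> \<nu> =
      complex_of_real (inverse q) \<odot>\<^bsub>Uq q \<mu> \<nu>\<^esub> (UF q \<mu> \<nu> \<otimes>\<^bsub>Uq q \<mu> \<nu>\<^esub> UK q \<mu> \<nu>)"
    unfolding proj_simps_word
    by (simp, rule proj_eqI_relator, simp add: Uq_relators_def)+
  show "star (Uq q \<mu> \<nu>) (Uq_gen q \<mu> \<nu> x) = Uq_gen q \<mu> \<nu> (generator_star x)" for x
    unfolding proj_simps_word by simp
qed simp_all

text \<open>Every class is a linear combination of words, and words are built by adding letters on
  the left. The generator case thus has the shape of \<open>act_gen_mult\<close>, which describes
  how a generator times x acts.\<close>

lemma Uq_induct [consumes 1, case_names one gen add smult]: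
  assumes "x \<in> carrier (Uq q \<mu> \<nu>)"
    and one: "P \<one>\<^bsub>Uq q \<mu> \<nu>\<^esub>"
    and gen: "\<And>z x. \<lbrakk>x \<in> carrier (Uq q \<mu> \<nu>); P x\<rbrakk> \<Longrightarrow> P (Uq_gen q \<mu> \<nu> z \<otimes>\<^bsub>Uq q \<mu> \<nu>\<^esub> x)"
    and add: "\<And>x y. \<lbrakk>x \<in> carrier (Uq q \<mu> \<nu>); y \<in> carrier (Uq q \<mu> \<nu>); P x; P y\<rbrakk> \<Longrightarrow>
      P (x \<oplus>\<^bsub>Uq q \<mu> \<nu>\<^esub> y)"
    and smult: "\<And>c x. \<lbrakk>x \<in> carrier (Uq q \<mu> \<nu>); P x\<rbrakk> \<Longrightarrow> P (c \<odot>\<^bsub>Uq q \<mu> \<nu>\<^esub> x)"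
  shows "P x"
proof -
  have cl [simp]: "UI.proj \<mu> \<nu> s \<in> carrier (Uq q \<mu> \<nu>)" for s
    by (simp add: Uq_def)
  obtain s where s: "x = UI.proj \<mu> \<nu> s"
    using assms(1) unfolding Uq_def by (rule UI.Q_cases)
  have word: "P (UI.proj \<mu> \<nu> (Poly_Mapping.single w 1))" for w
  proof (induction w)
    case Nil
    then show ?case using one by (simp add: proj_simps_word)
  next
    case (Cons z w)
    then show ?case using gen[OF cl, of "Poly_Mapping.single w 1" z] by (simp add: Uq_gen_mult_word)
  qed
  have single: "P (UI.proj \<mu> \<nu> (Poly_Mapping.single w c))" for w c
    using smult[OF cl word, of c w] by (simp add: proj_simps_word)
  have "Poly_Mapping.keys s \<subseteq> UNIV" by simp
  then have "P (UI.proj \<mu> \<nu> s)"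
  proof (induction rule: poly_mapping_span_induct)
    case zero
    then show ?case using single[of "[]" 0] by simp
  next
    case (add s t)
    then show ?case using assms(4)[OF cl cl, of s t] by (simp add: proj_simps_word)
  qed (rule single)
  then show ?thesis using s by simp
qed

text \<open>Evaluation at \<open>g\<close> kills the relators, hence the ideal they generate, and
  therefore descends to the quotient.\<close>

lemma Uq_hom_exists:
  assumes "Uq_rep V q \<mu> \<nu> g"
  obtains f where "f \<in> algebra_hom (Uq q \<mu> \<nu>) V" "\<And>z. f (Uq_gen q \<mu> \<nu> z) = g z"
proof -
  interpret V: Uq_rep V q \<mu> \<nu> g by fact
  have van: "V.free_value x = \<zero>\<^bsub>V\<^esub>" if "x \<in> Uq_ideal q \<mu> \<nu>" for x
    by (rule free_sa.hom_vanishes_on_genideal[OF V.complex_star_algebra_axioms V.free_value_linear])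
       (use that V.free_value_relator in \<open>auto simp: V.free_value_mult V.free_value_single Uq_ideal_def\<close>)
  show thesis
  proof (rule UI.factor_hom[OF V.complex_star_algebra_axioms V.free_value_linear, where \<mu> = \<mu> and \<nu> = \<nu>])
    fix f assume f: "f \<in> algebra_hom (quotient_star_algebra free_star_algebra (Uq_ideal q \<mu> \<nu>)) V"
      "\<And>x. x \<in> carrier free_star_algebra \<Longrightarrow> f (UI.proj \<mu> \<nu> x) = V.free_value x"
    show thesis
      by (rule that[of f])
         (use f in \<open>simp_all add: Uq_def Uq_gen_def V.free_value_single\<close>)
  qed (auto simp: V.free_value_mult V.free_value_single van)
qed

text \<open>The value at K^{-1} is not prescribed in the definitions of the structure maps. It is
  forced because f(K^{-1}) and f'(K^{-1}) are both two-sided inverses of the same element f(K) =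
  f'(K).\<close>

lemma Uq_hom_unique:
  assumes V: "complex_star_algebra V"
    and f: "f \<in> algebra_hom (Uq q \<mu> \<nu>) V" and f': "f' \<in> algebra_hom (Uq q \<mu> \<nu>) V"
    and gen: "f (UE q \<mu> \<nu>) = f' (UE q \<mu> \<nu>)" "f (UF q \<mu> \<nu>) = f' (UF q \<mu> \<nu>)"
      "f (UK q \<mu> \<nu>) = f' (UK q \<mu> \<nu>)"
  shows "f = f'"
proof -
  interpret V: complex_star_algebra V by fact
  interpret S: Uq_star_rep "Uq q \<mu> \<nu>" q \<mu> \<nu> "Uq_gen q \<mu> \<nu>" by (rule Uq_star_rep_Uq)
  note lin = algebra_hom_linear[OF f] and lin' = algebra_hom_linear[OF f']
  have cl [simp]: "f x \<in> carrier V" "f' x \<in> carrier V" if "x \<in> carrier (Uq q \<mu> \<nu>)" for x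
    using that linear_maps_closed[OF lin] linear_maps_closed[OF lin'] by auto
  let ?K = "UK q \<mu> \<nu>" and ?L = "UKinv q \<mu> \<nu>"
  have "f' ?K \<otimes>\<^bsub>V\<^esub> f' ?L = \<one>\<^bsub>V\<^esub>" "f ?L \<otimes>\<^bsub>V\<^esub> f ?K = \<one>\<^bsub>V\<^esub>"
    using algebra_hom_mult[OF f', of ?K ?L] algebra_hom_mult[OF f, of ?L ?K]
    by (simp_all add: S.K_Kinv S.Kinv_K algebra_hom_one[OF f] algebra_hom_one[OF f'])
  note inv = this
  have "f ?L = f ?L \<otimes>\<^bsub>V\<^esub> (f' ?K \<otimes>\<^bsub>V\<^esub> f' ?L)"
    by (simp add: inv)
  also have "\<dots> = (f ?L \<otimes>\<^bsub>V\<^esub> f ?K) \<otimes>\<^bsub>V\<^esub> f' ?L"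
    by (simp add: V.alg_mult_assoc gen)
  also have "\<dots> = f' ?L"
    by (simp only: inv) simp
  finally have gens: "f (Uq_gen q \<mu> \<nu> z) = f' (Uq_gen q \<mu> \<nu> z)" for z
    using gen by (cases z) auto
  have "f x = f' x" if "x \<in> carrier (Uq q \<mu> \<nu>)" for x
    using that
    by (induction rule: Uq_induct)
       (simp_all add: gens algebra_hom_one[OF f] algebra_hom_one[OF f'] algebra_hom_mult[OF f]
          algebra_hom_mult[OF f'] linear_maps_add[OF lin] linear_maps_add[OF lin']
          linear_maps_smult[OF lin] linear_maps_smult[OF lin'])
  then show ?thesis
    using algebra_hom_ext[OF f] algebra_hom_ext[OF f'] by (rule extensionalityI[rotated 2])
qed

lemma Uq_hom_star:
  assumes "Uq_star_rep V q \<mu> \<nu> g"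
    and f: "f \<in> algebra_hom (Uq q \<mu> \<nu>) V" and fg: "\<And>z. f (Uq_gen q \<mu> \<nu> z) = g z"
  shows "f \<in> star_algebra_hom (Uq q \<mu> \<nu>) V"
proof -
  interpret V: Uq_star_rep V q \<mu> \<nu> g by fact
  interpret S: Uq_star_rep "Uq q \<mu> \<nu>" q \<mu> \<nu> "Uq_gen q \<mu> \<nu>" by (rule Uq_star_rep_Uq)
  note lin = algebra_hom_linear[OF f]
  \<comment> \<open>The induction adds generators on the left, but the star moves them to the right
    end of the product.\<close>
  have mult_right: "f (x \<otimes>\<^bsub>Uq q \<mu> \<nu>\<^esub> Uq_gen q \<mu> \<nu> z) = f x \<otimes>\<^bsub>V\<^esub> g z"
    if "x \<in> carrier (Uq q \<mu> \<nu>)" for x z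
    using that by (simp add: algebra_hom_mult[OF f] fg)
  have "f (star (Uq q \<mu> \<nu>) x) = star V (f x)" if "x \<in> carrier (Uq q \<mu> \<nu>)" for x
    using that
    by (induction rule: Uq_induct)
       (simp_all add: algebra_hom_one[OF f] algebra_hom_mult[OF f] fg S.star_g V.star_g
         linear_maps_add[OF lin] linear_maps_smult[OF lin] linear_maps_closed[OF lin] mult_right)
  then show ?thesis
    using f by (simp add: star_algebra_hom_def)
qed

end

section \<open>Commutation rules for K and its inverse\<close>

context Uq_rep
begin

text \<open>Multiply KE = qEK by K^{-1} on both sides.\<close>

lemma Kinv_E: "g GKinv \<otimes> g GE = inverse q \<odot> (g GE \<otimes> g GKinv)"
proof -
  have "g GKinv \<otimes> ((g GK \<otimes> g GE) \<otimes> g GKinv) = q \<odot> ((g GKinv \<otimes> g GE) \<otimes> (g GK \<otimes> g GKinv))"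
    by (simp add: K_E smult_mult_left smult_mult_right alg_mult_assoc del: K_Kinv)
  moreover have "g GKinv \<otimes> ((g GK \<otimes> g GE) \<otimes> g GKinv) = (g GKinv \<otimes> g GK) \<otimes> (g GE \<otimes> g GKinv)"
    by (simp add: alg_mult_assoc)
  ultimately have "g GE \<otimes> g GKinv = q \<odot> (g GKinv \<otimes> g GE)"
    by (simp add: K_Kinv Kinv_K)
  then show ?thesis
    using q0 by simp
qed

lemma Kinv_F: "g GKinv \<otimes> g GF = q \<odot> (g GF \<otimes> g GKinv)"
proof -
  have "g GKinv \<otimes> ((g GK \<otimes> g GF) \<otimes> g GKinv) = inverse q \<odot> ((g GKinv \<otimes> g GF) \<otimes> (g GK \<otimes> g GKinv))"
    by (simp add: K_F smult_mult_left smult_mult_right alg_mult_assoc del: K_Kinv)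
  moreover have "g GKinv \<otimes> ((g GK \<otimes> g GF) \<otimes> g GKinv) = (g GKinv \<otimes> g GK) \<otimes> (g GF \<otimes> g GKinv)"
    by (simp add: alg_mult_assoc)
  ultimately have "g GF \<otimes> g GKinv = inverse q \<odot> (g GKinv \<otimes> g GF)"
    by (simp add: K_Kinv Kinv_K)
  then show ?thesis
    using q0 by simp
qed

lemma q_cancel:
  "complex_of_real q * inverse (complex_of_real q) = 1"
  "inverse (complex_of_real q) * complex_of_real q = 1"
  "inverse (complex_of_real q) * (complex_of_real q * x) = x"
  "complex_of_real q * (inverse (complex_of_real q) * x) = x"
  using q0 by simp_all

text \<open>Products are normalised to nest to the right, where the two factors of a relation may be
  followed by a further factor \<open>w\<close>. The variants in \<open>K_rules\<close> cover that
  position and move K and K^{-1} to the right past E and F.\<close>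

lemma mult_assoc_rule:
  assumes "x \<otimes> y = z" "x \<in> carrier A" "y \<in> carrier A" "w \<in> carrier A"
  shows "x \<otimes> (y \<otimes> w) = z \<otimes> w"
  using assms by (simp flip: alg_mult_assoc)

lemmas K_rules =
  Kinv_K K_Kinv K_E K_F Kinv_E Kinv_F
  mult_assoc_rule[OF Kinv_K g_closed g_closed] mult_assoc_rule[OF K_Kinv g_closed g_closed]
  mult_assoc_rule[OF K_E g_closed g_closed] mult_assoc_rule[OF K_F g_closed g_closed]
  mult_assoc_rule[OF Kinv_E g_closed g_closed] mult_assoc_rule[OF Kinv_F g_closed g_closed]

lemmas K_norm = K_rules alg_mult_assoc smult_mult_left smult_mult_right alg_l_distr alg_r_distr
  alg_smult_add_right

end

section \<open>Existence and uniqueness of Delta, S and epsilon\<close>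

context quantum_parameter
begin

sublocale US: Uq_star_rep "Uq q \<mu> \<nu>" q \<mu> \<nu> "Uq_gen q \<mu> \<nu>" for \<mu> \<nu>
  by (rule Uq_star_rep_Uq)

sublocale UU: tensor_product "Uq q \<mu> \<upsilon>" "Uq q \<upsilon> \<nu>" for \<mu> \<upsilon> \<nu>
  by unfold_locales

abbreviation TU where "TU \<mu> \<upsilon> \<nu> \<equiv> tensor_algebra (Uq q \<mu> \<upsilon>) (Uq q \<upsilon> \<nu>)"

text \<open>\<open>Uq_comult\<close> prescribes only E and K. The value at F is the star of the
  value at E, and the value at K^{-1} is the inverse of the value at K.\<close>

primrec comult_gen :: "real \<Rightarrow> real \<Rightarrow> real \<Rightarrow> generator \<Rightarrow> (Uq_elem \<times> Uq_elem \<Rightarrow>\<^sub>0 complex) set" where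
  "comult_gen \<mu> \<upsilon> \<nu> GK = pure_tensor (Uq q \<mu> \<upsilon>) (Uq q \<upsilon> \<nu>) (UK q \<mu> \<upsilon>) (UK q \<upsilon> \<nu>)"
| "comult_gen \<mu> \<upsilon> \<nu> GKinv = pure_tensor (Uq q \<mu> \<upsilon>) (Uq q \<upsilon> \<nu>) (UKinv q \<mu> \<upsilon>) (UKinv q \<upsilon> \<nu>)"
| "comult_gen \<mu> \<upsilon> \<nu> GE = pure_tensor (Uq q \<mu> \<upsilon>) (Uq q \<upsilon> \<nu>) (UE q \<mu> \<upsilon>) (UK q \<upsilon> \<nu>)
     \<oplus>\<^bsub>TU \<mu> \<upsilon> \<nu>\<^esub> pure_tensor (Uq q \<mu> \<upsilon>) (Uq q \<upsilon> \<nu>) (UKinv q \<mu> \<upsilon>) (UE q \<upsilon> \<nu>)"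
| "comult_gen \<mu> \<upsilon> \<nu> GF = pure_tensor (Uq q \<mu> \<upsilon>) (Uq q \<upsilon> \<nu>) (UF q \<mu> \<upsilon>) (UK q \<upsilon> \<nu>)
     \<oplus>\<^bsub>TU \<mu> \<upsilon> \<nu>\<^esub> pure_tensor (Uq q \<mu> \<upsilon>) (Uq q \<upsilon> \<nu>) (UKinv q \<mu> \<upsilon>) (UF q \<upsilon> \<nu>)"

lemma comult_gen_closed [simp]: "comult_gen \<mu> \<upsilon> \<nu> z \<in> carrier (TU \<mu> \<upsilon> \<nu>)"
  by (cases z) simp_all

text \<open>In the commutator of the images of E and F the mixed terms cancel, since the powers of q
  from the two legs compensate. What remains is [E,F] \<otimes> K^2 + K^{-2} \<otimes> [E,F], where
  the two terms with the middle index \<upsilon> cancel and only \<mu> and \<nu> survive.\<close>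

lemma comult_gen_rep: "Uq_star_rep (TU \<mu> \<upsilon> \<nu>) q \<mu> \<nu> (comult_gen \<mu> \<upsilon> \<nu>)"
proof (intro Uq_star_rep.intro Uq_star_rep_axioms.intro Uq_rep.intro Uq_rep_axioms.intro
    UU.complex_star_algebra_T)
  let ?D = "comult_gen \<mu> \<upsilon> \<nu>" and ?T = "TU \<mu> \<upsilon> \<nu>"
  note tensor_norm = UU.pure_mult UU.pure_smult_left UU.pure_smult_right UU.pure_add_left
    UU.pure_add_right UU.T.alg_l_distr UU.T.alg_r_distr UU.T.alg_smult_add_right
  show "?D GKinv \<otimes>\<^bsub>?T\<^esub> ?D GK = \<one>\<^bsub>?T\<^esub>" "?D GK \<otimes>\<^bsub>?T\<^esub> ?D GKinv = \<one>\<^bsub>?T\<^esub>"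
    by (simp_all add: tensor_norm US.K_rules UU.pure_one)
  show "?D GK \<otimes>\<^bsub>?T\<^esub> ?D GE = q \<odot>\<^bsub>?T\<^esub> (?D GE \<otimes>\<^bsub>?T\<^esub> ?D GK)"
    "?D GK \<otimes>\<^bsub>?T\<^esub> ?D GF = complex_of_real (inverse q) \<odot>\<^bsub>?T\<^esub> (?D GF \<otimes>\<^bsub>?T\<^esub> ?D GK)"
    by (simp_all add: tensor_norm US.K_rules)
  show "?D GE \<otimes>\<^bsub>?T\<^esub> ?D GF = ?D GF \<otimes>\<^bsub>?T\<^esub> ?D GE \<oplus>\<^bsub>?T\<^esub> (lam q * \<mu>) \<odot>\<^bsub>?T\<^esub> (?D GK \<otimes>\<^bsub>?T\<^esub> ?D GK)
        \<oplus>\<^bsub>?T\<^esub> (- (lam q * \<nu>)) \<odot>\<^bsub>?T\<^esub> (?D GKinv \<otimes>\<^bsub>?T\<^esub> ?D GKinv)"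
    by (simp add: tensor_norm US.K_rules US.E_F UU.T.alg_add_ac UU.T.alg_cancel_inner)
  show "star ?T (?D z) = ?D (generator_star z)" for z
    by (cases z) (simp_all add: UU.pure_star US.star_g)
qed simp_all

definition antipode_gen :: "real \<Rightarrow> real \<Rightarrow> generator \<Rightarrow> Uq_elem" where
  "antipode_gen \<mu> \<nu> z = (case z of GK \<Rightarrow> UKinv q \<nu> \<mu> | GKinv \<Rightarrow> UK q \<nu> \<mu>
     | GE \<Rightarrow> complex_of_real (- q) \<odot>\<^bsub>Uq q \<nu> \<mu>\<^esub> UE q \<nu> \<mu>
     | GF \<Rightarrow> complex_of_real (- inverse q) \<odot>\<^bsub>Uq q \<nu> \<mu>\<^esub> UF q \<nu> \<mu>)"

lemma antipode_gen_simps [simp]: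
  "antipode_gen \<mu> \<nu> GK = UKinv q \<nu> \<mu>" "antipode_gen \<mu> \<nu> GKinv = UK q \<nu> \<mu>"
  "antipode_gen \<mu> \<nu> GE = complex_of_real (- q) \<odot>\<^bsub>Uq q \<nu> \<mu>\<^esub> UE q \<nu> \<mu>"
  "antipode_gen \<mu> \<nu> GF = complex_of_real (- inverse q) \<odot>\<^bsub>Uq q \<nu> \<mu>\<^esub> UF q \<nu> \<mu>"
  by (simp_all add: antipode_gen_def)

lemma antipode_gen_closed [simp]: "antipode_gen \<mu> \<nu> z \<in> carrier (Uq q \<nu> \<mu>)"
  by (cases z) simp_all

text \<open>The factors -q and -q^{-1} multiply to 1, and reversing products negates the commutator.
  This sign is compensated by the exchange of the indices together with that of K and
  K^{-1}.\<close>

lemma antipode_gen_rep: "Uq_rep (op_algebra (Uq q \<nu> \<mu>)) q \<mu> \<nu> (antipode_gen \<mu> \<nu>)"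
proof (intro Uq_rep.intro Uq_rep_axioms.intro U.complex_star_algebra_op)
qed (simp_all add: US.K_rules U.smult_mult_left U.smult_mult_right US.E_F U.alg_add_ac
      U.alg_cancel_left U.alg_cancel_right U.alg_smult_add_right US.q_cancel U.alg_cancel_inner)

definition counit_gen :: "generator \<Rightarrow> complex" where
  "counit_gen z = (if z = GK \<or> z = GKinv then 1 else 0)"

text \<open>Equal indices are essential: sending E and F to 0 and K to 1 requires lambda (mu - nu) =
  0.\<close>

lemma counit_gen_rep: "Uq_rep complex_algebra q \<mu> \<mu> counit_gen"
  by (intro Uq_rep.intro Uq_rep_axioms.intro complex_star_algebra_complex)
     (auto simp: complex_algebra_def counit_gen_def)

lemma
  shows comult_hom: "Uq_comult q \<mu> \<upsilon> \<nu> \<in> star_algebra_hom (Uq q \<mu> \<nu>) (TU \<mu> \<upsilon> \<nu>)"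
    and comult_gen_eq: "Uq_comult q \<mu> \<upsilon> \<nu> (Uq_gen q \<mu> \<nu> z) = comult_gen \<mu> \<upsilon> \<nu> z"
proof -
  let ?P = "\<lambda>f. f \<in> star_algebra_hom (Uq q \<mu> \<nu>) (TU \<mu> \<upsilon> \<nu>) \<and>
    f (UE q \<mu> \<nu>) = comult_gen \<mu> \<upsilon> \<nu> GE \<and> f (UK q \<mu> \<nu>) = comult_gen \<mu> \<upsilon> \<nu> GK"
  interpret D: Uq_star_rep "TU \<mu> \<upsilon> \<nu>" q \<mu> \<nu> "comult_gen \<mu> \<upsilon> \<nu>" by (rule comult_gen_rep)
  obtain f where f: "f \<in> algebra_hom (Uq q \<mu> \<nu>) (TU \<mu> \<upsilon> \<nu>)"
      "\<And>z. f (Uq_gen q \<mu> \<nu> z) = comult_gen \<mu> \<upsilon> \<nu> z"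
    using Uq_hom_exists[OF D.Uq_rep_axioms] by blast
  have "?P f"
    using f Uq_hom_star[OF D.Uq_star_rep_axioms f] by simp
  moreover have "f' = f" if "?P f'" for f'
  proof (rule Uq_hom_unique[OF UU.complex_star_algebra_T _ f(1)])
    \<comment> \<open>The characterisation of the comultiplication says nothing about F; its value
      follows from F = E^* and compatibility with the star.\<close>
    have "f' (star (Uq q \<mu> \<nu>) (UE q \<mu> \<nu>)) = star (TU \<mu> \<upsilon> \<nu>) (f' (UE q \<mu> \<nu>))"
      using that US.g_closed unfolding star_algebra_hom_def by blast
    then show "f' (UF q \<mu> \<nu>) = f (UF q \<mu> \<nu>)"
      using that f(2) by (simp add: US.star_g D.star_g del: comult_gen.simps)
  qed (use that f(2) in \<open>auto simp: star_algebra_hom_def\<close>)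
  ultimately have "(THE f. ?P f) = f"
    by (intro the_equality) blast+
  then have "Uq_comult q \<mu> \<upsilon> \<nu> = f"
    unfolding Uq_comult_def Let_def by simp
  then show "Uq_comult q \<mu> \<upsilon> \<nu> \<in> star_algebra_hom (Uq q \<mu> \<nu>) (TU \<mu> \<upsilon> \<nu>)"
    "Uq_comult q \<mu> \<upsilon> \<nu> (Uq_gen q \<mu> \<nu> z) = comult_gen \<mu> \<upsilon> \<nu> z"
    using \<open>?P f\<close> f by simp_all
qed

lemma
  shows antipode_antihom: "Uq_antipode q \<mu> \<nu> \<in> algebra_hom (Uq q \<mu> \<nu>) (op_algebra (Uq q \<nu> \<mu>))"
    and antipode_gen_eq: "Uq_antipode q \<mu> \<nu> (Uq_gen q \<mu> \<nu> z) = antipode_gen \<mu> \<nu> z"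
proof -
  let ?P = "\<lambda>f. f \<in> algebra_antihom (Uq q \<mu> \<nu>) (Uq q \<nu> \<mu>) \<and>
    f (UE q \<mu> \<nu>) = antipode_gen \<mu> \<nu> GE \<and> f (UF q \<mu> \<nu>) = antipode_gen \<mu> \<nu> GF \<and>
    f (UK q \<mu> \<nu>) = antipode_gen \<mu> \<nu> GK"
  obtain f where f: "f \<in> algebra_hom (Uq q \<mu> \<nu>) (op_algebra (Uq q \<nu> \<mu>))"
      "\<And>z. f (Uq_gen q \<mu> \<nu> z) = antipode_gen \<mu> \<nu> z"
    using Uq_hom_exists[OF antipode_gen_rep] by blast
  have "?P f"
    using f by (simp add: algebra_antihom_eq)
  moreover have "f' = f" if "?P f'" for f'
    by (rule Uq_hom_unique[OF U.complex_star_algebra_op _ f(1)])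
       (use that f(2) in \<open>auto simp: algebra_antihom_eq\<close>)
  ultimately have "(THE f. ?P f) = f"
    by (intro the_equality) blast+
  then have "Uq_antipode q \<mu> \<nu> = f"
    unfolding Uq_antipode_def antipode_gen_simps by simp
  then show "Uq_antipode q \<mu> \<nu> \<in> algebra_hom (Uq q \<mu> \<nu>) (op_algebra (Uq q \<nu> \<mu>))"
    "Uq_antipode q \<mu> \<nu> (Uq_gen q \<mu> \<nu> z) = antipode_gen \<mu> \<nu> z"
    using f by simp_all
qed

lemma
  shows counit_hom: "Uq_counit q \<mu> \<in> algebra_hom (Uq q \<mu> \<mu>) complex_algebra"
    and counit_gen_eq: "Uq_counit q \<mu> (Uq_gen q \<mu> \<mu> z) = counit_gen z"
proof -
  let ?P = "\<lambda>f. f \<in> algebra_hom (Uq q \<mu> \<mu>) complex_algebra \<and>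
    f (UE q \<mu> \<mu>) = 0 \<and> f (UF q \<mu> \<mu>) = 0 \<and> f (UK q \<mu> \<mu>) = 1"
  obtain f where f: "f \<in> algebra_hom (Uq q \<mu> \<mu>) complex_algebra"
      "\<And>z. f (Uq_gen q \<mu> \<mu> z) = counit_gen z"
    using Uq_hom_exists[OF counit_gen_rep] by blast
  have "?P f"
    using f by (simp add: counit_gen_def)
  moreover have "f' = f" if "?P f'" for f'
    by (rule Uq_hom_unique[OF complex_star_algebra_complex _ f(1)])
       (use that f(2) in \<open>auto simp: counit_gen_def\<close>)
  ultimately have "Uq_counit q \<mu> = f"
    unfolding Uq_counit_def by (intro the_equality) blast+
  then show "Uq_counit q \<mu> \<in> algebra_hom (Uq q \<mu> \<mu>) complex_algebra"
    "Uq_counit q \<mu> (Uq_gen q \<mu> \<mu> z) = counit_gen z"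
    using f by simp_all
qed

end

section \<open>Actions determined on generators\<close>

lemma (in quantum_parameter) comult_linear: "Uq_comult q \<mu> \<upsilon> \<nu> \<in> linear_maps (Uq q \<mu> \<nu>) (TU \<mu> \<upsilon> \<nu>)"
  and comult_mult: "\<lbrakk>x \<in> carrier (Uq q \<mu> \<nu>); y \<in> carrier (Uq q \<mu> \<nu>)\<rbrakk> \<Longrightarrow>
    Uq_comult q \<mu> \<upsilon> \<nu> (x \<otimes>\<^bsub>Uq q \<mu> \<nu>\<^esub> y) = Uq_comult q \<mu> \<upsilon> \<nu> x \<otimes>\<^bsub>TU \<mu> \<upsilon> \<nu>\<^esub> Uq_comult q \<mu> \<upsilon> \<nu> y"
  and comult_one: "Uq_comult q \<mu> \<upsilon> \<nu> \<one>\<^bsub>Uq q \<mu> \<nu>\<^esub> = \<one>\<^bsub>TU \<mu> \<upsilon> \<nu>\<^esub>"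
  using comult_hom[of \<mu> \<upsilon> \<nu>]
  by (auto simp: star_algebra_hom_def dest: algebra_hom_linear algebra_hom_mult algebra_hom_one)

lemma (in quantum_parameter) comult_closed [simp]:
  "x \<in> carrier (Uq q \<mu> \<nu>) \<Longrightarrow> Uq_comult q \<mu> \<upsilon> \<nu> x \<in> carrier (TU \<mu> \<upsilon> \<nu>)"
  using linear_maps_closed[OF comult_linear] .

lemma (in quantum_parameter)
  shows antipode_closed [simp]: "x \<in> carrier (Uq q \<mu> \<nu>) \<Longrightarrow> Uq_antipode q \<mu> \<nu> x \<in> carrier (Uq q \<nu> \<mu>)"
    and antipode_add: "\<lbrakk>x \<in> carrier (Uq q \<mu> \<nu>); y \<in> carrier (Uq q \<mu> \<nu>)\<rbrakk> \<Longrightarrow>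
      Uq_antipode q \<mu> \<nu> (x \<oplus>\<^bsub>Uq q \<mu> \<nu>\<^esub> y) = Uq_antipode q \<mu> \<nu> x \<oplus>\<^bsub>Uq q \<nu> \<mu>\<^esub> Uq_antipode q \<mu> \<nu> y"
    and antipode_smult: "x \<in> carrier (Uq q \<mu> \<nu>) \<Longrightarrow>
      Uq_antipode q \<mu> \<nu> (c \<odot>\<^bsub>Uq q \<mu> \<nu>\<^esub> x) = c \<odot>\<^bsub>Uq q \<nu> \<mu>\<^esub> Uq_antipode q \<mu> \<nu> x"
    and antipode_mult: "\<lbrakk>x \<in> carrier (Uq q \<mu> \<nu>); y \<in> carrier (Uq q \<mu> \<nu>)\<rbrakk> \<Longrightarrow>
      Uq_antipode q \<mu> \<nu> (x \<otimes>\<^bsub>Uq q \<mu> \<nu>\<^esub> y) = Uq_antipode q \<mu> \<nu> y \<otimes>\<^bsub>Uq q \<nu> \<mu>\<^esub> Uq_antipode q \<mu> \<nu> x"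
    and antipode_one: "Uq_antipode q \<mu> \<nu> \<one>\<^bsub>Uq q \<mu> \<nu>\<^esub> = \<one>\<^bsub>Uq q \<nu> \<mu>\<^esub>"
  using antipode_antihom[of \<mu> \<nu>]
  by (auto simp: algebra_hom_def ring_hom_def)

lemma (in quantum_parameter)
  shows counit_add: "\<lbrakk>x \<in> carrier (Uq q \<mu> \<mu>); y \<in> carrier (Uq q \<mu> \<mu>)\<rbrakk> \<Longrightarrow>
      Uq_counit q \<mu> (x \<oplus>\<^bsub>Uq q \<mu> \<mu>\<^esub> y) = Uq_counit q \<mu> x + Uq_counit q \<mu> y"
    and counit_smult: "x \<in> carrier (Uq q \<mu> \<mu>) \<Longrightarrow> Uq_counit q \<mu> (c \<odot>\<^bsub>Uq q \<mu> \<mu>\<^esub> x) = c * Uq_counit q \<mu> x"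
    and counit_mult: "\<lbrakk>x \<in> carrier (Uq q \<mu> \<mu>); y \<in> carrier (Uq q \<mu> \<mu>)\<rbrakk> \<Longrightarrow>
      Uq_counit q \<mu> (x \<otimes>\<^bsub>Uq q \<mu> \<mu>\<^esub> y) = Uq_counit q \<mu> x * Uq_counit q \<mu> y"
    and counit_one: "Uq_counit q \<mu> \<one>\<^bsub>Uq q \<mu> \<mu>\<^esub> = 1"
  using counit_hom[of \<mu>]
  by (auto simp: algebra_hom_def ring_hom_def complex_algebra_def)

text \<open>An action described by one operator \<open>G z\<close> per generator:
  \<open>act_gen_mult\<close> determines it recursively on words, and associativity and linearity in
  the module argument follow by \<open>Uq_induct\<close>. It is instantiated for U_q(mu,nu), A and
  B.\<close>

locale Uq_action = quantum_parameter q + V: complex_star_algebra V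
  for q :: real and V :: "('v, 'r) star_algebra_scheme" +
  fixes \<mu> :: real and G :: "generator \<Rightarrow> 'v \<Rightarrow> 'v" and act :: "Uq_elem \<Rightarrow> 'v \<Rightarrow> 'v"
  assumes G_linear: "G z \<in> linear_maps V V"
    and act_linear_left: "v \<in> carrier V \<Longrightarrow> (\<lambda>x. act x v) \<in> linear_maps (Uq q \<mu> \<mu>) V"
    and act_one: "v \<in> carrier V \<Longrightarrow> act \<one>\<^bsub>Uq q \<mu> \<mu>\<^esub> v = v"
    and act_gen_mult: "\<lbrakk>x \<in> carrier (Uq q \<mu> \<mu>); v \<in> carrier V\<rbrakk> \<Longrightarrow>
      act (Uq_gen q \<mu> \<mu> z \<otimes>\<^bsub>Uq q \<mu> \<mu>\<^esub> x) v = G z (act x v)"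
begin

abbreviation "H \<equiv> Uq q \<mu> \<mu>"

lemma act_closed [simp]: "\<lbrakk>x \<in> carrier H; v \<in> carrier V\<rbrakk> \<Longrightarrow> act x v \<in> carrier V"
  using linear_maps_closed[OF act_linear_left] .

lemma G_closed [simp]: "v \<in> carrier V \<Longrightarrow> G z v \<in> carrier V"
  using linear_maps_closed[OF G_linear] .

lemmas act_add_left = linear_maps_add[OF act_linear_left]
lemmas act_smult_left = linear_maps_smult[OF act_linear_left]

lemma act_linear_right:
  assumes "x \<in> carrier H"
  shows "act x \<in> linear_maps V V"
proof (rule linear_mapsI)
  show "act x (v \<oplus>\<^bsub>V\<^esub> w) = act x v \<oplus>\<^bsub>V\<^esub> act x w" if "v \<in> carrier V" "w \<in> carrier V" for v w
    using assms
    by (induction rule: Uq_induct)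
       (use that in \<open>simp_all add: act_one act_gen_mult act_add_left act_smult_left
          linear_maps_add[OF G_linear] V.alg_smult_add_right V.alg_add_ac\<close>)
  show "act x (c \<odot>\<^bsub>V\<^esub> v) = c \<odot>\<^bsub>V\<^esub> act x v" if "v \<in> carrier V" for c v
    using assms
    by (induction rule: Uq_induct)
       (use that in \<open>simp_all add: act_one act_gen_mult act_add_left act_smult_left
          linear_maps_smult[OF G_linear] V.alg_smult_add_right mult.commute\<close>)
qed (use assms in simp)

lemma act_mult:
  assumes "x \<in> carrier H" "y \<in> carrier H" "v \<in> carrier V"
  shows "act (x \<otimes>\<^bsub>H\<^esub> y) v = act x (act y v)"
  using assms(1)
  by (induction rule: Uq_induct)
     (use assms(2,3) in \<open>simp_all add: act_one act_gen_mult act_add_left act_smult_left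
        U.alg_l_distr U.smult_mult_left U.alg_mult_assoc\<close>)

lemma left_module: "left_module_over H V act"
  by (rule left_module_over.intro)
     (simp_all add: act_add_left act_smult_left linear_maps_add[OF act_linear_right]
       linear_maps_smult[OF act_linear_right] act_one act_mult)

lemma act_gen: "v \<in> carrier V \<Longrightarrow> act (Uq_gen q \<mu> \<mu> z) v = G z v"
  using act_gen_mult[of "\<one>\<^bsub>H\<^esub>" v z] by (simp add: act_one)

end

text \<open>The first group of assumptions is the module algebra law for the coproduct of each
  generator, the last one is compatibility with $S(x)^*$ for each generator \<open>x\<close>.\<close>

locale Uq_star_action = Uq_action +
  assumes G_K_mult: "\<lbrakk>a \<in> carrier V; b \<in> carrier V\<rbrakk> \<Longrightarrow> G GK (a \<otimes>\<^bsub>V\<^esub> b) = G GK a \<otimes>\<^bsub>V\<^esub> G GK b"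
    and G_Kinv_mult: "\<lbrakk>a \<in> carrier V; b \<in> carrier V\<rbrakk> \<Longrightarrow>
      G GKinv (a \<otimes>\<^bsub>V\<^esub> b) = G GKinv a \<otimes>\<^bsub>V\<^esub> G GKinv b"
    and G_E_mult: "\<lbrakk>a \<in> carrier V; b \<in> carrier V\<rbrakk> \<Longrightarrow>
      G GE (a \<otimes>\<^bsub>V\<^esub> b) = G GE a \<otimes>\<^bsub>V\<^esub> G GK b \<oplus>\<^bsub>V\<^esub> G GKinv a \<otimes>\<^bsub>V\<^esub> G GE b"
    and G_F_mult: "\<lbrakk>a \<in> carrier V; b \<in> carrier V\<rbrakk> \<Longrightarrow>
      G GF (a \<otimes>\<^bsub>V\<^esub> b) = G GF a \<otimes>\<^bsub>V\<^esub> G GK b \<oplus>\<^bsub>V\<^esub> G GKinv a \<otimes>\<^bsub>V\<^esub> G GF b"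
    and G_one: "G z \<one>\<^bsub>V\<^esub> = counit_gen z \<odot>\<^bsub>V\<^esub> \<one>\<^bsub>V\<^esub>"
    and G_K_star: "a \<in> carrier V \<Longrightarrow> G GK (star V a) = star V (G GKinv a)"
    and G_Kinv_star: "a \<in> carrier V \<Longrightarrow> G GKinv (star V a) = star V (G GK a)"
    and G_E_star: "a \<in> carrier V \<Longrightarrow> G GE (star V a) = (- q) \<odot>\<^bsub>V\<^esub> star V (G GF a)"
    and G_F_star: "a \<in> carrier V \<Longrightarrow> G GF (star V a) = (- inverse q) \<odot>\<^bsub>V\<^esub> star V (G GE a)"
begin

text \<open>The constants in the star assumptions come from S(E)^* = -q F and S(F)^* = -q^{-1} E,
  while S(K)^* = K^{-1}.\<close>

lemma act_star_gen:
  assumes "a \<in> carrier V"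
  shows "G z (star V a) = star V (act (star H (Uq_antipode q \<mu> \<mu> (Uq_gen q \<mu> \<mu> z))) a)"
  using assms
  by (cases z)
     (simp_all add: antipode_gen_eq US.star_g act_gen act_smult_left G_K_star G_Kinv_star
       G_E_star G_F_star)

text \<open>Since S(zx)^* = S(z)^* S(x)^*, the identity for x composed with the one for a generator
  z gives the identity for zx.\<close>

lemma act_star:
  assumes "x \<in> carrier H" "a \<in> carrier V"
  shows "act x (star V a) = star V (act (star H (Uq_antipode q \<mu> \<mu> x)) a)"
  using assms(1,2)
proof (induction arbitrary: a rule: Uq_induct)
  case (gen z x)
  then show ?case
    by (simp add: act_gen antipode_mult act_star_gen act_mult)
qed (simp_all add: act_one antipode_one antipode_add antipode_smult act_add_left act_smult_left)

lemma act_unit: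
  assumes "x \<in> carrier H"
  shows "act x \<one>\<^bsub>V\<^esub> = Uq_counit q \<mu> x \<odot>\<^bsub>V\<^esub> \<one>\<^bsub>V\<^esub>"
  using assms
  by (induction rule: Uq_induct)
     (simp_all add: act_one act_gen_mult counit_one counit_mult counit_add counit_smult counit_gen_eq
       linear_maps_smult[OF G_linear] G_one act_add_left act_smult_left V.alg_smult_add_left
       mult.commute)

lemma tensor_product_lift_act:
  assumes "a \<in> carrier V" "b \<in> carrier V"
  shows "tensor_product_lift H H V (\<lambda>x1 x2. act x1 a \<otimes>\<^bsub>V\<^esub> act x2 b)"
proof (intro tensor_product_lift.intro tensor_product_lift_axioms.intro
    UU.tensor_product_axioms V.complex_star_algebra_axioms bilinear_mapsI linear_mapsI)
qed (use assms in \<open>simp_all add: act_add_left act_smult_left V.alg_l_distr V.alg_r_distr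
      V.smult_mult_left V.smult_mult_right\<close>)

text \<open>Both sides are linear in \<open>t\<close>. On a pure tensor of x and y the claim is the
  module algebra law of the generator, applied to \<open>act x a\<close> and
  \<open>act y b\<close>.\<close>

lemma act_product_gen:
  assumes a: "a \<in> carrier V" and b: "b \<in> carrier V" and t: "t \<in> carrier (TU \<mu> \<mu> \<mu>)"
  shows "tensor_lift V (\<lambda>x1 x2. act x1 a \<otimes>\<^bsub>V\<^esub> act x2 b) (comult_gen \<mu> \<mu> \<mu> z \<otimes>\<^bsub>TU \<mu> \<mu> \<mu>\<^esub> t)
    = G z (tensor_lift V (\<lambda>x1 x2. act x1 a \<otimes>\<^bsub>V\<^esub> act x2 b) t)"
proof -
  interpret L: tensor_product_lift H H V "\<lambda>x1 x2. act x1 a \<otimes>\<^bsub>V\<^esub> act x2 b"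
    by (rule tensor_product_lift_act[OF a b])
  note lin = L.tensor_lift_linear
  note lin_simps = linear_maps_add[OF lin] linear_maps_smult[OF lin] linear_maps_closed[OF lin]
  show ?thesis
  proof (rule UU.linear_maps_T_eqI[OF _ _ t])
    show "(\<lambda>t. tensor_lift V (\<lambda>x1 x2. act x1 a \<otimes>\<^bsub>V\<^esub> act x2 b) (comult_gen \<mu> \<mu> \<mu> z \<otimes>\<^bsub>TU \<mu> \<mu> \<mu>\<^esub> t))
        \<in> linear_maps (TU \<mu> \<mu> \<mu>) V"
      by (rule linear_mapsI) (simp_all add: lin_simps UU.T.alg_r_distr UU.T.smult_mult_right)
    show "(\<lambda>t. G z (tensor_lift V (\<lambda>x1 x2. act x1 a \<otimes>\<^bsub>V\<^esub> act x2 b) t)) \<in> linear_maps (TU \<mu> \<mu> \<mu>) V"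
      by (rule linear_mapsI)
         (simp_all add: lin_simps linear_maps_add[OF G_linear] linear_maps_smult[OF G_linear])
    show "tensor_lift V (\<lambda>x1 x2. act x1 a \<otimes>\<^bsub>V\<^esub> act x2 b)
          (comult_gen \<mu> \<mu> \<mu> z \<otimes>\<^bsub>TU \<mu> \<mu> \<mu>\<^esub> pure_tensor H H x y)
        = G z (tensor_lift V (\<lambda>x1 x2. act x1 a \<otimes>\<^bsub>V\<^esub> act x2 b) (pure_tensor H H x y))"
      if "x \<in> carrier H" "y \<in> carrier H" for x y
      using that a b
      by (cases z) (simp_all add: UU.pure_mult UU.T.alg_l_distr lin_simps L.tensor_lift_pure
        act_gen_mult G_K_mult G_Kinv_mult G_E_mult G_F_mult)
  qed
qed

lemma act_product:
  assumes "x \<in> carrier H" "a \<in> carrier V" "b \<in> carrier V"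
  shows "act x (a \<otimes>\<^bsub>V\<^esub> b) =
    tensor_lift V (\<lambda>x1 x2. act x1 a \<otimes>\<^bsub>V\<^esub> act x2 b) (Uq_comult q \<mu> \<mu> \<mu> x)"
proof -
  interpret L: tensor_product_lift H H V "\<lambda>x1 x2. act x1 a \<otimes>\<^bsub>V\<^esub> act x2 b"
    by (rule tensor_product_lift_act[OF assms(2,3)])
  note lin = L.tensor_lift_linear
  show ?thesis
    using assms(1)
    by (induction rule: Uq_induct)
       (use assms(2,3) in \<open>simp_all add: act_one comult_one UU.pure_one L.tensor_lift_pure
          act_gen_mult comult_mult comult_gen_eq act_product_gen act_add_left act_smult_left
          linear_maps_add[OF comult_linear] linear_maps_smult[OF comult_linear]
          linear_maps_add[OF lin] linear_maps_smult[OF lin]\<close>)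
qed

lemma left_module_star_algebra:
  "left_module_star_algebra H (Uq_comult q \<mu> \<mu> \<mu>) (Uq_counit q \<mu>) (Uq_antipode q \<mu> \<mu>) V act"
  by (intro left_module_star_algebra.intro left_module_star_algebra_axioms.intro left_module
      V.complex_star_algebra_axioms act_product act_unit act_star)

end

section \<open>The adjoint action of the generators\<close>

context Uq_rep
begin

text \<open>The Miyashita-Ulbrich formula evaluated on generators: E has coproduct E \<otimes> K +
  K^{-1} \<otimes> E, and S(K) = K^{-1}, S(E) = -q E. Read in any \<open>Uq_rep\<close>, it serves
  U_q(mu,nu) and A alike.\<close>

primrec adj :: "generator \<Rightarrow> 'a \<Rightarrow> 'a" where
  "adj GK a = g GK \<otimes> a \<otimes> g GKinv"
| "adj GKinv a = g GKinv \<otimes> a \<otimes> g GK"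
| "adj GE a = g GE \<otimes> a \<otimes> g GKinv \<oplus> (- q) \<odot> (g GKinv \<otimes> a \<otimes> g GE)"
| "adj GF a = g GF \<otimes> a \<otimes> g GKinv \<oplus> (- inverse q) \<odot> (g GKinv \<otimes> a \<otimes> g GF)"

lemma adj_linear: "adj z \<in> linear_maps A A"
  by (rule linear_mapsI; cases z)
     (simp_all add: alg_l_distr alg_r_distr smult_mult_left smult_mult_right alg_smult_add_right
        alg_add_ac mult.commute)

lemma adj_closed [simp]: "a \<in> carrier A \<Longrightarrow> adj z a \<in> carrier A"
  using linear_maps_closed[OF adj_linear] .

text \<open>For E the right-hand side has the extra terms -q K^{-1} a E K b K^{-1} and K^{-1} a K E
  b K^{-1}, which cancel because KE = qEK. For F the same happens with q^{-1}.\<close>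

lemma
  assumes "a \<in> carrier A" "b \<in> carrier A"
  shows adj_K_mult: "adj GK (a \<otimes> b) = adj GK a \<otimes> adj GK b"
    and adj_Kinv_mult: "adj GKinv (a \<otimes> b) = adj GKinv a \<otimes> adj GKinv b"
    and adj_E_mult: "adj GE (a \<otimes> b) = adj GE a \<otimes> adj GK b \<oplus> adj GKinv a \<otimes> adj GE b"
    and adj_F_mult: "adj GF (a \<otimes> b) = adj GF a \<otimes> adj GK b \<oplus> adj GKinv a \<otimes> adj GF b"
  using assms
  by (simp_all add: K_norm alg_add_ac q_cancel alg_cancel_left alg_cancel_inner alg_cancel_right)

lemma adj_one: "adj z \<one> = (if z = GK \<or> z = GKinv then 1 else 0) \<odot> \<one>"
  by (cases z) (simp_all add: K_norm q_cancel alg_cancel_left alg_cancel_inner alg_cancel_right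
    alg_cancel)

end

context Uq_star_rep
begin

text \<open>The star carries each summand of \<open>adj GF a\<close> to a multiple of the other
  summand of \<open>adj GE (star A a)\<close>; the factor -q corrects both coefficients at
  once.\<close>

lemma
  assumes "a \<in> carrier A"
  shows adj_K_star: "adj GK (star A a) = star A (adj GKinv a)"
    and adj_Kinv_star: "adj GKinv (star A a) = star A (adj GK a)"
    and adj_E_star: "adj GE (star A a) = (- q) \<odot> star A (adj GF a)"
    and adj_F_star: "adj GF (star A a) = (- inverse q) \<odot> star A (adj GE a)"
  using assms
  by (simp_all add: star_g alg_mult_assoc alg_smult_add_right q_cancel alg_add_ac q0)

end

section \<open>The Miyashita-Ulbrich action on U_q(mu,nu)\<close>

context quantum_parameter
begin

lemma tensor_product_lift_MU:
  assumes "y \<in> carrier (Uq q \<mu> \<nu>)"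
  shows "tensor_product_lift (Uq q \<mu> \<nu>) (Uq q \<nu> \<mu>) (Uq q \<mu> \<nu>)
    (\<lambda>x1 x2. x1 \<otimes>\<^bsub>Uq q \<mu> \<nu>\<^esub> y \<otimes>\<^bsub>Uq q \<mu> \<nu>\<^esub> Uq_antipode q \<nu> \<mu> x2)"
proof (intro tensor_product_lift.intro tensor_product_lift_axioms.intro
    UU.tensor_product_axioms U.complex_star_algebra_axioms bilinear_mapsI linear_mapsI)
qed (use assms in \<open>simp_all add: antipode_add antipode_smult U.alg_l_distr U.alg_r_distr
      U.smult_mult_left U.smult_mult_right\<close>)

text \<open>For a pure tensor of x1 and x2, anti-multiplicativity of S gives (z1 x1) y S(z2 x2) = z1
  (x1 y S(x2)) S(z2), so the generator acts from outside on the value already computed.\<close>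

lemma MU_gen:
  assumes y: "y \<in> carrier (Uq q \<mu> \<nu>)" and t: "t \<in> carrier (TU \<mu> \<nu> \<mu>)"
  defines "f \<equiv> \<lambda>x1 x2. x1 \<otimes>\<^bsub>Uq q \<mu> \<nu>\<^esub> y \<otimes>\<^bsub>Uq q \<mu> \<nu>\<^esub> Uq_antipode q \<nu> \<mu> x2"
  shows "tensor_lift (Uq q \<mu> \<nu>) f (comult_gen \<mu> \<nu> \<mu> z \<otimes>\<^bsub>TU \<mu> \<nu> \<mu>\<^esub> t)
    = US.adj \<mu> \<nu> z (tensor_lift (Uq q \<mu> \<nu>) f t)"
proof -
  interpret L: tensor_product_lift "Uq q \<mu> \<nu>" "Uq q \<nu> \<mu>" "Uq q \<mu> \<nu>" f
    unfolding f_def by (rule tensor_product_lift_MU[OF y])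
  note lin = L.tensor_lift_linear
  note lin_simps = linear_maps_add[OF lin] linear_maps_smult[OF lin] linear_maps_closed[OF lin]
  have f_apply: "f a b = a \<otimes>\<^bsub>Uq q \<mu> \<nu>\<^esub> y \<otimes>\<^bsub>Uq q \<mu> \<nu>\<^esub> Uq_antipode q \<nu> \<mu> b" for a b
    by (simp add: f_def)
  show ?thesis
  proof (rule UU.linear_maps_T_eqI[OF _ _ t])
    show "(\<lambda>t. tensor_lift (Uq q \<mu> \<nu>) f (comult_gen \<mu> \<nu> \<mu> z \<otimes>\<^bsub>TU \<mu> \<nu> \<mu>\<^esub> t))
        \<in> linear_maps (TU \<mu> \<nu> \<mu>) (Uq q \<mu> \<nu>)"
      by (rule linear_mapsI) (simp_all add: lin_simps UU.T.alg_r_distr UU.T.smult_mult_right)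
    show "(\<lambda>t. US.adj \<mu> \<nu> z (tensor_lift (Uq q \<mu> \<nu>) f t)) \<in> linear_maps (TU \<mu> \<nu> \<mu>) (Uq q \<mu> \<nu>)"
      by (rule linear_mapsI)
         (simp_all add: lin_simps linear_maps_add[OF US.adj_linear] linear_maps_smult[OF US.adj_linear])
    show "tensor_lift (Uq q \<mu> \<nu>) f
          (comult_gen \<mu> \<nu> \<mu> z \<otimes>\<^bsub>TU \<mu> \<nu> \<mu>\<^esub> pure_tensor (Uq q \<mu> \<nu>) (Uq q \<nu> \<mu>) x1 x2)
        = US.adj \<mu> \<nu> z (tensor_lift (Uq q \<mu> \<nu>) f (pure_tensor (Uq q \<mu> \<nu>) (Uq q \<nu> \<mu>) x1 x2))"
      if "x1 \<in> carrier (Uq q \<mu> \<nu>)" "x2 \<in> carrier (Uq q \<nu> \<mu>)" for x1 x2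
      using that y
      by (cases z) (simp_all add: UU.pure_mult UU.T.alg_l_distr lin_simps L.tensor_lift_pure
        f_apply antipode_mult antipode_gen_eq U.alg_mult_assoc U.smult_mult_right)
  qed
qed

lemma MU_is_action: "Uq_action q (Uq q \<mu> \<nu>) \<mu> (US.adj \<mu> \<nu>) (MU_action q \<mu> \<nu>)"
proof (intro Uq_action.intro Uq_action_axioms.intro quantum_parameter_axioms
    U.complex_star_algebra_axioms US.adj_linear)
  fix y assume y: "y \<in> carrier (Uq q \<mu> \<nu>)"
  interpret L: tensor_product_lift "Uq q \<mu> \<nu>" "Uq q \<nu> \<mu>" "Uq q \<mu> \<nu>"
      "\<lambda>x1 x2. x1 \<otimes>\<^bsub>Uq q \<mu> \<nu>\<^esub> y \<otimes>\<^bsub>Uq q \<mu> \<nu>\<^esub> Uq_antipode q \<nu> \<mu> x2"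
    by (rule tensor_product_lift_MU[OF y])
  note lin = L.tensor_lift_linear
  show "(\<lambda>x. MU_action q \<mu> \<nu> x y) \<in> linear_maps (Uq q \<mu> \<mu>) (Uq q \<mu> \<nu>)"
    by (rule linear_mapsI) (simp_all add: MU_action_def linear_maps_add[OF comult_linear]
      linear_maps_smult[OF comult_linear] linear_maps_add[OF lin] linear_maps_smult[OF lin]
      linear_maps_closed[OF lin])
  show "MU_action q \<mu> \<nu> \<one>\<^bsub>Uq q \<mu> \<mu>\<^esub> y = y"
    using y by (simp add: MU_action_def comult_one UU.pure_one L.tensor_lift_pure antipode_one)
  show "MU_action q \<mu> \<nu> (Uq_gen q \<mu> \<mu> z \<otimes>\<^bsub>Uq q \<mu> \<mu>\<^esub> x) y = US.adj \<mu> \<nu> z (MU_action q \<mu> \<nu> x y)"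
    if "x \<in> carrier (Uq q \<mu> \<mu>)" for z x
    using that y by (simp add: MU_action_def comult_mult comult_gen_eq MU_gen)
qed

end

section \<open>The quotients $A_{\mu\nu}^\tau$\<close>

lemma (in star_ideal) Uq_star_rep_quotient:
  assumes "Uq_star_rep A q \<mu> \<nu> g"
  shows "Uq_star_rep Q q \<mu> \<nu> (\<lambda>z. proj (g z))"
proof -
  interpret R: Uq_star_rep A q \<mu> \<nu> g by fact
  show ?thesis
    by (intro Uq_star_rep.intro Uq_star_rep_axioms.intro Uq_rep.intro Uq_rep_axioms.intro
        complex_star_algebra_Q)
       (simp_all add: R.q0 proj_simps R.Kinv_K R.K_Kinv R.K_E R.K_F R.E_F R.star_g)
qed

context quantum_parameter
begin

lemma casimir_closed [simp]: "casimir q \<mu> \<nu> \<in> carrier (Uq q \<mu> \<nu>)"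
  by (simp add: casimir_def Let_def)

lemma star_casimir: "star (Uq q \<mu> \<nu>) (casimir q \<mu> \<nu>) = casimir q \<mu> \<nu>"
  by (simp add: casimir_def Let_def US.star_g)

lemma star_ideal_casimir: "star_ideal (casimir_ideal q \<mu> \<nu> \<tau>) (Uq q \<mu> \<nu>)"
  unfolding casimir_ideal_def Let_def
proof (rule U.star_ideal_genideal)
  let ?r = "casimir q \<mu> \<nu> \<ominus>\<^bsub>Uq q \<mu> \<nu>\<^esub> (\<tau> * inverse q * (lam q)\<^sup>2) \<odot>\<^bsub>Uq q \<mu> \<nu>\<^esub> \<one>\<^bsub>Uq q \<mu> \<nu>\<^esub>"
  fix x assume "x \<in> {?r}"
  moreover have "?r \<in> Idl\<^bsub>Uq q \<mu> \<nu>\<^esub> {?r}"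
    by (rule ring.genideal_self'[OF U.alg_ring]) simp
  moreover have "star (Uq q \<mu> \<nu>) ?r = ?r"
    by (simp add: U.alg_minus_eq_smult star_casimir)
  ultimately show "star (Uq q \<mu> \<nu>) x \<in> Idl\<^bsub>Uq q \<mu> \<nu>\<^esub> {?r}"
    by simp
qed simp

sublocale CI: star_ideal "casimir_ideal q \<mu> \<nu> \<tau>" "Uq q \<mu> \<nu>" for \<mu> \<nu> \<tau>
  by (rule star_ideal_casimir)

sublocale AS: Uq_star_rep "A_algebra q \<mu> \<nu> \<tau>" q \<mu> \<nu> "\<lambda>z. A_proj q \<mu> \<nu> \<tau> (Uq_gen q \<mu> \<nu> z)"
  for \<mu> \<nu> \<tau>
  unfolding A_algebra_def A_proj_def by (rule CI.Uq_star_rep_quotient[OF Uq_star_rep_Uq])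

lemma A_proj_closed [simp]: "y \<in> carrier (Uq q \<mu> \<nu>) \<Longrightarrow> A_proj q \<mu> \<nu> \<tau> y \<in> carrier (A_algebra q \<mu> \<nu> \<tau>)"
  by (simp add: A_algebra_def A_proj_def)

lemma A_cases:
  assumes "X \<in> carrier (A_algebra q \<mu> \<nu> \<tau>)"
  obtains y where "y \<in> carrier (Uq q \<mu> \<nu>)" "X = A_proj q \<mu> \<nu> \<tau> y"
  using assms unfolding A_algebra_def A_proj_def by (rule CI.Q_cases)

lemmas A_proj_simps = CI.proj_simps[folded A_algebra_def, folded A_proj_def]

text \<open>The Casimir relation solved for EF, which places EF in the span of 1, K^2 and
  K^{-2}.\<close>

lemma A_E_F:
  fixes \<mu> \<nu> \<tau> :: real
  defines "A \<equiv> A_algebra q \<mu> \<nu> \<tau>" and "g \<equiv> \<lambda>z. A_proj q \<mu> \<nu> \<tau> (Uq_gen q \<mu> \<nu> z)"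
  shows "g GE \<otimes>\<^bsub>A\<^esub> g GF = (\<tau> * inverse q * (lam q)\<^sup>2) \<odot>\<^bsub>A\<^esub> \<one>\<^bsub>A\<^esub>
      \<oplus>\<^bsub>A\<^esub> (- ((lam q)\<^sup>2 * (inverse q * \<mu>))) \<odot>\<^bsub>A\<^esub> (g GK \<otimes>\<^bsub>A\<^esub> g GK)
      \<oplus>\<^bsub>A\<^esub> (- ((lam q)\<^sup>2 * (q * \<nu>))) \<odot>\<^bsub>A\<^esub> (g GKinv \<otimes>\<^bsub>A\<^esub> g GKinv)"
proof -
  let ?c = "complex_of_real (\<tau> * inverse q * (lam q)\<^sup>2)"
  have "casimir q \<mu> \<nu> \<ominus>\<^bsub>Uq q \<mu> \<nu>\<^esub> ?c \<odot>\<^bsub>Uq q \<mu> \<nu>\<^esub> \<one>\<^bsub>Uq q \<mu> \<nu>\<^esub> \<in> casimir_ideal q \<mu> \<nu> \<tau>"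
    unfolding casimir_ideal_def Let_def
    by (rule ring.genideal_self'[OF U.alg_ring]) simp
  then have "A_proj q \<mu> \<nu> \<tau> (casimir q \<mu> \<nu>) = A_proj q \<mu> \<nu> \<tau> (?c \<odot>\<^bsub>Uq q \<mu> \<nu>\<^esub> \<one>\<^bsub>Uq q \<mu> \<nu>\<^esub>)"
    unfolding A_proj_def by (subst CI.proj_eq_iff) simp_all
  then have "g GE \<otimes>\<^bsub>A\<^esub> g GF \<oplus>\<^bsub>A\<^esub> ((lam q)\<^sup>2 * (inverse q * \<mu>)) \<odot>\<^bsub>A\<^esub> (g GK \<otimes>\<^bsub>A\<^esub> g GK)
      \<oplus>\<^bsub>A\<^esub> ((lam q)\<^sup>2 * (q * \<nu>)) \<odot>\<^bsub>A\<^esub> (g GKinv \<otimes>\<^bsub>A\<^esub> g GKinv) = ?c \<odot>\<^bsub>A\<^esub> \<one>\<^bsub>A\<^esub>"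
    unfolding A_def g_def
    by (simp add: casimir_def Let_def A_proj_simps U.alg_smult_add_right AS.alg_add_assoc
      flip: A_proj_simps)
  then show ?thesis
    unfolding A_def g_def of_real_minus by (rule AS.alg_move3) simp_all
qed

text \<open>The coefficients are left unnamed because only membership in B is wanted: 1 and K^2 lie
  in B, and the point is that no K^{-2} term remains.\<close>

lemma A_adj_F_KE:
  fixes \<mu> \<nu> \<tau> :: real
  defines "A \<equiv> A_algebra q \<mu> \<nu> \<tau>" and "g \<equiv> \<lambda>z. A_proj q \<mu> \<nu> \<tau> (Uq_gen q \<mu> \<nu> z)"
  obtains c d where
    "AS.adj \<mu> \<nu> \<tau> GF (g GK \<otimes>\<^bsub>A\<^esub> g GE) = c \<odot>\<^bsub>A\<^esub> \<one>\<^bsub>A\<^esub> \<oplus>\<^bsub>A\<^esub> d \<odot>\<^bsub>A\<^esub> (g GK \<otimes>\<^bsub>A\<^esub> g GK)"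
proof -
  let ?l = "complex_of_real (lam q)" and ?q = "complex_of_real q"
  let ?m = "complex_of_real \<mu>" and ?n = "complex_of_real \<nu>"
  let ?a0 = "complex_of_real (\<tau> * inverse q * (lam q)\<^sup>2)"
  let ?a1 = "- (?l\<^sup>2 * (inverse ?q * ?m))" and ?a2 = "- (?l\<^sup>2 * (?q * ?n))"
  have EF: "g GE \<otimes>\<^bsub>A\<^esub> g GF = ?a0 \<odot>\<^bsub>A\<^esub> \<one>\<^bsub>A\<^esub> \<oplus>\<^bsub>A\<^esub> ?a1 \<odot>\<^bsub>A\<^esub> (g GK \<otimes>\<^bsub>A\<^esub> g GK)
      \<oplus>\<^bsub>A\<^esub> ?a2 \<odot>\<^bsub>A\<^esub> (g GKinv \<otimes>\<^bsub>A\<^esub> g GKinv)"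
    using A_E_F[of \<mu> \<nu> \<tau>] unfolding A_def g_def by simp
  have "g GF \<otimes>\<^bsub>A\<^esub> g GE \<oplus>\<^bsub>A\<^esub> (?l * ?m) \<odot>\<^bsub>A\<^esub> (g GK \<otimes>\<^bsub>A\<^esub> g GK)
      \<oplus>\<^bsub>A\<^esub> (- (?l * ?n)) \<odot>\<^bsub>A\<^esub> (g GKinv \<otimes>\<^bsub>A\<^esub> g GKinv) = g GE \<otimes>\<^bsub>A\<^esub> g GF"
    unfolding A_def g_def AS.E_F by simp
  then have "g GF \<otimes>\<^bsub>A\<^esub> g GE = g GE \<otimes>\<^bsub>A\<^esub> g GF \<oplus>\<^bsub>A\<^esub> (- (?l * ?m)) \<odot>\<^bsub>A\<^esub> (g GK \<otimes>\<^bsub>A\<^esub> g GK)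
      \<oplus>\<^bsub>A\<^esub> (- (- (?l * ?n))) \<odot>\<^bsub>A\<^esub> (g GKinv \<otimes>\<^bsub>A\<^esub> g GKinv)"
    unfolding A_def g_def by (rule AS.alg_move3) simp_all
  also have "\<dots> = ?a0 \<odot>\<^bsub>A\<^esub> \<one>\<^bsub>A\<^esub> \<oplus>\<^bsub>A\<^esub> (?a1 + - (?l * ?m)) \<odot>\<^bsub>A\<^esub> (g GK \<otimes>\<^bsub>A\<^esub> g GK)
      \<oplus>\<^bsub>A\<^esub> (?a2 + - (- (?l * ?n))) \<odot>\<^bsub>A\<^esub> (g GKinv \<otimes>\<^bsub>A\<^esub> g GKinv)"
    unfolding EF unfolding A_def g_def by (rule AS.alg_combine2) simp_all
  finally have FE: "g GF \<otimes>\<^bsub>A\<^esub> g GE = \<dots>" .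
  \<comment> \<open>With a2 = -lambda^2 q nu, the K^{-2} coefficient of EF, that of FE is a2 +
    lambda nu, so the sum is q lambda nu - lambda^2 (q - q^{-1}) q nu. It vanishes since lambda^2 (q
    - q^{-1}) = lambda.\<close>
  have coeff: "?q * (?a2 + - (- (?l * ?n))) + (- inverse ?q) * ?a2 = 0"
  proof -
    \<comment> \<open>Ensures that \<open>lam q\<close> is a genuine inverse and not the default
      value \<open>inverse 0 = 0\<close>.\<close>
    have "q - inverse q \<noteq> 0"
      using q_pos q_less_1 by (simp add: field_simps) (metis less_irrefl mult_less_cancel_left_pos mult.right_neutral order_less_trans)
    then have "(lam q)\<^sup>2 * (q - inverse q) = lam q"
      by (simp add: lam_def power2_eq_square)
    then have "?l\<^sup>2 * (?q - inverse ?q) = ?l"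
      by (metis of_real_diff of_real_inverse of_real_mult of_real_power)
    then have "?l * (?q * ?n) = (?l\<^sup>2 * (?q - inverse ?q)) * (?q * ?n)"
      by simp
    then show ?thesis
      by (simp add: algebra_simps)
  qed
  have "AS.adj \<mu> \<nu> \<tau> GF (g GK \<otimes>\<^bsub>A\<^esub> g GE)
      = ?q \<odot>\<^bsub>A\<^esub> (g GF \<otimes>\<^bsub>A\<^esub> g GE) \<oplus>\<^bsub>A\<^esub> (- inverse ?q) \<odot>\<^bsub>A\<^esub> (g GE \<otimes>\<^bsub>A\<^esub> g GF)"
    unfolding A_def g_def by (simp add: AS.K_norm)
  also have "\<dots> = (?q * ?a0 + (- inverse ?q) * ?a0) \<odot>\<^bsub>A\<^esub> \<one>\<^bsub>A\<^esub>
      \<oplus>\<^bsub>A\<^esub> (?q * (?a1 + - (?l * ?m)) + (- inverse ?q) * ?a1) \<odot>\<^bsub>A\<^esub> (g GK \<otimes>\<^bsub>A\<^esub> g GK)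
      \<oplus>\<^bsub>A\<^esub> (?q * (?a2 + - (- (?l * ?n))) + (- inverse ?q) * ?a2) \<odot>\<^bsub>A\<^esub> (g GKinv \<otimes>\<^bsub>A\<^esub> g GKinv)"
    unfolding FE EF unfolding A_def g_def by (rule AS.alg_combine3) simp_all
  also have "\<dots> = (?q * ?a0 + (- inverse ?q) * ?a0) \<odot>\<^bsub>A\<^esub> \<one>\<^bsub>A\<^esub>
      \<oplus>\<^bsub>A\<^esub> (?q * (?a1 + - (?l * ?m)) + (- inverse ?q) * ?a1) \<odot>\<^bsub>A\<^esub> (g GK \<otimes>\<^bsub>A\<^esub> g GK)"
    unfolding coeff unfolding A_def g_def by simp
  finally show thesis by (rule that)
qed

text \<open>This makes \<open>A_action\<close> well defined: by linearity, representatives of one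
  coset are sent to representatives of one coset.\<close>

lemma MU_mem_casimir_ideal:
  assumes "x \<in> carrier (Uq q \<mu> \<mu>)" "y \<in> casimir_ideal q \<mu> \<nu> \<tau>"
  shows "MU_action q \<mu> \<nu> x y \<in> casimir_ideal q \<mu> \<nu> \<tau>"
proof -
  interpret MU: Uq_action q "Uq q \<mu> \<nu>" \<mu> "US.adj \<mu> \<nu>" "MU_action q \<mu> \<nu>" by (rule MU_is_action)
  have y: "y \<in> carrier (Uq q \<mu> \<nu>)"
    using CI.a_Hcarr[OF assms(2)] .
  have add: "a \<oplus>\<^bsub>Uq q \<mu> \<nu>\<^esub> b \<in> casimir_ideal q \<mu> \<nu> \<tau>"
    if "a \<in> casimir_ideal q \<mu> \<nu> \<tau>" "b \<in> casimir_ideal q \<mu> \<nu> \<tau>" for a b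
    using CI.a_closed that .
  have adj: "US.adj \<mu> \<nu> z a \<in> casimir_ideal q \<mu> \<nu> \<tau>" if "a \<in> casimir_ideal q \<mu> \<nu> \<tau>" for z a
    using that by (cases z) (simp_all add: CI.I_l_closed CI.I_r_closed CI.smult_mem add)
  show ?thesis
    using assms(1)
    by (induction rule: Uq_induct)
       (use assms(2) y in \<open>simp_all add: adj MU.act_one MU.act_gen_mult MU.act_add_left
          MU.act_smult_left add CI.smult_mem del: US.adj.simps\<close>)
qed

lemma A_action_proj:
  assumes x: "x \<in> carrier (Uq q \<mu> \<mu>)" and y: "y \<in> carrier (Uq q \<mu> \<nu>)"
  shows "A_action q \<mu> \<nu> \<tau> x (A_proj q \<mu> \<nu> \<tau> y) = A_proj q \<mu> \<nu> \<tau> (MU_action q \<mu> \<nu> x y)"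
  unfolding A_action_def A_proj_def
proof (rule CI.UN_proj_eq[OF y])
  interpret MU: Uq_action q "Uq q \<mu> \<nu>" \<mu> "US.adj \<mu> \<nu>" "MU_action q \<mu> \<nu>" by (rule MU_is_action)
  note lin = MU.act_linear_right[OF x]
  fix y' assume y': "y' \<in> carrier (Uq q \<mu> \<nu>)" "CI.proj \<mu> \<nu> \<tau> y' = CI.proj \<mu> \<nu> \<tau> y"
  then have "MU_action q \<mu> \<nu> x (y' \<ominus>\<^bsub>Uq q \<mu> \<nu>\<^esub> y) \<in> casimir_ideal q \<mu> \<nu> \<tau>"
    using x y by (simp add: CI.proj_eq_iff MU_mem_casimir_ideal)
  then show "CI.proj \<mu> \<nu> \<tau> (MU_action q \<mu> \<nu> x y') = CI.proj \<mu> \<nu> \<tau> (MU_action q \<mu> \<nu> x y)"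
    using x y y' by (simp add: CI.proj_eq_iff U.alg_minus_eq_smult linear_maps_add[OF lin]
      linear_maps_smult[OF lin])
qed

lemma A_adj_proj:
  "y \<in> carrier (Uq q \<mu> \<nu>) \<Longrightarrow> AS.adj \<mu> \<nu> \<tau> z (A_proj q \<mu> \<nu> \<tau> y) = A_proj q \<mu> \<nu> \<tau> (US.adj \<mu> \<nu> z y)"
  by (cases z) (simp_all add: A_proj_simps)

lemma A_is_action: "Uq_action q (A_algebra q \<mu> \<nu> \<tau>) \<mu> (AS.adj \<mu> \<nu> \<tau>) (A_action q \<mu> \<nu> \<tau>)"
proof (intro Uq_action.intro Uq_action_axioms.intro quantum_parameter_axioms
    AS.complex_star_algebra_axioms AS.adj_linear)
  interpret MU: Uq_action q "Uq q \<mu> \<nu>" \<mu> "US.adj \<mu> \<nu>" "MU_action q \<mu> \<nu>" by (rule MU_is_action)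
  fix v assume "v \<in> carrier (A_algebra q \<mu> \<nu> \<tau>)"
  then obtain y where y: "y \<in> carrier (Uq q \<mu> \<nu>)" "v = A_proj q \<mu> \<nu> \<tau> y"
    by (rule A_cases)
  show "(\<lambda>x. A_action q \<mu> \<nu> \<tau> x v) \<in> linear_maps (Uq q \<mu> \<mu>) (A_algebra q \<mu> \<nu> \<tau>)"
    by (rule linear_mapsI)
       (simp_all add: y A_action_proj MU.act_add_left MU.act_smult_left A_proj_simps)
  show "A_action q \<mu> \<nu> \<tau> \<one>\<^bsub>Uq q \<mu> \<mu>\<^esub> v = v"
    by (simp add: y A_action_proj MU.act_one)
  show "A_action q \<mu> \<nu> \<tau> (Uq_gen q \<mu> \<mu> z \<otimes>\<^bsub>Uq q \<mu> \<mu>\<^esub> x) v = AS.adj \<mu> \<nu> \<tau> z (A_action q \<mu> \<nu> \<tau> x v)"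
    if "x \<in> carrier (Uq q \<mu> \<mu>)" for x z
    using that by (simp add: y A_action_proj MU.act_gen_mult A_adj_proj)
qed

section \<open>The subalgebras $B_{\mu\nu}^\tau$\<close>

lemma star_subalgebra_generated:
  assumes "complex_star_algebra A" "X \<subseteq> carrier A"
  shows "star_subalgebra (generated_star_subalgebra A X) A" "X \<subseteq> generated_star_subalgebra A X"
proof -
  interpret A: complex_star_algebra A by fact
  \<comment> \<open>The carrier belongs to the intersected family, which is therefore nonempty, and
    the intersection stays inside the carrier.\<close>
  have "star_subalgebra (carrier A) A"
    by (simp add: star_subalgebra_def)
  then have "generated_star_subalgebra A X \<subseteq> carrier A"
    using assms(2) by (auto simp: generated_star_subalgebra_def)
  then show "star_subalgebra (generated_star_subalgebra A X) A"
    unfolding star_subalgebra_def generated_star_subalgebra_def by auto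
  show "X \<subseteq> generated_star_subalgebra A X"
    by (auto simp: generated_star_subalgebra_def)
qed

lemma generated_star_subalgebra_minimal:
  "\<lbrakk>star_subalgebra S A; X \<subseteq> S\<rbrakk> \<Longrightarrow> generated_star_subalgebra A X \<subseteq> S"
  by (auto simp: generated_star_subalgebra_def)

lemma
  shows B_subalgebra: "star_subalgebra (B_carrier q \<mu> \<nu> \<tau>) (A_algebra q \<mu> \<nu> \<tau>)"
    and B_K_K: "A_proj q \<mu> \<nu> \<tau> (UK q \<mu> \<nu>) \<otimes>\<^bsub>A_algebra q \<mu> \<nu> \<tau>\<^esub> A_proj q \<mu> \<nu> \<tau> (UK q \<mu> \<nu>)
      \<in> B_carrier q \<mu> \<nu> \<tau>"
    and B_K_E: "A_proj q \<mu> \<nu> \<tau> (UK q \<mu> \<nu>) \<otimes>\<^bsub>A_algebra q \<mu> \<nu> \<tau>\<^esub> A_proj q \<mu> \<nu> \<tau> (UE q \<mu> \<nu>)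
      \<in> B_carrier q \<mu> \<nu> \<tau>"
  unfolding B_carrier_def Let_def
  using star_subalgebra_generated[OF AS.complex_star_algebra_axioms, where X =
      "{A_proj q \<mu> \<nu> \<tau> (UK q \<mu> \<nu> \<otimes>\<^bsub>Uq q \<mu> \<nu>\<^esub> UK q \<mu> \<nu>), A_proj q \<mu> \<nu> \<tau> (UK q \<mu> \<nu> \<otimes>\<^bsub>Uq q \<mu> \<nu>\<^esub> UE q \<mu> \<nu>)}"]
  by (simp_all add: A_proj_simps)

lemma B_adj_closed:
  assumes "b \<in> B_carrier q \<mu> \<nu> \<tau>"
  shows "AS.adj \<mu> \<nu> \<tau> z b \<in> B_carrier q \<mu> \<nu> \<tau>"
proof -
  let ?A = "A_algebra q \<mu> \<nu> \<tau>" and ?B = "B_carrier q \<mu> \<nu> \<tau>"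
  let ?g = "\<lambda>z. A_proj q \<mu> \<nu> \<tau> (Uq_gen q \<mu> \<nu> z)"
  have Bsub: "?B \<subseteq> carrier ?A" and Bone: "\<one>\<^bsub>?A\<^esub> \<in> ?B"
    and Badd: "\<And>x y. \<lbrakk>x \<in> ?B; y \<in> ?B\<rbrakk> \<Longrightarrow> x \<oplus>\<^bsub>?A\<^esub> y \<in> ?B"
    and Bmult: "\<And>x y. \<lbrakk>x \<in> ?B; y \<in> ?B\<rbrakk> \<Longrightarrow> x \<otimes>\<^bsub>?A\<^esub> y \<in> ?B"
    and Bsmult: "\<And>c x. x \<in> ?B \<Longrightarrow> c \<odot>\<^bsub>?A\<^esub> x \<in> ?B"
    and Bstar: "\<And>x. x \<in> ?B \<Longrightarrow> star ?A x \<in> ?B"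
    using B_subalgebra[of \<mu> \<nu> \<tau>] by (auto simp: star_subalgebra_def)
  have Bc: "x \<in> carrier ?A" if "x \<in> ?B" for x using that Bsub by blast
  have Bzero: "\<zero>\<^bsub>?A\<^esub> \<in> ?B" using Bsmult[OF Bone, of 0] by simp
  \<comment> \<open>All generators are required at once because the closure conditions mix them:
    \<open>adj GE (x \<otimes> y)\<close> involves the operators of K and K^{-1}, and the star
    exchanges E with F and K with K^{-1}.\<close>
  define S where "S = {x \<in> ?B. \<forall>z. AS.adj \<mu> \<nu> \<tau> z x \<in> ?B}"
  have "star_subalgebra S ?A"
    unfolding star_subalgebra_def
  proof (intro conjI ballI allI)
    show "\<one>\<^bsub>?A\<^esub> \<in> S"
      using Bone Bsmult[OF Bone] by (simp add: S_def AS.adj_one del: AS.adj.simps)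
    fix x assume x: "x \<in> S"
    show "star ?A x \<in> S"
    proof -
      have "AS.adj \<mu> \<nu> \<tau> z (star ?A x) \<in> ?B" for z
        using x by (cases z) (simp_all add: S_def Bc AS.adj_K_star AS.adj_Kinv_star AS.adj_E_star
          AS.adj_F_star Bsmult Bstar del: AS.adj.simps AS.alg_star_simps)
      then show ?thesis using x by (simp add: S_def Bstar)
    qed
    show "c \<odot>\<^bsub>?A\<^esub> x \<in> S" for c
      using x by (simp add: S_def Bc Bsmult linear_maps_smult[OF AS.adj_linear] del: AS.adj.simps)
    fix y assume y: "y \<in> S"
    show "x \<oplus>\<^bsub>?A\<^esub> y \<in> S"
      using x y by (simp add: S_def Bc Badd linear_maps_add[OF AS.adj_linear] del: AS.adj.simps)
    show "x \<otimes>\<^bsub>?A\<^esub> y \<in> S"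
    proof -
      have "AS.adj \<mu> \<nu> \<tau> z (x \<otimes>\<^bsub>?A\<^esub> y) \<in> ?B" for z
        using x y by (cases z) (simp_all add: S_def Bc AS.adj_K_mult AS.adj_Kinv_mult AS.adj_E_mult
          AS.adj_F_mult Badd Bmult del: AS.adj.simps)
      then show ?thesis using x y by (simp add: S_def Bmult)
    qed
  qed (use Bsub in \<open>auto simp: S_def\<close>)
  moreover have "?g GK \<otimes>\<^bsub>?A\<^esub> ?g GK \<in> S"
  proof -
    \<comment> \<open>FK enters B only as the star of the generator KE.\<close>
    have "star ?A (?g GK \<otimes>\<^bsub>?A\<^esub> ?g GE) \<in> ?B"
      by (rule Bstar[OF B_K_E])
    then have FK: "?g GF \<otimes>\<^bsub>?A\<^esub> ?g GK \<in> ?B"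
      by (simp add: AS.star_g)
    have EK: "?g GE \<otimes>\<^bsub>?A\<^esub> ?g GK \<in> ?B"
      using Bsmult[OF B_K_E[of \<mu> \<nu> \<tau>], of "inverse q"] by (simp add: AS.K_E)
    \<comment> \<open>K and K^{-1} fix K^2, while E sends it to (1 - q^2) EK and F to (1 - q^{-2})
      FK.\<close>
    have "AS.adj \<mu> \<nu> \<tau> z (?g GK \<otimes>\<^bsub>?A\<^esub> ?g GK) \<in> ?B" for z
      by (cases z) (simp_all add: AS.K_norm B_K_K Badd Bsmult EK FK)
    then show ?thesis by (simp add: S_def B_K_K del: AS.adj.simps)
  qed
  moreover have "?g GK \<otimes>\<^bsub>?A\<^esub> ?g GE \<in> S"
  proof -
    have EK: "?g GE \<otimes>\<^bsub>?A\<^esub> ?g GK \<in> ?B"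
      using Bsmult[OF B_K_E[of \<mu> \<nu> \<tau>], of "inverse q"] by (simp add: AS.K_E)
    obtain c d where F: "AS.adj \<mu> \<nu> \<tau> GF (?g GK \<otimes>\<^bsub>?A\<^esub> ?g GE)
        = c \<odot>\<^bsub>?A\<^esub> \<one>\<^bsub>?A\<^esub> \<oplus>\<^bsub>?A\<^esub> d \<odot>\<^bsub>?A\<^esub> (?g GK \<otimes>\<^bsub>?A\<^esub> ?g GK)"
      by (rule A_adj_F_KE)
    \<comment> \<open>Both summands are multiples of E^2: since KEK^{-1} = qE, the result is qE^2 -
      qE^2.\<close>
    have E: "AS.adj \<mu> \<nu> \<tau> GE (?g GK \<otimes>\<^bsub>?A\<^esub> ?g GE) = \<zero>\<^bsub>?A\<^esub>"
      by (simp add: AS.K_norm AS.q_cancel AS.alg_cancel_right)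
    have "AS.adj \<mu> \<nu> \<tau> z (?g GK \<otimes>\<^bsub>?A\<^esub> ?g GE) \<in> ?B" for z
    proof (cases z)
      case GE
      then show ?thesis by (simp only: E Bzero)
    next
      case GF
      then show ?thesis by (simp only: F Badd Bsmult Bone B_K_K)
    qed (simp_all add: AS.K_norm Bsmult EK)
    then show ?thesis by (simp add: S_def B_K_E del: AS.adj.simps)
  qed
  ultimately have "?B \<subseteq> S"
    unfolding B_carrier_def[of q \<mu> \<nu> \<tau>] Let_def
    by (intro generated_star_subalgebra_minimal) (simp_all add: A_proj_simps)
  then show ?thesis
    using assms by (auto simp: S_def)
qed

lemma B_algebra_sel [simp]:
  "carrier (B_algebra q \<mu> \<nu> \<tau>) = B_carrier q \<mu> \<nu> \<tau>"
  "mult (B_algebra q \<mu> \<nu> \<tau>) = mult (A_algebra q \<mu> \<nu> \<tau>)"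
  "one (B_algebra q \<mu> \<nu> \<tau>) = one (A_algebra q \<mu> \<nu> \<tau>)"
  "zero (B_algebra q \<mu> \<nu> \<tau>) = zero (A_algebra q \<mu> \<nu> \<tau>)"
  "add (B_algebra q \<mu> \<nu> \<tau>) = add (A_algebra q \<mu> \<nu> \<tau>)"
  "smult (B_algebra q \<mu> \<nu> \<tau>) = smult (A_algebra q \<mu> \<nu> \<tau>)"
  "star (B_algebra q \<mu> \<nu> \<tau>) = star (A_algebra q \<mu> \<nu> \<tau>)"
  by (simp_all add: B_algebra_def)

text \<open>The identities are inherited from A. The new content is closure, which
  \<open>B_adj_closed\<close> gives for generators and \<open>Uq_induct\<close> extends to all of
  U_q(mu).\<close>

lemma B_is_action: "Uq_star_action q (B_algebra q \<mu> \<nu> \<tau>) \<mu> (AS.adj \<mu> \<nu> \<tau>) (A_action q \<mu> \<nu> \<tau>)"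
proof -
  interpret A: Uq_action q "A_algebra q \<mu> \<nu> \<tau>" \<mu> "AS.adj \<mu> \<nu> \<tau>" "A_action q \<mu> \<nu> \<tau>"
    by (rule A_is_action)
  interpret B: complex_star_algebra "B_algebra q \<mu> \<nu> \<tau>"
    unfolding B_algebra_def by (rule AS.complex_star_algebra_subalgebra[OF B_subalgebra])
  have Bc: "b \<in> carrier (A_algebra q \<mu> \<nu> \<tau>)" if "b \<in> B_carrier q \<mu> \<nu> \<tau>" for b
    using B_subalgebra[of \<mu> \<nu> \<tau>] that by (auto simp: star_subalgebra_def)
  have act: "A_action q \<mu> \<nu> \<tau> x b \<in> B_carrier q \<mu> \<nu> \<tau>"
    if "x \<in> carrier (Uq q \<mu> \<mu>)" "b \<in> B_carrier q \<mu> \<nu> \<tau>" for x b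
    using that(1)
    by (induction rule: Uq_induct)
       (use that(2) B_subalgebra[of \<mu> \<nu> \<tau>] in \<open>simp_all add: A.act_one A.act_gen_mult
          A.act_add_left A.act_smult_left Bc B_adj_closed star_subalgebra_def del: AS.adj.simps\<close>)
  show ?thesis
  proof (intro Uq_star_action.intro Uq_star_action_axioms.intro Uq_action.intro
      Uq_action_axioms.intro quantum_parameter_axioms B.complex_star_algebra_axioms)
    show "AS.adj \<mu> \<nu> \<tau> z \<in> linear_maps (B_algebra q \<mu> \<nu> \<tau>) (B_algebra q \<mu> \<nu> \<tau>)" for z
      by (rule linear_mapsI) (simp_all add: B_adj_closed Bc linear_maps_add[OF AS.adj_linear]
        linear_maps_smult[OF AS.adj_linear] del: AS.adj.simps)
    show "(\<lambda>x. A_action q \<mu> \<nu> \<tau> x v) \<in> linear_maps (Uq q \<mu> \<mu>) (B_algebra q \<mu> \<nu> \<tau>)"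
      if "v \<in> carrier (B_algebra q \<mu> \<nu> \<tau>)" for v
      using that by (intro linear_mapsI) (simp_all add: act Bc A.act_add_left A.act_smult_left)
  qed (simp_all add: Bc A.act_one A.act_gen_mult AS.adj_K_mult AS.adj_Kinv_mult AS.adj_E_mult
      AS.adj_F_mult AS.adj_one AS.adj_K_star AS.adj_Kinv_star AS.adj_E_star AS.adj_F_star
      counit_gen_def del: AS.adj.simps AS.alg_star_simps)
qed

end

theorem proposition2p7:
  fixes q \<mu> \<nu> \<tau> :: real
  assumes "0 < q" and "q < 1"
    and "\<mu> \<in> {-1, 0, 1}" and "\<nu> \<in> {-1, 0, 1}"
  shows "(\<forall>x \<in> carrier (Uq q \<mu> \<mu>). \<forall>b \<in> carrier (B_algebra q \<mu> \<nu> \<tau>).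
            A_action q \<mu> \<nu> \<tau> x b \<in> carrier (B_algebra q \<mu> \<nu> \<tau>))
       \<and> left_module_over (Uq q \<mu> \<mu>) (B_algebra q \<mu> \<nu> \<tau>) (A_action q \<mu> \<nu> \<tau>)
       \<and> left_module_star_algebra
           (Uq q \<mu> \<mu>) (Uq_comult q \<mu> \<mu> \<mu>) (Uq_counit q \<mu>) (Uq_antipode q \<mu> \<mu>)
           (B_algebra q \<mu> \<nu> \<tau>) (A_action q \<mu> \<nu> \<tau>)"
proof -
  interpret quantum_parameter q
    by unfold_locales (use assms in auto)
  interpret B: Uq_star_action q "B_algebra q \<mu> \<nu> \<tau>" \<mu> "AS.adj \<mu> \<nu> \<tau>" "A_action q \<mu> \<nu> \<tau>"
    by (rule B_is_action)
  show ?thesis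
    using B.act_closed B.left_module B.left_module_star_algebra by blast
qed

end
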